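(* Let $V=\mathfrak{sl}(2,\mathbb C)$ be the adjoint representation of $\mathfrak{sl}(2,\mathbb C)$, let $S(V)$ be the $\beta\gamma$-system of $V$, and let $\mathcal A=\widehat\psi(\mathcal O(\mathfrak{sl}(2,\mathbb C),-\tfrac38K))\subset S(V)$, where $K$ is the Killing form. Then $\mathcal A$ and the commutant $S(V)^{\mathcal A_+}=\mathrm{Com}(\mathcal A,S(V))$ form a Howe pair in $S(V)$, i.e. $$\mathcal A=\mathrm{Com}\big(\mathrm{Com}(\mathcal A,S(V)),S(V)\big).$$
   Context: Vertex algebras are over $\mathbb C$; the $n$-th product of $u,v$ is written $u\circ_n v$ (so $Y(u,z)v=\sum_n (u\circ_n v)z^{-n-1}$), $:uv:=u\circ_{-1}v$ is the Wick (normally ordered) product, and $u(z)v(w)\sim\sum_{n\ge0}(u\circ_n v)(w)(z-w)^{-n-1}$ denotes the OPE. Commutant: for a subset $U$ of a vertex algebra $W$, $\mathrm{Com}(U,W)=\{v\in W\mid u\circ_n v=0\ \text{for all } u\in U,\ n\ge0\}$, also written $W^{U_+}$. For a vertex subalgebra $U\subset W$, the pair $U$, $\mathrm{Com}(U,W)$ is called a Howe pair if $U=\mathrm{Com}(\mathrm{Com}(U,W),W)$. Current algebra: for a Lie algebra $\mathfrak g$ with symmetric invariant bilinear form $B$, $\mathcal O(\mathfrak g,B)$ is the universal affine vertex algebra generated by fields $u(z)$, $u\in\mathfrak g$, with $u(z)v(w)\sim B(u,v)(z-w)^{-2}+[u,v](w)(z-w)^{-1}$; its underlying space is the module induced from the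 one-dimensional representation of $\mathfrak g\otimes\mathbb C[t]\oplus\mathbb C c$ with $\mathfrak g\otimes\mathbb C[t]$ acting by $0$ and $c$ by $1$, to $\widehat{\mathfrak g}=\mathfrak g\otimes\mathbb C[t,t^{-1}]\oplus\mathbb Cc$, with $[u\otimes t^n,v\otimes t^m]=[u,v]\otimes t^{m+n}+nB(u,v)\delta_{m+n,0}c$. $\beta\gamma$-system: for a finite dimensional vector space $V$, $S(V)$ is the vertex algebra generated by fields $\beta^x(z)$ ($x\in V$, linear in $x$), $\gamma^{x'}(z)$ ($x'\in V^*$, linear in $x'$) with OPEs $\beta^x(z)\gamma^{x'}(w)\sim\langle x',x\rangle(z-w)^{-1}$, $\beta^x(z)\beta^y(w)\sim0$, $\gamma^{x'}(z)\gamma^{y'}(w)\sim0$; writing $\beta^x(z)=\sum_n\beta^x(n)z^{-n-1}$, $\gamma^{x'}(z)=\sum_n\gamma^{x'}(n)z^{-n-1}$, its underlying space is the Fock module generated by a vacuum vector killed by $\beta^x(n),\gamma^{x'}(n)$ for $n\ge0$, with PBW basis given by monomials in the modes $\beta^x(n),\gamma^{x'}(n)$, $n<0$. For $V=\mathfrak{sl}(2,\mathbb C)$ with standard basis $e,f,h$ ($[e,f]=h$, $[h,e]=2e$, $[h,f]=-2f$) and dual basis $e',f',h'$ of $V^*$, $\widehat\psi:\mathcal O(\mathfrak{sl}(2,\mathbb C),-\tfrac38K)\to S(V)$ is the vertex algebra homomorphism given on generators by $$e(z)\mapsto v^e(z)=4(:\gamma^{h'}(z)\gamma^{h'}(z):+:\gamma^{e'}(z)\gamma^{f'}(z):),$$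 $$f(z)\mapsto v^f(z)=-\tfrac1{16}(:\beta^{h}(z)\beta^{h}(z):+4:\beta^{e}(z)\beta^{f}(z):),$$ $$h(z)\mapsto v^h(z)=:\beta^{h}(z)\gamma^{h'}(z):+:\beta^{e}(z)\gamma^{e'}(z):+:\beta^{f}(z)\gamma^{f'}(z):.$$ Thus $\mathcal A$ is the vertex subalgebra of $S(V)$ generated by $v^e(z),v^f(z),v^h(z)$. *)

theory Defs
  imports
    "HOL-Analysis.Analysis"
    "HOL-Library.Multiset"
    "HOL-Library.Poly_Mapping"
    "HOL-Library.Groups_Big_Fun"
begin

section \<open>Vertex algebras over the complex numbers\<close>

text \<open>
  The underlying space is the whole type; its addition is that of the type, the remaining
  structure is collected in a record. \<open>nprod W u n v\<close> is the \<open>n\<close>-th product, so that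
  \<open>Y(u,z)v = \<Sum>n. nprod W u n v z^(-n-1)\<close>.
\<close>

record 'a vertex_data =
  scal :: "complex \<Rightarrow> 'a \<Rightarrow> 'a"
  vac :: 'a
  nprod :: "'a \<Rightarrow> int \<Rightarrow> 'a \<Rightarrow> 'a"

text \<open>
  The last clause is the Borcherds (Jacobi) identity. Its sums are over all \<open>j :: nat\<close>, but have
  finite support by the truncation clause; \<open>Sum_any\<close> sums over the support.
  The translation operator is \<open>u \<mapsto> nprod W u (-2) (vac W)\<close>.
\<close>

definition vertex_algebra :: "('a::ab_group_add) vertex_data \<Rightarrow> bool" where
  "vertex_algebra W \<longleftrightarrow>
     vector_space (scal W) \<and>
     (\<forall>u u' n v. nprod W (u + u') n v = nprod W u n v + nprod W u' n v) \<and>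
     (\<forall>u n v v'. nprod W u n (v + v') = nprod W u n v + nprod W u n v') \<and>
     (\<forall>c u n v. nprod W (scal W c u) n v = scal W c (nprod W u n v)) \<and>
     (\<forall>c u n v. nprod W u n (scal W c v) = scal W c (nprod W u n v)) \<and>
     (\<forall>u v. \<exists>N. \<forall>n\<ge>N. nprod W u n v = 0) \<and>
     (\<forall>n v. nprod W (vac W) n v = (if n = -1 then v else 0)) \<and>
     (\<forall>u. nprod W u (-1) (vac W) = u) \<and>
     (\<forall>u n. n \<ge> 0 \<longrightarrow> nprod W u n (vac W) = 0) \<and>
     (\<forall>u v w l m n.
        Sum_any (\<lambda>j::nat. scal W (of_int m gchoose j)
            (nprod W (nprod W u (l + int j) v) (m + n - int j) w)) =
        Sum_any (\<lambda>j::nat. scal W ((-1) ^ j * (of_int l gchoose j))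
            (nprod W u (m + l - int j) (nprod W v (n + int j) w)
             - scal W ((-1) powi l) (nprod W v (n + l - int j) (nprod W u (m + int j) w)))))"

definition vertex_hom ::
  "('a::ab_group_add) vertex_data \<Rightarrow> ('b::ab_group_add) vertex_data \<Rightarrow> ('a \<Rightarrow> 'b) \<Rightarrow> bool" where
  "vertex_hom W W' \<phi> \<longleftrightarrow>
     (\<forall>u v. \<phi> (u + v) = \<phi> u + \<phi> v) \<and>
     (\<forall>c u. \<phi> (scal W c u) = scal W' c (\<phi> u)) \<and>
     \<phi> (vac W) = vac W' \<and>
     (\<forall>u n v. \<phi> (nprod W u n v) = nprod W' (\<phi> u) n (\<phi> v))"

definition vertex_subalgebra :: "('a::ab_group_add) vertex_data \<Rightarrow> 'a set \<Rightarrow> bool" where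
  "vertex_subalgebra W U \<longleftrightarrow>
     vac W \<in> U \<and>
     (\<forall>u\<in>U. \<forall>v\<in>U. u + v \<in> U) \<and>
     (\<forall>c. \<forall>u\<in>U. scal W c u \<in> U) \<and>
     (\<forall>u\<in>U. \<forall>v\<in>U. \<forall>n. nprod W u n v \<in> U)"

definition Com :: "'a set \<Rightarrow> ('a::ab_group_add) vertex_data \<Rightarrow> 'a set" where
  "Com U W = {v. \<forall>u\<in>U. \<forall>n\<ge>0. nprod W u n v = 0}"

definition howe_pair :: "'a set \<Rightarrow> ('a::ab_group_add) vertex_data \<Rightarrow> bool" where
  "howe_pair U W \<longleftrightarrow> vertex_subalgebra W U \<and> U = Com (Com U W) W"


section \<open>Current algebras\<close>

text \<open>
  The Lie algebra is \<open>complex ^ 'i\<close> with bracket \<open>br\<close>, and \<open>B\<close> is an invariant form on it.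
  A word \<open>[(x1,n1),\<dots>,(xr,nr)]\<close> stands for \<open>(x1 t^n1) \<cdots> (xr t^nr)\<close> applied to the generator of
  the module induced to the affine Lie algebra, with the central element \<open>c\<close> already set to \<open>1\<close>.
  The induced module is the free vector space on words modulo the subspace \<open>vacuum_relations\<close>.
\<close>

type_synonym 'g word_space = "('g \<times> int) list \<Rightarrow>\<^sub>0 complex"

abbreviation word :: "complex \<Rightarrow> ('g \<times> int) list \<Rightarrow> 'g word_space" where
  "word c w \<equiv> Poly_Mapping.single w c"

inductive_set vacuum_relations ::
  "(complex^'i \<Rightarrow> complex^'i \<Rightarrow> complex^'i) \<Rightarrow> (complex^'i \<Rightarrow> complex^'i \<Rightarrow> complex) \<Rightarrow>
   (complex^'i) word_space set"
  for br :: "complex^'i \<Rightarrow> complex^'i \<Rightarrow> complex^'i"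
    and B :: "complex^'i \<Rightarrow> complex^'i \<Rightarrow> complex"
where
  zero: "0 \<in> vacuum_relations br B"
| add: "p \<in> vacuum_relations br B \<Longrightarrow> q \<in> vacuum_relations br B \<Longrightarrow> p + q \<in> vacuum_relations br B"
| scale: "p \<in> vacuum_relations br B \<Longrightarrow> Poly_Mapping.map ((*) c) p \<in> vacuum_relations br B"
| linear: "word 1 (w @ (a *s x + b *s y, n) # w') - word a (w @ (x, n) # w') - word b (w @ (y, n) # w')
     \<in> vacuum_relations br B"
| bracket: "word 1 (w @ (x, n) # (y, m) # w') - word 1 (w @ (y, m) # (x, n) # w')
      - word 1 (w @ (br x y, n + m) # w')
      - word (if n + m = 0 then of_int n * B x y else 0) (w @ w')
     \<in> vacuum_relations br B"
| vacuum: "n \<ge> 0 \<Longrightarrow> word 1 (w @ [(x, n)]) \<in> vacuum_relations br B"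

definition eval_words ::
  "('a::ab_group_add) vertex_data \<Rightarrow> ('g \<Rightarrow> 'a) \<Rightarrow> 'g word_space \<Rightarrow> 'a" where
  "eval_words W \<iota> p = (\<Sum>w\<in>Poly_Mapping.keys p.
     scal W (Poly_Mapping.lookup p w) (foldr (\<lambda>(x, n) v. nprod W (\<iota> x) n v) w (vac W)))"

text \<open>
  \<open>W\<close> together with the map \<open>\<iota>\<close> sending \<open>x\<close> to the state of the generating field \<open>x(z)\<close> is the
  universal affine vertex algebra of \<open>(br, B)\<close>. The last two clauses say that evaluation of words
  at the vacuum induces an isomorphism from the induced module onto \<open>W\<close>.
\<close>

definition current_algebra ::
  "(complex^'i \<Rightarrow> complex^'i \<Rightarrow> complex^'i) \<Rightarrow> (complex^'i \<Rightarrow> complex^'i \<Rightarrow> complex) \<Rightarrow>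
   ('a::ab_group_add) vertex_data \<Rightarrow> (complex^'i \<Rightarrow> 'a) \<Rightarrow> bool" where
  "current_algebra br B W \<iota> \<longleftrightarrow>
     vertex_algebra W \<and>
     (\<forall>a x b y. \<iota> (a *s x + b *s y) = scal W a (\<iota> x) + scal W b (\<iota> y)) \<and>
     (\<forall>x y. nprod W (\<iota> x) 0 (\<iota> y) = \<iota> (br x y)) \<and>
     (\<forall>x y. nprod W (\<iota> x) 1 (\<iota> y) = scal W (B x y) (vac W)) \<and>
     (\<forall>x y n. n \<ge> 2 \<longrightarrow> nprod W (\<iota> x) n (\<iota> y) = 0) \<and>
     (\<forall>v. \<exists>p. eval_words W \<iota> p = v) \<and>
     (\<forall>p. eval_words W \<iota> p = 0 \<longleftrightarrow> p \<in> vacuum_relations br B)"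


section \<open>The beta-gamma system of \<open>complex ^ 'i\<close>\<close>

text \<open>
  The mode \<open>(Beta i, k)\<close> stands for \<open>\<beta>(-k-1)\<close> at the \<open>i\<close>-th standard basis vector, and
  \<open>(Gamma i, k)\<close> for \<open>\<gamma>(-k-1)\<close> at the \<open>i\<close>-th dual basis vector. The Fock space is the polynomial
  ring in these modes; a monomial is a multiset of modes.
\<close>

datatype 'i letter = Beta 'i | Gamma 'i

type_synonym 'i mode = "'i letter \<times> nat"

type_synonym 'i fock = "'i mode multiset \<Rightarrow>\<^sub>0 complex"

definition fock_scale :: "complex \<Rightarrow> 'i fock \<Rightarrow> 'i fock" where
  "fock_scale c p = Poly_Mapping.map ((*) c) p"

definition fock_var :: "'i mode \<Rightarrow> 'i fock" where
  "fock_var x = Poly_Mapping.single {#x#} 1"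

definition fock_deriv :: "'i mode \<Rightarrow> 'i fock \<Rightarrow> 'i fock" where
  "fock_deriv x p = (\<Sum>M\<in>Poly_Mapping.keys p.
     Poly_Mapping.single (M - {#x#}) (of_nat (count M x) * Poly_Mapping.lookup p M))"

text \<open>
  The action of \<open>\<beta>(n)\<close> and \<open>\<gamma>(n)\<close>. The OPE is equivalent to \<open>[\<beta>(m), \<gamma>(n)] = 1\<close> for
  \<open>m + n = -1\<close> (same basis index), all other commutators being \<open>0\<close>. Hence for \<open>n \<ge> 0\<close> the operator
  \<open>\<beta>(n)\<close> is the derivative with respect to \<open>\<gamma>(-n-1)\<close>, and \<open>\<gamma>(n)\<close> is minus the derivative with
  respect to \<open>\<beta>(-n-1)\<close>.
\<close>

fun letter_field :: "'i letter \<Rightarrow> int \<Rightarrow> 'i fock \<Rightarrow> 'i fock" where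
  "letter_field (Beta i) n w =
     (if n < 0 then fock_var (Beta i, nat (-n-1)) * w else fock_deriv (Gamma i, nat n) w)"
| "letter_field (Gamma i) n w =
     (if n < 0 then fock_var (Gamma i, nat (-n-1)) * w else - fock_deriv (Beta i, nat n) w)"

text \<open>
  The \<open>n\<close>-th circle product of two fields \<open>a(z) = \<Sum>m. a m z^(-m-1)\<close> and \<open>b(z)\<close>; for \<open>n = -k-1\<close> it
  is the normally ordered product \<open>:(\<partial>^k a/k!) b:\<close>.
\<close>

definition circle_prod ::
  "(int \<Rightarrow> 'i fock \<Rightarrow> 'i fock) \<Rightarrow> int \<Rightarrow> (int \<Rightarrow> 'i fock \<Rightarrow> 'i fock) \<Rightarrow> (int \<Rightarrow> 'i fock \<Rightarrow> 'i fock)" where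
  "circle_prod a n b = (\<lambda>m w. Sum_any (\<lambda>j::nat. fock_scale ((-1) ^ j * (of_int n gchoose j))
     (a (n - int j) (b (m + int j) w) - fock_scale ((-1) powi n) (b (n + m - int j) (a (int j) w)))))"

text \<open>The field of the state \<open>a1(-k1-1) \<cdots> ar(-kr-1)\<close> applied to the vacuum.\<close>

fun monomial_field :: "'i mode list \<Rightarrow> int \<Rightarrow> 'i fock \<Rightarrow> 'i fock" where
  "monomial_field [] = (\<lambda>n w. if n = -1 then w else 0)"
| "monomial_field ((a, k) # xs) = circle_prod (letter_field a) (- int k - 1) (monomial_field xs)"

text \<open>
  The modes \<open>a(-k-1)\<close> commute with each other, so the field of a monomial does not depend on the
  order in which its factors are listed.
\<close>

definition fock_nprod :: "'i fock \<Rightarrow> int \<Rightarrow> 'i fock \<Rightarrow> 'i fock" where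
  "fock_nprod u n w = (\<Sum>M\<in>Poly_Mapping.keys u.
     fock_scale (Poly_Mapping.lookup u M) (monomial_field (SOME xs. mset xs = M) n w))"

definition beta_gamma_system :: "'i fock vertex_data" where
  "beta_gamma_system = \<lparr> scal = fock_scale, vac = 1, nprod = fock_nprod \<rparr>"

text \<open>
  The states of the fields \<open>\<beta>\<close> at a vector \<open>x\<close> and \<open>\<gamma>\<close> at a covector \<open>x'\<close>, the latter given by its
  coordinates in the dual basis.
\<close>

definition beta :: "complex^'i \<Rightarrow> 'i fock" where
  "beta x = (\<Sum>i\<in>UNIV. fock_scale (x $ i) (fock_var (Beta i, 0)))"

definition gamma :: "complex^'i \<Rightarrow> 'i fock" where
  "gamma x' = (\<Sum>i\<in>UNIV. fock_scale (x' $ i) (fock_var (Gamma i, 0)))"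

abbreviation wick :: "'i fock \<Rightarrow> 'i fock \<Rightarrow> 'i fock" where
  "wick u v \<equiv> nprod beta_gamma_system u (-1) v"


section \<open>The Lie algebra sl(2)\<close>

datatype sl2_index = Ie | If | Ih

instance sl2_index :: finite
proof
  have "UNIV = {Ie, If, Ih}" using sl2_index.exhaust by auto
  then show "finite (UNIV :: sl2_index set)" by (metis finite.emptyI finite.insertI)
qed

type_synonym sl2 = "complex ^ sl2_index"

definition sl2_e :: sl2 where "sl2_e = axis Ie 1"
definition sl2_f :: sl2 where "sl2_f = axis If 1"
definition sl2_h :: sl2 where "sl2_h = axis Ih 1"

definition sl2_bracket :: "sl2 \<Rightarrow> sl2 \<Rightarrow> sl2" where
  "sl2_bracket x y = (\<chi> i. case i of
      Ie \<Rightarrow> 2 * (x $ Ih * y $ Ie - x $ Ie * y $ Ih)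
    | If \<Rightarrow> - 2 * (x $ Ih * y $ If - x $ If * y $ Ih)
    | Ih \<Rightarrow> x $ Ie * y $ If - x $ If * y $ Ie)"

lemma sl2_bracket_basis:
  "sl2_bracket sl2_e sl2_f = sl2_h"
  "sl2_bracket sl2_h sl2_e = 2 *s sl2_e"
  "sl2_bracket sl2_h sl2_f = (-2) *s sl2_f"
  by (auto simp: vec_eq_iff sl2_bracket_def sl2_e_def sl2_f_def sl2_h_def axis_def
      split: sl2_index.split)

text \<open>The identification of \<open>sl2\<close> with the traceless matrices under the commutator.\<close>

definition sl2_matrix :: "sl2 \<Rightarrow> complex^2^2" where
  "sl2_matrix x = vector [vector [x $ Ih, x $ Ie], vector [x $ If, - (x $ Ih)]]"

lemma sl2_matrix_bracket:
  "sl2_matrix (sl2_bracket x y) = sl2_matrix x ** sl2_matrix y - sl2_matrix y ** sl2_matrix x"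
  by (simp add: vec_eq_iff forall_2 sl2_matrix_def sl2_bracket_def matrix_matrix_mult_def
      sum_2 algebra_simps)

lemma bij_betw_sl2_matrix: "bij_betw sl2_matrix UNIV {A. trace A = 0}"
proof (rule bij_betwI[where g = "\<lambda>A. \<chi> i. case i of Ie \<Rightarrow> A $ 1 $ 2 | If \<Rightarrow> A $ 2 $ 1 | Ih \<Rightarrow> A $ 1 $ 1"])
  show "sl2_matrix \<in> UNIV \<rightarrow> {A. trace A = 0}"
    by (auto simp: sl2_matrix_def trace_def sum_2)
  show "(\<chi> i. case i of Ie \<Rightarrow> sl2_matrix x $ 1 $ 2 | If \<Rightarrow> sl2_matrix x $ 2 $ 1
           | Ih \<Rightarrow> sl2_matrix x $ 1 $ 1) = x" for x
    by (auto simp: vec_eq_iff sl2_matrix_def split: sl2_index.split)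
  show "sl2_matrix (\<chi> i. case i of Ie \<Rightarrow> A $ 1 $ 2 | If \<Rightarrow> A $ 2 $ 1 | Ih \<Rightarrow> A $ 1 $ 1) = A"
    if "A \<in> {A. trace A = 0}" for A :: "complex^2^2"
    using that
    by (auto simp: vec_eq_iff forall_2 sl2_matrix_def trace_def sum_2 add_eq_0_iff)
qed auto

definition sl2_killing :: "sl2 \<Rightarrow> sl2 \<Rightarrow> complex" where
  "sl2_killing x y = trace (matrix (\<lambda>z. sl2_bracket x (sl2_bracket y z)))"

end

theory Submission
  imports Defs
begin

text \<open>
  Let \<open>\<theta>\<close> run over the currents of the adjoint action of \<open>sl(2)\<close> on \<open>S(V)\<close>. They commute with the
  generators of \<open>\<A>\<close>, so they lie in \<open>Com(\<A>)\<close>, and everything in \<open>Com(Com(\<A>))\<close> is killed by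
  their nonnegative modes. It therefore suffices that a vector killed by the nonnegative modes of
  \<open>\<theta>\<close> lies in \<open>\<A>\<close>. Its part of top degree is a polynomial on pairs \<open>(x, y)\<close> of arcs
  in \<open>sl(2)\<close> that is annihilated by \<open>sl(2)[t]\<close>, hence invariant under conjugation by elementary
  matrices over \<open>\<complex>[[t]]\<close>. Generically such a pair has a normal form depending only on the Gram
  matrix of \<open>(x, y)\<close> and a square root of \<open>(y, y)\<close>; comparing the two square roots shows that the
  polynomial becomes, after multiplication by a power of \<open>(y, y)\<^sub>0\<close>, a polynomial in the
  coefficients of the Gram matrix. These coefficients remain independent on \<open>(y, y)\<^sub>0 = 0\<close>, so the
  denominator cancels. The coefficients of the Gram matrix are the leading terms of the generators
  of \<open>\<A>\<close>, and induction on the degree finishes the argument.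
\<close>

section \<open>The Fock space as a polynomial ring\<close>

text \<open>Two currents \<open>theta_e\<close> and \<open>theta_f\<close> suffice because e and f
  generate sl(2), and both act nilpotently on letters: the flow of each is polynomial in time, so it
  makes sense with an arbitrary power series as parameter and integrates to conjugation by a
  unipotent matrix. Weyl elements and the torus are then words in these matrices. "Generically"
  means that certain constant coefficients do not vanish: over \<complex>[[t]] this is
  invertibility, and it also provides square roots, which enter because diagonalising y requires its
  eigenvalues. Identities between polynomials in the infinitely many modes are checked at complex
  points, a point being a pair of arcs. On the vertex algebra side the main tool is the formula for
  [a(m), u(n)] with a quadratic and u arbitrary: it turns annihilation by nonnegative modes into
  commutation of all modes. Moving a mode of a past one creation mode at a time isolates its leading
  part on polynomials.\<close>

abbreviation coef :: "('x \<Rightarrow>\<^sub>0 complex) \<Rightarrow> 'x \<Rightarrow> complex" where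
  "coef \<equiv> Poly_Mapping.lookup"

lemma lookup_fock_scale [simp]: "coef (fock_scale c p) M = c * coef p M"
  by (simp add: fock_scale_def Poly_Mapping.map.rep_eq when_def)

lemma fock_scale_eq_mult: "fock_scale c p = Poly_Mapping.single 0 c * p"
  by (simp add: fock_scale_def mult_map_scale_conv_mult)

interpretation fock: vector_space fock_scale
  by unfold_locales (auto intro!: poly_mapping_eqI simp: lookup_add algebra_simps)

interpretation fock_pair: vector_space_pair fock_scale fock_scale ..

abbreviation fock_linear :: "('i fock \<Rightarrow> 'i fock) \<Rightarrow> bool" where
  "fock_linear \<equiv> Vector_Spaces.linear fock_scale fock_scale"

lemma fock_linearI:
  assumes "\<And>u v. T (u + v) = T u + T v" "\<And>c u. T (fock_scale c u) = fock_scale c (T u)"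
  shows "fock_linear T"
  by unfold_locales (use assms in auto)

lemma fock_scale_mult_left [simp]: "fock_scale c p * q = fock_scale c (p * q)"
  by (simp add: fock_scale_eq_mult mult.assoc)

lemma fock_scale_mult_right [simp]: "p * fock_scale c q = fock_scale c (p * q)"
  by (simp add: fock_scale_eq_mult mult.left_commute)

lemma fock_linear_mult: "fock_linear (\<lambda>p. q * p)"
  by (rule fock_linearI) (simp_all add: algebra_simps)

lemma lookup_single_mult:
  fixes p :: "'x multiset \<Rightarrow>\<^sub>0 complex"
  shows "coef (Poly_Mapping.single K c * p) M = (if K \<subseteq># M then c * coef p (M - K) else 0)"
proof -
  have "coef (Poly_Mapping.single K c * p) M
      = (\<Sum>l. (c when K = l) * (\<Sum>q. coef p q when M = l + q))"
    by (simp add: lookup_mult lookup_single)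
  also have "\<dots> = (\<Sum>l. (c * (\<Sum>q. coef p q when M = K + q)) when l = K)"
    by (rule Sum_any.cong) (auto simp: when_def)
  also have "\<dots> = c * (\<Sum>q. coef p q when M = K + q)"
    by simp
  also have "(\<Sum>q. coef p q when M = K + q) = (if K \<subseteq># M then coef p (M - K) else 0)"
  proof (cases "K \<subseteq># M")
    case True
    then have eq: "(\<lambda>q. coef p q when M = K + q) = (\<lambda>q. coef p q when q = M - K)"
      by (auto simp: fun_eq_iff when_def)
    show ?thesis unfolding eq using True by simp
  next
    case False
    then have eq: "(\<lambda>q. coef p q when M = K + q) = (\<lambda>q. 0)"
      by (auto simp: fun_eq_iff when_def)
    show ?thesis unfolding eq using False by simp
  qed
  finally show ?thesis by simp
qed

lemma lookup_fock_var_mult [simp]: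
  "coef (fock_var x * p) M = (if x \<in># M then coef p (M - {#x#}) else 0)"
  by (simp add: fock_var_def lookup_single_mult)

lemma lookup_fock_deriv [simp]:
  "coef (fock_deriv x p) M = of_nat (count M x + 1) * coef p (add_mset x M)"
proof -
  have "coef (fock_deriv x p) M
      = (\<Sum>N\<in>Poly_Mapping.keys p. of_nat (count N x) * coef p N when N - {#x#} = M)"
    by (simp add: fock_deriv_def lookup_sum lookup_single)
  also have "\<dots> = (\<Sum>N\<in>Poly_Mapping.keys p. of_nat (count N x) * coef p N when N = add_mset x M)"
  proof (rule sum.cong [OF refl])
    fix N
    show "(of_nat (count N x) * coef p N when N - {#x#} = M)
        = (of_nat (count N x) * coef p N when N = add_mset x M)"
    proof (cases "x \<in># N")
      case True
      then have "N - {#x#} = M \<longleftrightarrow> N = add_mset x M"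
        by auto
      then show ?thesis by simp
    next
      case False
      then show ?thesis by (simp add: not_in_iff when_def)
    qed
  qed
  also have "\<dots> = of_nat (count M x + 1) * coef p (add_mset x M)"
    by (cases "add_mset x M \<in> Poly_Mapping.keys p")
      (auto simp: when_def sum.If_cases sum.delta in_keys_iff)
  finally show ?thesis .
qed

lemma fock_linear_deriv: "fock_linear (fock_deriv x)"
  by (rule fock_linearI) (auto intro!: poly_mapping_eqI simp: lookup_add algebra_simps)

lemma fock_deriv_var_mult:
  "fock_deriv x (fock_var y * p) = fock_var y * fock_deriv x p + (if x = y then p else 0)"
proof (rule poly_mapping_eqI)
  fix M
  show "coef (fock_deriv x (fock_var y * p)) M
     = coef (fock_var y * fock_deriv x p + (if x = y then p else 0)) M"
  proof (cases "x = y")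
    case True
    then show ?thesis
      by (cases "x \<in># M") (auto simp: lookup_add ring_distribs count_eq_zero_iff dest!: multi_member_split)
  next
    case False
    then show ?thesis
      by (auto simp: lookup_add ring_distribs)
  qed
qed

lemma fock_deriv_one [simp]: "fock_deriv x 1 = 0"
  by (rule poly_mapping_eqI) (simp add: lookup_one when_def)

lemma fock_deriv_commute: "fock_deriv x (fock_deriv y p) = fock_deriv y (fock_deriv x p)"
  by (rule poly_mapping_eqI) (cases "x = y"; simp add: add_mset_commute[of y x])

lemma fock_deriv_eventually_zero:
  "\<exists>N. \<forall>n\<ge>N. fock_deriv (a, n) p = 0"
proof -
  let ?A = "snd ` (\<Union>M\<in>Poly_Mapping.keys p. set_mset M)"
  have "finite ?A" by simp
  then obtain N where N: "\<And>n. n \<in> ?A \<Longrightarrow> n < N"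
    unfolding finite_nat_set_iff_bounded by auto
  have "fock_deriv (a, n) p = 0" if "n \<ge> N" for n
  proof (rule poly_mapping_eqI)
    fix M
    have "coef p (add_mset (a, n) M) = 0"
    proof (rule ccontr)
      assume "coef p (add_mset (a, n) M) \<noteq> 0"
      then have "add_mset (a, n) M \<in> Poly_Mapping.keys p"
        by (simp add: in_keys_iff)
      then have "(a, n) \<in> (\<Union>M\<in>Poly_Mapping.keys p. set_mset M)"
        by (intro UN_I[of "add_mset (a, n) M"]) simp_all
      then have "n \<in> ?A" by (rule rev_image_eqI) simp
      with N[of n] that show False by linarith
    qed
    then show "coef (fock_deriv (a, n) p) M = coef 0 M" by simp
  qed
  then show ?thesis by blast
qed

lemma single_add_mset: "Poly_Mapping.single (add_mset x M) (c::complex)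
    = fock_var x * Poly_Mapping.single M c"
  by (simp add: fock_var_def mult_single)

lemma fock_induct_single [case_names single add]:
  fixes p :: "'i fock"
  assumes single: "\<And>M c. P (Poly_Mapping.single M c)"
    and add: "\<And>p q. P p \<Longrightarrow> P q \<Longrightarrow> P (p + q)"
  shows "P p"
proof (induction p rule: update_induct)
  case const
  then show ?case using single[of 0 0] by simp
next
  case (update p a b)
  have "Poly_Mapping.update a b p = p + Poly_Mapping.single a b"
    using update(1) by (intro poly_mapping_eqI)
      (auto simp: lookup_update lookup_add lookup_single in_keys_iff)
  then show ?case using add update single by simp
qed

text \<open>States are built from the vacuum by creation modes, and the field of such a state is an
  iterated circle product; this rule follows that construction.\<close>

lemma fock_induct [case_names one scale add var]:
  assumes "P 1" and "\<And>c p. P p \<Longrightarrow> P (fock_scale c p)"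
    and "\<And>p q. P p \<Longrightarrow> P q \<Longrightarrow> P (p + q)" and "\<And>x p. P p \<Longrightarrow> P (fock_var x * p)"
  shows "P p"
proof (induction p rule: fock_induct_single)
  case (single M c)
  have "P (Poly_Mapping.single M 1)"
    by (induction M) (use assms in \<open>simp_all add: single_add_mset\<close>)
  then show ?case
    using assms(2)[of "Poly_Mapping.single M 1" c] by (simp add: fock_scale_def)
qed (use assms in blast)

section \<open>Letters and fields\<close>

text \<open>The antisymmetric form behind the OPE: the commutator of modes m and n of two letters is
  this scalar if m + n = -1, and zero otherwise.\<close>

fun letter_pairing :: "'i letter \<Rightarrow> 'i letter \<Rightarrow> complex" where
  "letter_pairing (Beta i) (Gamma j) = (if i = j then 1 else 0)"
| "letter_pairing (Gamma i) (Beta j) = (if i = j then - 1 else 0)"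
| "letter_pairing (Beta i) (Beta j) = 0"
| "letter_pairing (Gamma i) (Gamma j) = 0"

lemma fock_linear_neg: "fock_linear T \<Longrightarrow> fock_linear (\<lambda>w. - T w)"
  by (auto intro!: fock_linearI simp: fock_pair.linear_add fock_pair.linear_scale)

lemma fock_linear_letter:
  fixes a :: "'i letter"
  shows "fock_linear (letter_field a n)"
proof -
  have "letter_field (Beta i) n = (if n < 0 then (\<lambda>w. fock_var (Beta i, nat (-n-1)) * w)
      else fock_deriv (Gamma i, nat n))"
    "letter_field (Gamma i) n = (if n < 0 then (\<lambda>w. fock_var (Gamma i, nat (-n-1)) * w)
      else (\<lambda>w. - fock_deriv (Beta i, nat n) w))" for i :: 'i
    by (auto simp: fun_eq_iff)
  then show ?thesis
    by (cases a) (auto simp: fock_linear_mult fock_linear_deriv fock_linear_neg)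
qed

lemma letter_field_creation: "letter_field a (- int k - 1) w = fock_var (a, k) * w"
  by (cases a) auto

lemma letter_field_eventually_zero: "\<exists>N. \<forall>n\<ge>N. letter_field a n w = 0"
proof (cases a)
  case (Beta i)
  obtain N where N: "\<And>n. n \<ge> N \<Longrightarrow> fock_deriv (Gamma i, n) w = 0"
    using fock_deriv_eventually_zero by blast
  have "letter_field a n w = 0" if "n \<ge> int N" for n
    using that N[of "nat n"] Beta by auto
  then show ?thesis by blast
next
  case (Gamma i)
  obtain N where N: "\<And>n. n \<ge> N \<Longrightarrow> fock_deriv (Beta i, n) w = 0"
    using fock_deriv_eventually_zero by blast
  have "letter_field a n w = 0" if "n \<ge> int N" for n
    using that N[of "nat n"] Gamma by auto
  then show ?thesis by blast
qed

lemma letter_commutator: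
  "letter_field a m (letter_field b n w) = letter_field b n (letter_field a m w)
     + (if m + n = - 1 then fock_scale (letter_pairing a b) w else 0)"
proof -
  note [simp] = fock_deriv_var_mult fock_pair.linear_neg[OF fock_linear_deriv] 
  show ?thesis
    by (cases a; cases b; cases "m < 0"; cases "n < 0")
      (auto simp: fock_deriv_commute mult.left_commute split: if_splits)
qed

section \<open>Fields on the Fock space and their circle products\<close>

definition fock_field :: "(int \<Rightarrow> 'i fock \<Rightarrow> 'i fock) \<Rightarrow> bool" where
  "fock_field F \<longleftrightarrow> (\<forall>n. fock_linear (F n)) \<and> (\<forall>w. \<forall>\<^sub>F n in at_top. F n w = 0)"

lemma fock_field_linear: "fock_field F \<Longrightarrow> fock_linear (F n)"
  by (simp add: fock_field_def)

lemma fock_field_ev: "fock_field F \<Longrightarrow> \<forall>\<^sub>F n in at_top. F n w = 0"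
  by (simp add: fock_field_def)

lemma fock_field_ev_nat: "fock_field F \<Longrightarrow> \<forall>\<^sub>F j in sequentially. F (m + int j) w = 0"
proof -
  assume "fock_field F"
  then obtain N where "\<And>n. n \<ge> N \<Longrightarrow> F n w = 0"
    using fock_field_ev unfolding eventually_at_top_linorder by blast
  then have "F (m + int j) w = 0" if "j \<ge> nat (N - m)" for j
    using that by auto
  then show ?thesis unfolding eventually_sequentially by blast
qed

lemmas field_add = fock_pair.linear_add[OF fock_field_linear]
  and field_scale = fock_pair.linear_scale[OF fock_field_linear]
  and field_diff = fock_pair.linear_diff[OF fock_field_linear]
  and field_zero = fock_pair.linear_0[OF fock_field_linear]
  and field_sum = fock_pair.linear_sum[OF fock_field_linear]

lemma fock_field_letter: "fock_field (letter_field a)"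
  unfolding fock_field_def eventually_at_top_linorder
  using fock_linear_letter letter_field_eventually_zero by blast

lemmas letter_add = field_add[OF fock_field_letter]
  and letter_scale = field_scale[OF fock_field_letter]
  and letter_diff = field_diff[OF fock_field_letter]
  and letter_zero = field_zero[OF fock_field_letter]
  and letter_sum = field_sum[OF fock_field_letter]

lemma Sum_any_eq_sum_lessThan:
  fixes g :: "nat \<Rightarrow> 'b::comm_monoid_add"
  assumes "\<And>j. j \<ge> N \<Longrightarrow> g j = 0"
  shows "Sum_any g = (\<Sum>j<N. g j)"
  by (rule Sum_any.expand_superset) (use assms in \<open>auto simp: not_le[symmetric]\<close>)

lemma Sum_any_eq_sum_eventually:
  fixes g :: "nat \<Rightarrow> 'b::comm_monoid_add"
  assumes "\<forall>\<^sub>F j in sequentially. g j = 0"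
  shows "\<forall>\<^sub>F N in sequentially. Sum_any g = (\<Sum>j<N. g j)"
proof -
  obtain K where "\<And>j. j \<ge> K \<Longrightarrow> g j = 0"
    using assms unfolding eventually_sequentially by blast
  then have "Sum_any g = (\<Sum>j<N. g j)" if "N \<ge> K" for N
    using that by (intro Sum_any_eq_sum_lessThan) auto
  then show ?thesis unfolding eventually_sequentially by blast
qed

definition circle_term where
  "circle_term a n b m w j = fock_scale ((-1) ^ j * (of_int n gchoose j))
     (a (n - int j) (b (m + int j) w) - fock_scale ((-1) powi n) (b (n + m - int j) (a (int j) w)))"

lemma circle_prod_eq: "circle_prod a n b m w = Sum_any (circle_term a n b m w)"
  by (simp add: circle_prod_def circle_term_def[abs_def])

lemma circle_term_eventually_zero:
  assumes "fock_field a" "fock_field b"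
  shows "\<forall>\<^sub>F j in sequentially. circle_term a n b m w j = 0"
  using fock_field_ev_nat[OF assms(1), of 0 w] fock_field_ev_nat[OF assms(2), of m w]
  by eventually_elim (simp add: circle_term_def field_zero assms)

text \<open>Infinite sums are handled through this: for all large \<open>N\<close> every circle
  product occurring in an identity is a sum over the same range \<open>j < N\<close>, and the
  identity can be checked term by term.\<close>

lemma circle_prod_eventually:
  assumes "fock_field a" "fock_field b"
  shows "\<forall>\<^sub>F N in sequentially. circle_prod a n b m w = (\<Sum>j<N. circle_term a n b m w j)"
  unfolding circle_prod_eq
  by (rule Sum_any_eq_sum_eventually circle_term_eventually_zero assms)+

lemma fock_field_circle_prod:
  assumes a: "fock_field a" and b: "fock_field b"
  shows "fock_field (circle_prod a n b)"
  unfolding fock_field_def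
proof (intro conjI allI fock_linearI)
  note ev = circle_prod_eventually[OF a b]
  fix m u v
  have "\<forall>\<^sub>F N in sequentially. circle_prod a n b m (u + v) = circle_prod a n b m u + circle_prod a n b m v"
    using ev[of n m u] ev[of n m v] ev[of n m "u + v"]
    by eventually_elim
      (simp add: circle_term_def sum.distrib[symmetric] field_add a b fock.scale_right_distrib
        fock.scale_right_diff_distrib algebra_simps)
  then show "circle_prod a n b m (u + v) = circle_prod a n b m u + circle_prod a n b m v"
    by simp
next
  note ev = circle_prod_eventually[OF a b]
  fix m c u
  have "\<forall>\<^sub>F N in sequentially. circle_prod a n b m (fock_scale c u) = fock_scale c (circle_prod a n b m u)"
    using ev[of n m u] ev[of n m "fock_scale c u"]
    by eventually_elim
      (simp add: circle_term_def fock.scale_sum_right field_scale a b 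
        fock.scale_right_diff_distrib algebra_simps)
  then show "circle_prod a n b m (fock_scale c u) = fock_scale c (circle_prod a n b m u)"
    by simp
next
  fix w
  \<comment> \<open>Only finitely many \<open>a (int j) w\<close> are nonzero, so the second half of
    the circle terms asks \<open>b\<close> to vanish at large modes on finitely many vectors
    only.\<close>
  obtain J where J: "\<And>j. j \<ge> J \<Longrightarrow> a (0 + int j) w = 0"
    using fock_field_ev_nat[OF a] unfolding eventually_sequentially by blast
  have "\<forall>\<^sub>F m in at_top. \<forall>j\<in>{..<J}. b (n + m - int j) (a (int j) w) = 0"
  proof (rule eventually_ball_finite, simp, rule ballI)
    fix j
    obtain N where "\<And>k. k \<ge> N \<Longrightarrow> b k (a (int j) w) = 0"
      using fock_field_ev[OF b] unfolding eventually_at_top_linorder by blast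
    then show "\<forall>\<^sub>F m in at_top. b (n + m - int j) (a (int j) w) = 0"
      unfolding eventually_at_top_linorder by (intro exI[of _ "N - n + int j"]) auto
  qed
  moreover obtain M where "\<And>m. m \<ge> M \<Longrightarrow> b m w = 0"
    using fock_field_ev[OF b] unfolding eventually_at_top_linorder by blast
  then have "\<forall>\<^sub>F m in at_top. \<forall>j. b (m + int j) w = 0"
    unfolding eventually_at_top_linorder by (intro exI[of _ M]) auto
  ultimately show "\<forall>\<^sub>F m in at_top. circle_prod a n b m w = 0"
  proof eventually_elim
    case (elim m)
    have "circle_term a n b m w j = 0" for j
      using elim J[of j] by (cases "j < J") (auto simp: circle_term_def field_zero a b)
    then show ?case by (simp add: circle_prod_eq)
  qed
qed

lemma fock_field_add: "fock_field F \<Longrightarrow> fock_field G \<Longrightarrow> fock_field (\<lambda>m w. F m w + G m w)"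
  unfolding fock_field_def
proof (intro conjI allI fock_linearI)
  assume F: "(\<forall>n. fock_linear (F n)) \<and> (\<forall>w. \<forall>\<^sub>F n in at_top. F n w = 0)"
    and G: "(\<forall>n. fock_linear (G n)) \<and> (\<forall>w. \<forall>\<^sub>F n in at_top. G n w = 0)"
  show "\<forall>\<^sub>F n in at_top. F n w + G n w = 0" for w
    using F[THEN conjunct2, rule_format, of w] G[THEN conjunct2, rule_format, of w]
    by eventually_elim simp
qed (simp_all add: fock_pair.linear_add fock_pair.linear_scale fock.scale_right_distrib)

lemma fock_field_scale: "fock_field F \<Longrightarrow> fock_field (\<lambda>m w. fock_scale c (F m w))"
  unfolding fock_field_def
proof (intro conjI allI fock_linearI)
  assume F: "(\<forall>n. fock_linear (F n)) \<and> (\<forall>w. \<forall>\<^sub>F n in at_top. F n w = 0)"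
  show "\<forall>\<^sub>F n in at_top. fock_scale c (F n w) = 0" for w
    using F[THEN conjunct2, rule_format, of w] by eventually_elim simp
qed (simp_all add: fock_pair.linear_add fock_pair.linear_scale fock.scale_right_distrib mult.commute)

lemma circle_prod_add:
  assumes "fock_field a" "fock_field F" "fock_field G"
  shows "circle_prod a n (\<lambda>m w. F m w + G m w) = (\<lambda>m w. circle_prod a n F m w + circle_prod a n G m w)"
proof (intro ext)
  fix m w
  note FG = fock_field_add[OF assms(2,3)]
  have "\<forall>\<^sub>F N in sequentially. circle_prod a n (\<lambda>m w. F m w + G m w) m w
      = circle_prod a n F m w + circle_prod a n G m w"
    using circle_prod_eventually[OF assms(1) FG, of n m w]
      circle_prod_eventually[OF assms(1,2), of n m w]
      circle_prod_eventually[OF assms(1,3), of n m w]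
    by eventually_elim
      (simp add: circle_term_def sum.distrib[symmetric] field_add assms fock.scale_right_distrib
        fock.scale_right_diff_distrib algebra_simps)
  then show "circle_prod a n (\<lambda>m w. F m w + G m w) m w = circle_prod a n F m w + circle_prod a n G m w"
    by simp
qed

lemma circle_prod_scale:
  assumes "fock_field a" "fock_field F"
  shows "circle_prod a n (\<lambda>m w. fock_scale c (F m w)) = (\<lambda>m w. fock_scale c (circle_prod a n F m w))"
proof (intro ext)
  fix m w
  note F' = fock_field_scale[OF assms(2), of c]
  have "\<forall>\<^sub>F N in sequentially. circle_prod a n (\<lambda>m w. fock_scale c (F m w)) m w
      = fock_scale c (circle_prod a n F m w)"
    using circle_prod_eventually[OF assms(1) F', of n m w]
      circle_prod_eventually[OF assms(1,2), of n m w]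
    by eventually_elim
      (simp add: circle_term_def field_scale assms fock.scale_sum_right
        fock.scale_right_diff_distrib algebra_simps)
  then show "circle_prod a n (\<lambda>m w. fock_scale c (F m w)) m w = fock_scale c (circle_prod a n F m w)"
    by simp
qed

lemma fock_field_monomial: "fock_field (monomial_field xs)"
proof (induction xs)
  case Nil
  have "\<forall>\<^sub>F n in at_top. monomial_field [] n w = 0" for w :: "'a fock"
    by (rule eventually_mono[OF eventually_gt_at_top[of "-1"]]) auto
  then show ?case
    by (auto simp: fock_field_def intro!: fock_linearI)
next
  case (Cons x xs)
  then show ?case by (cases x) (simp add: fock_field_circle_prod fock_field_letter)
qed

text \<open>All creation modes commute, and so do all annihilation modes.\<close>

lemma circle_prod_letter_commute:
  assumes F: "fock_field F" and p: "p < 0" and q: "q < 0"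
  shows "circle_prod (letter_field a) p (circle_prod (letter_field b) q F)
       = circle_prod (letter_field b) q (circle_prod (letter_field a) p F)"
proof (intro ext)
  fix m w
  let ?A = "letter_field a" and ?B = "letter_field b"
  note A = fock_field_letter[of a] and B = fock_field_letter[of b]
  have "\<forall>\<^sub>F j in sequentially. ?A (int j) w = 0 \<and> ?B (int j) w = 0 \<and> F (m + int j) w = 0"
    using fock_field_ev_nat[OF A, of 0 w] fock_field_ev_nat[OF B, of 0 w] fock_field_ev_nat[OF F, of m w]
    by eventually_elim simp
  then obtain J where J: "\<And>j. j \<ge> J \<Longrightarrow> ?A (int j) w = 0" "\<And>j. j \<ge> J \<Longrightarrow> ?B (int j) w = 0"
      "\<And>j. j \<ge> J \<Longrightarrow> F (m + int j) w = 0"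
    unfolding eventually_sequentially by blast
  have "\<forall>\<^sub>F i in sequentially. \<forall>j\<in>{..<J}. F (p + m - int j + int i) (?A (int j) w) = 0
      \<and> F (q + m - int j + int i) (?B (int j) w) = 0"
    using fock_field_ev_nat[OF F] by (intro eventually_ball_finite) (auto intro: eventually_conj)
  then obtain K' where K': "\<And>i j. i \<ge> K' \<Longrightarrow> j < J \<Longrightarrow> F (p + m - int j + int i) (?A (int j) w) = 0"
      "\<And>i j. i \<ge> K' \<Longrightarrow> j < J \<Longrightarrow> F (q + m - int j + int i) (?B (int j) w) = 0"
    unfolding eventually_sequentially by (metis lessThan_iff)
  \<comment> \<open>One bound for both summation indices of both iterated products, so that the two
    double sums run over the same square and can be exchanged.\<close>
  define K where "K = max J K'"
  have AB: "?A (int j) (?B (int i) v) = ?B (int i) (?A (int j) v)" for i j v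
    by (subst letter_commutator) simp
  have AB': "?A (p - int j) (?B (q - int i) v) = ?B (q - int i) (?A (p - int j) v)" for i j v
    using p q by (subst letter_commutator) simp
  have Fz: "F (p + m - int j + int i) (?A (int j) w) = 0"
      "F (q + m - int j + int i) (?B (int j) w) = 0" if "i \<ge> K" for i j
    using that K'[of i j] J[of j] by (cases "j < J"; simp add: K_def field_zero[OF F])+
  note zeros = field_zero[OF F] letter_zero
  have Az: "?A (int j) w = 0" and Bz: "?B (int j) w = 0" and Fw: "F (m + int j) w = 0" if "j \<ge> K" for j
    using J that by (auto simp: K_def)
  have Fw2: "F (m + int j + int i) w = 0" if "i \<ge> K \<or> j \<ge> K" for i j
    using Fw[of "i + j"] that by (auto simp: algebra_simps)
  have ABz: "?A (int j) (?B (int i) w) = 0"  "?B (int j) (?A (int i) w) = 0" if "i \<ge> K \<or> j \<ge> K" for i j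
    using that AB[of i j w] AB[of j i w] by (auto simp: Az Bz zeros)
  define c d where "c j = (-1) ^ j * (of_int p gchoose j :: complex)"
    and "d j = (-1) ^ j * (of_int q gchoose j :: complex)" for j :: nat
  define s t where "s = ((-1) powi p :: complex)" and "t = ((-1) powi q :: complex)"
  have FB: "circle_prod ?B q F (m + int j) w
      = (\<Sum>i<K. circle_term ?B q F (m + int j) w i)" for j
    unfolding circle_prod_eq
    by (rule Sum_any_eq_sum_lessThan) (simp add: circle_term_def Bz Fw2 zeros)
  have FBA: "circle_prod ?B q F (p + m - int j) (?A (int j) w)
      = (\<Sum>i<K. circle_term ?B q F (p + m - int j) (?A (int j) w) i)" for j
    unfolding circle_prod_eq
    by (rule Sum_any_eq_sum_lessThan) (simp add: circle_term_def ABz Fz zeros)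
  have FA: "circle_prod ?A p F (m + int j) w
      = (\<Sum>i<K. circle_term ?A p F (m + int j) w i)" for j
    unfolding circle_prod_eq
    by (rule Sum_any_eq_sum_lessThan) (simp add: circle_term_def Az Fw2 zeros)
  have FAB: "circle_prod ?A p F (q + m - int j) (?B (int j) w)
      = (\<Sum>i<K. circle_term ?A p F (q + m - int j) (?B (int j) w) i)" for j
    unfolding circle_prod_eq
    by (rule Sum_any_eq_sum_lessThan) (simp add: circle_term_def ABz Fz zeros)
  have BFz: "circle_prod ?B q F (m + int j) w = 0" if "j \<ge> K" for j
  proof -
    have "F (q + (m + int j) - int i) (?B (int i) w) = 0" for i
      using Fz(2)[of j i] that by (simp add: algebra_simps)
    then show ?thesis using that by (simp add: FB circle_term_def Fw2 zeros)
  qed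
  have AFz: "circle_prod ?A p F (m + int j) w = 0" if "j \<ge> K" for j
  proof -
    have "F (p + (m + int j) - int i) (?A (int i) w) = 0" for i
      using Fz(1)[of j i] that by (simp add: algebra_simps)
    then show ?thesis using that by (simp add: FA circle_term_def Fw2 zeros)
  qed
  have lhs: "circle_prod ?A p (circle_prod ?B q F) m w
      = (\<Sum>j<K. circle_term ?A p (circle_prod ?B q F) m w j)"
    unfolding circle_prod_eq[of ?A]
    by (rule Sum_any_eq_sum_lessThan)
      (simp add: circle_term_def BFz Az zeros field_zero[OF fock_field_circle_prod[OF B F]])
  have rhs: "circle_prod ?B q (circle_prod ?A p F) m w
      = (\<Sum>j<K. circle_term ?B q (circle_prod ?A p F) m w j)"
    unfolding circle_prod_eq[of ?B]
    by (rule Sum_any_eq_sum_lessThan)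
      (simp add: circle_term_def AFz Bz zeros field_zero[OF fock_field_circle_prod[OF A F]])
  have TA: "circle_term ?A p G m' w' j
      = fock_scale (c j) (?A (p - int j) (G (m' + int j) w') - fock_scale s (G (p + m' - int j) (?A (int j) w')))"
    for G m' w' j by (simp add: circle_term_def c_def s_def)
  have TB: "circle_term ?B q G m' w' j
      = fock_scale (d j) (?B (q - int j) (G (m' + int j) w') - fock_scale t (G (q + m' - int j) (?B (int j) w')))"
    for G m' w' j by (simp add: circle_term_def d_def t_def)
  have "(\<Sum>j<K. circle_term ?A p (circle_prod ?B q F) m w j)
      = (\<Sum>j<K. \<Sum>i<K. fock_scale (c j * d i)
          (?A (p - int j) (?B (q - int i) (F (m + int j + int i) w))
           - fock_scale t (?A (p - int j) (F (q + (m + int j) - int i) (?B (int i) w)))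
           - fock_scale s (?B (q - int i) (F (p + m - int j + int i) (?A (int j) w)))
           + fock_scale (s * t) (F (q + (p + m - int j) - int i) (?B (int i) (?A (int j) w)))))"
    unfolding TA FB FBA TB
    by (simp only: letter_sum letter_scale letter_diff fock.scale_sum_right
        fock.scale_right_diff_distrib fock.scale_right_distrib fock.scale_scale sum_subtractf[symmetric])
      (simp add: algebra_simps)
  also have "\<dots> = (\<Sum>i<K. \<Sum>j<K. fock_scale (c j * d i)
          (?A (p - int j) (?B (q - int i) (F (m + int j + int i) w))
           - fock_scale t (?A (p - int j) (F (q + (m + int j) - int i) (?B (int i) w)))
           - fock_scale s (?B (q - int i) (F (p + m - int j + int i) (?A (int j) w)))
           + fock_scale (s * t) (F (q + (p + m - int j) - int i) (?B (int i) (?A (int j) w)))))"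
    by (rule sum.swap)
  also have "\<dots> = (\<Sum>i<K. \<Sum>j<K. fock_scale (d i * c j)
          (?B (q - int i) (?A (p - int j) (F (m + int i + int j) w))
           - fock_scale s (?B (q - int i) (F (p + (m + int i) - int j) (?A (int j) w)))
           - fock_scale t (?A (p - int j) (F (q + m - int i + int j) (?B (int i) w)))
           + fock_scale (t * s) (F (p + (q + m - int i) - int j) (?A (int j) (?B (int i) w)))))"
    by (intro sum.cong refl) (simp add: AB AB' algebra_simps)
  also have "\<dots> = (\<Sum>j<K. circle_term ?B q (circle_prod ?A p F) m w j)"
    unfolding TB FA FAB TA
    by (simp only: letter_sum letter_scale letter_diff fock.scale_sum_right
        fock.scale_right_diff_distrib fock.scale_right_distrib fock.scale_scale sum_subtractf[symmetric])
      (simp add: algebra_simps)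
  finally show "circle_prod ?A p (circle_prod ?B q F) m w = circle_prod ?B q (circle_prod ?A p F) m w"
    unfolding lhs rhs .
qed

section \<open>State-field correspondence\<close>

lemma monomial_field_append_Cons:
  "monomial_field (xs @ y # ys) = monomial_field (y # xs @ ys)"
proof (induction xs)
  case (Cons x xs)
  obtain a k b l where [simp]: "x = (a, k)" "y = (b, l)" by (cases x, cases y)
  show ?case
    using Cons circle_prod_letter_commute[OF fock_field_monomial[of "xs @ ys"],
        of "- int k - 1" "- int l - 1" a b] by simp
qed simp

text \<open>This makes the listing chosen by \<open>SOME\<close> in \<open>fock_nprod\<close>
  immaterial.\<close>

lemma monomial_field_mset_cong:
  "mset xs = mset ys \<Longrightarrow> monomial_field xs = monomial_field ys"
proof (induction xs arbitrary: ys)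
  case (Cons x xs)
  then have "x \<in> set ys" by (metis list.set_intros(1) set_mset_mset)
  then obtain us vs where ys: "ys = us @ x # vs" by (meson split_list)
  then have "mset xs = mset (us @ vs)" using Cons.prems by simp
  then have "monomial_field xs = monomial_field (us @ vs)"
    by (rule Cons.IH)
  then have "monomial_field (x # xs) = monomial_field (x # us @ vs)"
    by (cases x) simp
  then show ?case by (simp only: ys monomial_field_append_Cons)
qed simp

definition mset_field :: "'i mode multiset \<Rightarrow> int \<Rightarrow> 'i fock \<Rightarrow> 'i fock" where
  "mset_field M = monomial_field (SOME xs. mset xs = M)"

lemma mset_field_mset: "mset_field (mset xs) = monomial_field xs"
  unfolding mset_field_def by (rule monomial_field_mset_cong, rule someI) (rule refl)

lemma mset_field_empty: "mset_field {#} n w = (if n = -1 then w else 0)"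
  by (simp add: mset_field_mset[of "[]", simplified])

lemma mset_field_add_mset:
  "mset_field (add_mset (a, k) M) = circle_prod (letter_field a) (- int k - 1) (mset_field M)"
proof -
  obtain xs where M: "M = mset xs" by (metis ex_mset)
  show ?thesis
    using mset_field_mset[of "(a, k) # xs"] by (simp add: M mset_field_mset)
qed

lemma fock_field_mset: "fock_field (mset_field M)"
  by (simp add: mset_field_def fock_field_monomial)

lemma fock_nprod_superset:
  assumes "finite S" "Poly_Mapping.keys u \<subseteq> S"
  shows "fock_nprod u n w = (\<Sum>M\<in>S. fock_scale (coef u M) (mset_field M n w))"
  unfolding fock_nprod_def mset_field_def
  by (rule sum.mono_neutral_left) (use assms in \<open>auto simp: in_keys_iff\<close>)

lemma nprod_single: "fock_nprod (Poly_Mapping.single M c) n w = fock_scale c (mset_field M n w)"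
  by (subst fock_nprod_superset[of "{M}"]) auto

lemma nprod_add: "fock_nprod (u + v) n w = fock_nprod u n w + fock_nprod v n w"
proof -
  let ?S = "Poly_Mapping.keys u \<union> Poly_Mapping.keys v"
  have "Poly_Mapping.keys (u + v) \<subseteq> ?S" by (rule keys_add)
  then show ?thesis
    by (simp add: fock_nprod_superset[of ?S] lookup_add fock.scale_left_distrib sum.distrib)
qed

lemma nprod_scale: "fock_nprod (fock_scale c u) n w = fock_scale c (fock_nprod u n w)"
proof -
  have "Poly_Mapping.keys (fock_scale c u) \<subseteq> Poly_Mapping.keys u" by (auto simp: in_keys_iff)
  then show ?thesis
    by (simp add: fock_nprod_superset[of "Poly_Mapping.keys u"] fock.scale_sum_right)
qed

lemma nprod_linear: "fock_linear (\<lambda>u. fock_nprod u n w)"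
  by (rule fock_linearI) (simp_all add: nprod_add nprod_scale)

lemmas nprod_zero [simp] = fock_pair.linear_0[OF nprod_linear]

lemma fock_field_nprod: "fock_field (fock_nprod u)"
proof (induction u rule: fock_induct_single)
  case (single M c)
  have "fock_nprod (Poly_Mapping.single M c) = (\<lambda>n w. fock_scale c (mset_field M n w))"
    by (simp add: nprod_single fun_eq_iff)
  then show ?case by (simp add: fock_field_scale fock_field_mset)
next
  case (add p q)
  moreover have "fock_nprod (p + q) = (\<lambda>n w. fock_nprod p n w + fock_nprod q n w)"
    by (simp add: nprod_add fun_eq_iff)
  ultimately show ?case by (simp add: fock_field_add)
qed

lemmas nprod_add_right = field_add[OF fock_field_nprod]
  and nprod_scale_right = field_scale[OF fock_field_nprod]
  and nprod_diff_right = field_diff[OF fock_field_nprod]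
  and nprod_zero_right [simp] = field_zero[OF fock_field_nprod]

lemma nprod_one: "fock_nprod 1 n w = (if n = -1 then w else 0)"
  using nprod_single[of 0 1 n w] by (simp add: mset_field_empty)

text \<open>The working form of the state-field correspondence: linearity extends the recursion of
  \<open>monomial_field\<close> from monomials to all states.\<close>

lemma nprod_var_mult:
  "fock_nprod (fock_var (a, k) * u) = circle_prod (letter_field a) (- int k - 1) (fock_nprod u)"
proof (induction u rule: fock_induct_single)
  case (single M c)
  have "fock_nprod (fock_var (a, k) * Poly_Mapping.single M c)
      = (\<lambda>n w. fock_scale c (mset_field (add_mset (a, k) M) n w))"
    by (simp add: single_add_mset[symmetric] nprod_single fun_eq_iff)
  also have "\<dots> = circle_prod (letter_field a) (- int k - 1) (\<lambda>n w. fock_scale c (mset_field M n w))"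
    unfolding circle_prod_scale[OF fock_field_letter fock_field_mset] mset_field_add_mset ..
  also have "(\<lambda>n w. fock_scale c (mset_field M n w)) = fock_nprod (Poly_Mapping.single M c)"
    by (simp add: nprod_single fun_eq_iff)
  finally show ?case .
next
  case (add p q)
  have "fock_nprod (fock_var (a, k) * (p + q))
      = (\<lambda>n w. circle_prod (letter_field a) (- int k - 1) (fock_nprod p) n w
          + circle_prod (letter_field a) (- int k - 1) (fock_nprod q) n w)"
    by (simp add: distrib_left nprod_add fun_eq_iff add)
  also have "\<dots> = circle_prod (letter_field a) (- int k - 1) (\<lambda>n w. fock_nprod p n w + fock_nprod q n w)"
    by (simp add: circle_prod_add fock_field_letter fock_field_nprod)
  also have "(\<lambda>n w. fock_nprod p n w + fock_nprod q n w) = fock_nprod (p + q)"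
    by (simp add: nprod_add fun_eq_iff)
  finally show ?case .
qed

lemma nprod_letter:
  assumes "p < 0"
  shows "fock_nprod (letter_field a p u) = circle_prod (letter_field a) p (fock_nprod u)"
proof -
  obtain k where p: "p = - int k - 1"
    by (rule that[of "nat (- 1 - p)"]) (use assms in simp)
  show ?thesis
    unfolding p letter_field_creation by (rule nprod_var_mult)
qed

lemma letter_field_one: "letter_field a (int j) 1 = 0"
  by (cases a) auto

text \<open>Annihilation modes kill the vacuum, so the second half of each circle term drops out; by
  induction the first half survives only for \<open>j = 0\<close> and \<open>n = -1\<close>.\<close>

lemma nprod_vacuum: "n \<ge> - 1 \<Longrightarrow> fock_nprod u n 1 = (if n = - 1 then u else 0)"
proof (induction u arbitrary: n rule: fock_induct)
  case (var x u)
  obtain a k where x: "x = (a, k)" by (cases x)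
  have "circle_term (letter_field a) (- int k - 1) (fock_nprod u) n 1 j
      = (if j = 0 then if n = -1 then fock_var x * u else 0 else 0)" for j
    using var letter_field_creation[of a k u]
    by (auto simp: circle_term_def letter_field_one x letter_zero)
  then show ?case
    by (simp add: x nprod_var_mult circle_prod_eq)
qed (simp_all add: nprod_one nprod_scale nprod_add)

lemma minus_one_gchoose: "((-1::complex) gchoose j) = (-1) ^ j"
  using gbinomial_negated_upper[of "-1::complex" j] by (simp add: gbinomial_binomial[symmetric] binomial_gbinomial[symmetric])

text \<open>In the (-1)-product with the identity field exactly one summand can survive: it comes
  from the first half of the circle term when \<open>n < 0\<close> and from the second half
  otherwise.\<close>

lemma nprod_var: "fock_nprod (fock_var (a, 0)) n w = letter_field a n w"
proof -
  have "circle_term (letter_field a) (- 1) (fock_nprod 1) n w j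
      = (if j = (if n < 0 then nat (- 1 - n) else nat n) then letter_field a n w else 0)" for j
    by (auto simp: circle_term_def nprod_one letter_zero minus_one_gchoose power_mult_distrib[symmetric])
  then show ?thesis
    using nprod_var_mult[of a 0 1] by (simp add: circle_prod_eq)
qed

section \<open>Commutator formulas\<close>

text \<open>Pascal's rule under a finitely supported sum; it yields the recursion in
  \<open>m\<close> of the left side and the recursion in \<open>l\<close> of the right side of the
  Borcherds identity.\<close>

lemma Sum_any_gbinomial_Suc:
  assumes "\<forall>\<^sub>F j in sequentially. g j = 0"
  shows "Sum_any (\<lambda>j::nat. fock_scale ((a + 1) gchoose j) (g j))
    = Sum_any (\<lambda>j. fock_scale (a gchoose j) (g j)) + Sum_any (\<lambda>j. fock_scale (a gchoose j) (g (Suc j)))"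
proof -
  obtain N where N: "\<And>j. j \<ge> N \<Longrightarrow> g j = 0"
    using assms unfolding eventually_sequentially by blast
  have "Sum_any (\<lambda>j::nat. fock_scale ((a + 1) gchoose j) (g j))
      = (\<Sum>j<Suc N. fock_scale ((a + 1) gchoose j) (g j))"
    by (rule Sum_any_eq_sum_lessThan) (simp add: N)
  also have "\<dots> = g 0 + (\<Sum>j<N. fock_scale (a gchoose Suc j) (g (Suc j)))
      + (\<Sum>j<N. fock_scale (a gchoose j) (g (Suc j)))"
    by (simp add: sum.lessThan_Suc_shift gbinomial_Suc_Suc fock.scale_left_distrib sum.distrib del: sum.lessThan_Suc)
  also have "g 0 + (\<Sum>j<N. fock_scale (a gchoose Suc j) (g (Suc j)))
      = (\<Sum>j<Suc N. fock_scale (a gchoose j) (g j))"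
    by (simp add: sum.lessThan_Suc_shift del: sum.lessThan_Suc)
  also have "\<dots> = Sum_any (\<lambda>j. fock_scale (a gchoose j) (g j))"
    by (rule Sum_any_eq_sum_lessThan[symmetric]) (simp add: N)
  also have "(\<Sum>j<N. fock_scale (a gchoose j) (g (Suc j)))
      = Sum_any (\<lambda>j. fock_scale (a gchoose j) (g (Suc j)))"
    by (rule Sum_any_eq_sum_lessThan[symmetric]) (simp add: N)
  finally show ?thesis .
qed

text \<open>The two sides of the Borcherds identity for a state whose modes are \<open>T\<close>.
  Keeping \<open>T\<close> an arbitrary family of operators lets the same induction serve for
  letters and for quadratic states.\<close>

definition borcherds_left where
  "borcherds_left T u l m n w = Sum_any (\<lambda>j::nat. fock_scale (of_int m gchoose j)
     (fock_nprod (T (l + int j) u) (m + n - int j) w))"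

definition borcherds_right where
  "borcherds_right T u l m n w = Sum_any (\<lambda>j::nat. fock_scale (of_int l gchoose j)
     (fock_scale ((-1) ^ j) (T (m + l - int j) (fock_nprod u (n + int j) w)
       - fock_scale ((-1) powi l) (fock_nprod u (n + l - int j) (T (m + int j) w)))))"

lemma borcherds_left_Suc:
  assumes T: "fock_field T"
  shows "borcherds_left T u l (m + 1) n w = borcherds_left T u l m (n + 1) w + borcherds_left T u (l + 1) m n w"
proof -
  have "\<forall>\<^sub>F j in sequentially. fock_nprod (T (l + int j) u) (m + 1 + n - int j) w = 0"
    using fock_field_ev_nat[OF T, of l u] by eventually_elim simp
  from Sum_any_gbinomial_Suc[OF this, of "of_int m"] show ?thesis
    by (simp add: borcherds_left_def algebra_simps)
qed

lemma borcherds_right_ev: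
  assumes T: "fock_field T"
  shows "\<forall>\<^sub>F j in sequentially. fock_scale ((-1) ^ j) (T (p - int j) (fock_nprod u (n + int j) w)
       - fock_scale s (fock_nprod u (q - int j) (T (m + int j) w))) = 0"
  using fock_field_ev_nat[OF T, of m w] fock_field_ev_nat[OF fock_field_nprod, of u n w]
  by eventually_elim (simp add: field_zero[OF T])

lemma borcherds_right_Suc:
  assumes T: "fock_field T"
  shows "borcherds_right T u (l + 1) m n w = borcherds_right T u l (m + 1) n w - borcherds_right T u l m (n + 1) w"
proof -
  note ev = borcherds_right_ev[OF T]
  have s: "(-1) powi (l + 1) = (- ((-1) powi l) :: complex)"
    by (simp add: power_int_add_1)
  have 1: "Sum_any (\<lambda>j. fock_scale (of_int l gchoose j)
      (fock_scale ((-1) ^ j) (T (m + (l + 1) - int j) (fock_nprod u (n + int j) w)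
       - fock_scale ((-1) powi (l + 1)) (fock_nprod u (n + (l + 1) - int j) (T (m + int j) w)))))
     + Sum_any (\<lambda>j. fock_scale (of_int l gchoose j)
      (fock_scale ((-1) ^ Suc j) (T (m + (l + 1) - int (Suc j)) (fock_nprod u (n + int (Suc j)) w)
       - fock_scale ((-1) powi (l + 1)) (fock_nprod u (n + (l + 1) - int (Suc j)) (T (m + int (Suc j)) w)))))
     = borcherds_right T u (l + 1) m n w"
    unfolding borcherds_right_def of_int_add of_int_1
    by (rule Sum_any_gbinomial_Suc[symmetric, OF ev])
  have ev': "\<forall>\<^sub>F j in sequentially. fock_scale (c j) (fock_scale ((-1) ^ (f j)) (T (p - int (f j)) (fock_nprod u (n + int (f j)) w)
       - fock_scale s (fock_nprod u (q - int (f j)) (T (m + int (f j)) w)))) = 0"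
    if f: "filterlim f sequentially sequentially" for c f p n s q m
    using eventually_compose_filterlim[OF ev[where p=p and n=n and s=s and q=q and m=m and u=u and w=w] f]
    by eventually_elim simp
  note evs = Sum_any_eq_sum_eventually[OF ev'[OF filterlim_ident]]
    Sum_any_eq_sum_eventually[OF ev'[OF filterlim_Suc]]
  have "\<forall>\<^sub>F N in sequentially. borcherds_right T u (l + 1) m n w
      = borcherds_right T u l (m + 1) n w - borcherds_right T u l m (n + 1) w"
    unfolding 1[symmetric] unfolding borcherds_right_def
    using evs(1)[of "\<lambda>j. of_int l gchoose j" "m + (l + 1)" n "(-1) powi (l + 1)" "n + (l + 1)" m]
      evs(2)[of "\<lambda>j. of_int l gchoose j" "m + (l + 1)" n "(-1) powi (l + 1)" "n + (l + 1)" m]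
      evs(1)[of "\<lambda>j. of_int l gchoose j" "m + 1 + l" n "(-1) powi l" "n + l" "m + 1"]
      evs(1)[of "\<lambda>j. of_int l gchoose j" "m + l" "n + 1" "(-1) powi l" "n + 1 + l" m]
  proof eventually_elim
    case (elim N)
    show ?case
      unfolding elim unfolding sum.distrib[symmetric] sum_subtractf[symmetric] s
      by (intro sum.cong refl) (simp add: fock.scale_right_diff_distrib algebra_simps)
  qed
  then show ?thesis by simp
qed

lemma borcherds_right_zero_right:
  "borcherds_right T u l 0 n w = circle_prod T l (fock_nprod u) n w"
  unfolding borcherds_right_def circle_prod_eq circle_term_def[abs_def]
  by (simp add: mult.commute add.commute)

lemma borcherds_left_zero_right:
  "borcherds_left T u l 0 n w = fock_nprod (T l u) n w"
proof -
  have "borcherds_left T u l 0 n w = Sum_any (\<lambda>j::nat. if j = 0 then fock_nprod (T l u) n w else 0)"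
    unfolding borcherds_left_def by (intro Sum_any.cong) (auto simp: gbinomial_0_left)
  then show ?thesis by simp
qed

lemma borcherds_right_zero_left:
  "borcherds_right T u 0 m n w = T m (fock_nprod u n w) - fock_nprod u n (T m w)"
proof -
  have "borcherds_right T u 0 m n w
      = Sum_any (\<lambda>j::nat. if j = 0 then T m (fock_nprod u n w) - fock_nprod u n (T m w) else 0)"
    unfolding borcherds_right_def by (intro Sum_any.cong) (auto simp: gbinomial_0_left)
  then show ?thesis by simp
qed

text \<open>The difference \<open>D l m n\<close> of the two sides satisfies
  \<open>D (l + 1) m n = D l (m + 1) n - D l m (n + 1)\<close>, which propagates its vanishing from \<open>l = 0\<close> and
  from \<open>m = 0\<close>, \<open>l < 0\<close> to all indices.\<close>

lemma borcherds_identity: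
  assumes T: "fock_field T"
    and comm: "\<And>m n w. T m (fock_nprod u n w) - fock_nprod u n (T m w) = borcherds_left T u 0 m n w"
    and iter: "\<And>l n w. l < 0 \<Longrightarrow> fock_nprod (T l u) n w = circle_prod T l (fock_nprod u) n w"
  shows "borcherds_left T u l m n w = borcherds_right T u l m n w"
proof -
  define D where "D l m n = borcherds_left T u l m n w - borcherds_right T u l m n w" for l m n
  have rec: "D (l + 1) m n = D l (m + 1) n - D l m (n + 1)" for l m n
    unfolding D_def borcherds_left_Suc[OF T] borcherds_right_Suc[OF T] by simp
  have D0: "D 0 m n = 0" for m n
    by (simp add: D_def borcherds_right_zero_left comm)
  have neg0: "D l 0 n = 0" if "l < 0" for l n
    by (simp add: D_def borcherds_right_zero_right borcherds_left_zero_right iter that)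
  have pos: "D (int k) m n = 0" for k m n
  proof (induction k arbitrary: m n)
    case (Suc k)
    then show ?case using rec[of "int k" m n] by (simp add: add.commute)
  qed (simp add: D0)
  have neg: "D (- int k) m n = 0" for k m n
  proof (induction k arbitrary: m n)
    case (Suc k)
    have step: "D (- int (Suc k)) (m + 1) n = D (- int (Suc k)) m (n + 1)" for m n
      using rec[of "- int (Suc k)" m n] Suc by simp
    show ?case
    proof (induction m arbitrary: n rule: int_induct[where k = 0])
      case base
      then show ?case by (rule neg0) simp
    next
      case (step1 i)
      then show ?case using step[of i n] by simp
    next
      case (step2 i)
      then show ?case using step[of "i - 1" "n - 1"] by simp
    qed
  qed (simp add: D0)
  have "D l m n = 0"
    using pos[of "nat l" m n] neg[of "nat (- l)" m n] by (cases "l \<ge> 0") simp_all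
  then show ?thesis by (simp add: D_def)
qed

text \<open>\<open>T m\<close> passes through a circle product with a letter like a derivation, up
  to the corrections \<open>R\<close>. The derivation part is the induction hypothesis;
  \<open>K\<close> says that the corrections, summed over the circle product, match what
  \<open>R\<close> adds to the right-hand side.\<close>

lemma commutator_formula_induct:
  fixes T :: "int \<Rightarrow> 'i fock \<Rightarrow> 'i fock" and R :: "'i letter \<Rightarrow> int \<Rightarrow> int \<Rightarrow> 'i fock \<Rightarrow> 'i fock"
  assumes T: "fock_field T" and T1: "\<And>j. T (int j) 1 = 0"
    and R: "\<And>m b p w. T m (letter_field b p w) = letter_field b p (T m w) + R b m p w"
    and K: "\<And>b k u m n w. Sum_any (\<lambda>j::nat. fock_scale ((-1) ^ j * (of_int (- int k - 1) gchoose j))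
          (R b m (- int k - 1 - int j) (fock_nprod u (n + int j) w)
           - fock_scale ((-1) powi (- int k - 1)) (fock_nprod u (- int k - 1 + n - int j) (R b m (int j) w))))
        = Sum_any (\<lambda>i::nat. fock_scale (of_int m gchoose i)
            (fock_nprod (R b (int i) (- int k - 1) u) (m + n - int i) w))"
  shows "T m (fock_nprod u n w) - fock_nprod u n (T m w) = borcherds_left T u 0 m n w"
proof -
  have left_ev: "\<forall>\<^sub>F N in sequentially. borcherds_left T u 0 m n w
     = (\<Sum>j<N. fock_scale (of_int m gchoose j) (fock_nprod (T (0 + int j) u) (m + n - int j) w))" for u m n w
  proof -
    have "\<forall>\<^sub>F j in sequentially. fock_scale (of_int m gchoose j) (fock_nprod (T (0 + int j) u) (m + n - int j) w) = 0"
      using fock_field_ev_nat[OF T, of 0 u] by eventually_elim simp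
    then show ?thesis
      unfolding borcherds_left_def by (rule Sum_any_eq_sum_eventually)
  qed
  show ?thesis
  proof (induction u arbitrary: m n w rule: fock_induct)
    case one
    have "\<And>v. v = 0 \<Longrightarrow> fock_nprod v = (\<lambda>n w. 0)" by (simp add: fun_eq_iff)
    then show ?case
      by (simp add: borcherds_left_def T1 nprod_one field_zero[OF T])
  next
    case (scale c u)
    have "\<forall>\<^sub>F N in sequentially. borcherds_left T (fock_scale c u) 0 m n w = fock_scale c (borcherds_left T u 0 m n w)"
      using left_ev[of u m n w] left_ev[of "fock_scale c u" m n w]
      by eventually_elim
        (simp add: field_scale[OF T] nprod_scale fock.scale_sum_right mult.commute)
    then show ?case
      using scale[of m n w]
      by (simp add: nprod_scale field_scale[OF T] fock.scale_right_diff_distrib[symmetric])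
  next
    case (add u v)
    have "\<forall>\<^sub>F N in sequentially. borcherds_left T (u + v) 0 m n w = borcherds_left T u 0 m n w + borcherds_left T v 0 m n w"
      using left_ev[of u m n w] left_ev[of v m n w] left_ev[of "u + v" m n w]
      by eventually_elim
        (simp add: field_add[OF T] nprod_add sum.distrib fock.scale_right_distrib)
    then show ?case
      using add[of m n w]
      by (simp add: nprod_add field_add[OF T] algebra_simps)
  next
    case (var x u)
    obtain b k where x: "x = (b, k)" by (cases x)
    define p where "p = - int k - 1"
    define F where "F = fock_nprod u"
    define c where "c j = (-1) ^ j * (of_int p gchoose j :: complex)" for j :: nat
    define s where "s = ((-1) powi p :: complex)"
    note Ff = fock_field_nprod[of u, folded F_def] and B = fock_field_letter[of b]
    have vu: "fock_var x * u = letter_field b p u"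
      by (simp add: p_def letter_field_creation x)
    have Fx: "fock_nprod (fock_var x * u) = circle_prod (letter_field b) p F"
      by (simp add: x nprod_var_mult p_def F_def)
    have "\<forall>\<^sub>F i in sequentially. T (0 + int i) u = 0 \<and> T (0 + int i) (letter_field b p u) = 0"
      by (intro eventually_conj fock_field_ev_nat[OF T])
    then obtain I where I: "\<And>i. i \<ge> I \<Longrightarrow> T (int i) u = 0" "\<And>i. i \<ge> I \<Longrightarrow> T (int i) (letter_field b p u) = 0"
      unfolding eventually_sequentially by auto
    have IR: "R b (int i) p u = 0" if "i \<ge> I" for i
      using R[of "int i" b p u] I[OF that] by (simp add: letter_zero)
    have comm: "T m (F q v) = F q (T m v) + (\<Sum>i<I. fock_scale (of_int m gchoose i) (fock_nprod (T (int i) u) (m + q - int i) v))" for q v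
    proof -
      have "borcherds_left T u 0 m q v = (\<Sum>i<I. fock_scale (of_int m gchoose i) (fock_nprod (T (int i) u) (m + q - int i) v))"
        unfolding borcherds_left_def by (subst Sum_any_eq_sum_lessThan[of I]) (simp_all add: I)
      then show ?thesis using var[of m q v] by (simp add: F_def algebra_simps)
    qed
    have left: "borcherds_left T (fock_var x * u) 0 m n w
        = (\<Sum>i<I. fock_scale (of_int m gchoose i) (circle_prod (letter_field b) p (fock_nprod (T (int i) u)) (m + n - int i) w))
        + (\<Sum>i<I. fock_scale (of_int m gchoose i) (fock_nprod (R b (int i) p u) (m + n - int i) w))"
    proof -
      have "borcherds_left T (fock_var x * u) 0 m n w
          = (\<Sum>i<I. fock_scale (of_int m gchoose i) (fock_nprod (T (int i) (letter_field b p u)) (m + n - int i) w))"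
        unfolding borcherds_left_def vu by (subst Sum_any_eq_sum_lessThan[of I]) (simp_all add: I)
      then show ?thesis
        by (simp add: R nprod_add nprod_letter p_def fock.scale_right_distrib sum.distrib)
    qed
    have "(\<Sum>i<I. fock_scale (of_int m gchoose i) (fock_nprod (R b (int i) p u) (m + n - int i) w))
        = Sum_any (\<lambda>i::nat. fock_scale (of_int m gchoose i) (fock_nprod (R b (int i) p u) (m + n - int i) w))"
      by (rule Sum_any_eq_sum_lessThan[symmetric]) (simp add: IR)
    also have "\<dots> = Sum_any (\<lambda>j::nat. fock_scale (c j) (R b m (p - int j) (F (n + int j) w)
             - fock_scale s (F (p + n - int j) (R b m (int j) w))))" (is "_ = Sum_any ?K")
      unfolding F_def c_def p_def s_def by (rule K[symmetric])
    finally have right: "(\<Sum>i<I. fock_scale (of_int m gchoose i) (fock_nprod (R b (int i) p u) (m + n - int i) w))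
        = Sum_any ?K" .
    have R0: "R b m q 0 = 0" for q
      using R[of m b q 0] by (simp add: letter_zero field_zero[OF T])
    have "\<forall>\<^sub>F j in sequentially. ?K j = 0"
      using fock_field_ev_nat[OF B, of 0 "T m w"] fock_field_ev_nat[OF B, of 0 w] fock_field_ev_nat[OF Ff, of n w]
    proof eventually_elim
      case (elim j)
      then have "R b m (int j) w = 0"
        using R[of m b "int j" w] by (simp add: field_zero[OF T])
      then show ?case using elim by (simp add: R0 field_zero[OF Ff])
    qed
    note Kev = Sum_any_eq_sum_eventually[OF this]
    have ball: "\<forall>\<^sub>F N in sequentially. \<forall>i\<in>{..<I}. circle_prod (letter_field b) p (fock_nprod (T (int i) u)) (m + n - int i) w
         = (\<Sum>j<N. circle_term (letter_field b) p (fock_nprod (T (int i) u)) (m + n - int i) w j)"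
      by (rule eventually_ball_finite) (simp_all add: circle_prod_eventually B fock_field_nprod)
    have "\<forall>\<^sub>F N in sequentially. T m (circle_prod (letter_field b) p F n w)
        - circle_prod (letter_field b) p F n (T m w) = borcherds_left T (fock_var x * u) 0 m n w"
      using Kev circle_prod_eventually[OF B Ff, of p n w] circle_prod_eventually[OF B Ff, of p n "T m w"] ball
    proof eventually_elim
      case (elim N)
      have cp: "(\<Sum>i<I. fock_scale (of_int m gchoose i) (circle_prod (letter_field b) p (fock_nprod (T (int i) u)) (m + n - int i) w))
        = (\<Sum>j<N. \<Sum>i<I. fock_scale (of_int m gchoose i) (circle_term (letter_field b) p (fock_nprod (T (int i) u)) (m + n - int i) w j))"
        using elim(4) by (subst sum.swap) (simp add: fock.scale_sum_right)
      have "T m (circle_term (letter_field b) p F n w j) - circle_term (letter_field b) p F n (T m w) j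
          = (\<Sum>i<I. fock_scale (of_int m gchoose i) (circle_term (letter_field b) p (fock_nprod (T (int i) u)) (m + n - int i) w j))
            + ?K j" for j
      proof -
        let ?S = "\<Sum>i<I. fock_scale (of_int m gchoose i) (fock_nprod (T (int i) u) (m + (n + int j) - int i) w)"
        let ?S' = "\<Sum>i<I. fock_scale (of_int m gchoose i) (fock_nprod (T (int i) u) (m + (p + n - int j) - int i) (letter_field b (int j) w))"
        have "T m (circle_term (letter_field b) p F n w j) - circle_term (letter_field b) p F n (T m w) j
          = fock_scale (c j) (letter_field b (p - int j) ?S - fock_scale s ?S') + ?K j"
          by (simp add: circle_term_def c_def[symmetric] s_def[symmetric] field_scale[OF T] field_diff[OF T] R comm
             field_add[OF Ff] letter_add fock.scale_right_distrib fock.scale_right_diff_distrib)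
        also have "fock_scale (c j) (letter_field b (p - int j) ?S - fock_scale s ?S')
          = (\<Sum>i<I. fock_scale (of_int m gchoose i) (circle_term (letter_field b) p (fock_nprod (T (int i) u)) (m + n - int i) w j))"
          by (simp add: circle_term_def c_def s_def[symmetric] letter_sum letter_scale fock.scale_sum_right
            sum_subtractf[symmetric] fock.scale_right_diff_distrib algebra_simps)
        finally show ?thesis .
      qed
      then have "(\<Sum>j<N. T m (circle_term (letter_field b) p F n w j) - circle_term (letter_field b) p F n (T m w) j)
        = (\<Sum>j<N. \<Sum>i<I. fock_scale (of_int m gchoose i) (circle_term (letter_field b) p (fock_nprod (T (int i) u)) (m + n - int i) w j))
         + (\<Sum>j<N. ?K j)"
        by (simp add: sum.distrib)
      then show ?case
        unfolding left right elim(1-3) cp by (simp add: field_sum[OF T] sum_subtractf)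
    qed
    then show ?case by (simp add: Fx)
  qed
qed

section \<open>Commutators of a letter with arbitrary states\<close>

lemma gchoose_minus_Suc:
  "((of_int (- int k - 1) :: complex) gchoose j) = (-1) ^ j * of_nat ((j + k) choose j)"
proof -
  have "(of_int (- int k - 1) :: complex) gchoose j = (-1) ^ j * ((of_nat j - of_int (- int k - 1) - 1) gchoose j)"
    by (rule gbinomial_negated_upper)
  also have "of_nat j - of_int (- int k - 1) - 1 = (of_nat (j + k) :: complex)" by simp
  finally show ?thesis by (simp only: binomial_gbinomial)
qed

lemma letter_commutator_formula:
  fixes a :: "'i letter"
  shows
  "letter_field a m (fock_nprod u n w) - fock_nprod u n (letter_field a m w)
     = borcherds_left (letter_field a) u 0 m n w"
proof (rule commutator_formula_induct[where R = "\<lambda>b m p w. if m + p = - 1 then fock_scale (letter_pairing a b) w else 0"])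
  fix b :: "'i letter" and k m n and u w :: "'i fock"
  let ?br = "letter_pairing a b" and ?s = "(-1) powi (- int k - 1) :: complex"
  have [simp]: "?s = - ((-1) ^ k)"
    by (simp add: power_int_diff power_int_minus power_inverse[symmetric])
  have right: "Sum_any (\<lambda>i::nat. fock_scale (of_int m gchoose i)
            (fock_nprod (if int i + (- int k - 1) = - 1 then fock_scale ?br u else 0) (m + n - int i) w))
      = fock_scale ((of_int m gchoose k) * ?br) (fock_nprod u (m + n - int k) w)"
  proof -
    have "Sum_any (\<lambda>i::nat. fock_scale (of_int m gchoose i)
            (fock_nprod (if int i + (- int k - 1) = - 1 then fock_scale ?br u else 0) (m + n - int i) w))
      = Sum_any (\<lambda>i::nat. if i = k then fock_scale ((of_int m gchoose k) * ?br) (fock_nprod u (m + n - int k) w) else 0)"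
      by (intro Sum_any.cong) (auto simp: nprod_scale)
    then show ?thesis by simp
  qed
  define c where "c j = (-1) ^ j * (of_int (- int k - 1) gchoose j :: complex)" for j :: nat
  have c: "c j = of_nat ((j + k) choose j)" for j
    by (simp add: c_def gchoose_minus_Suc[simplified] power_mult_distrib[symmetric])
  let ?G = "\<lambda>j. fock_scale (c j)
     ((if m + (- int k - 1 - int j) = - 1 then fock_scale ?br (fock_nprod u (n + int j) w) else 0)
      - fock_scale ?s (fock_nprod u (- int k - 1 + n - int j) (if m + int j = - 1 then fock_scale ?br w else 0)))"
  have "Sum_any ?G = fock_scale ((of_int m gchoose k) * ?br) (fock_nprod u (m + n - int k) w)"
  \<comment> \<open>For \<open>m < 0\<close>, \<open>0 \<le> m < k\<close> and
    \<open>k \<le> m\<close> the surviving summand comes from the second term of the bracket, from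
    neither term, and from the first term, while \<open>m gchoose k\<close> is a signed binomial
    coefficient, zero, and an ordinary binomial coefficient.\<close>
  proof (cases "m < 0")
    case True
    define j0 where "j0 = nat (- 1 - m)"
    have m: "m = - int j0 - 1" using True by (simp add: j0_def)
    have "((of_int m :: complex) gchoose k) = (-1) ^ k * c j0"
      unfolding m gchoose_minus_Suc c by (simp add: binomial_symmetric[of j0 "j0 + k"] add.commute)
    moreover have "?G j = (if j = j0 then fock_scale (c j0 * (-1) ^ k * ?br) (fock_nprod u (m + n - int k) w) else 0)" for j
      by (auto simp: m nprod_scale_right algebra_simps)
    ultimately show ?thesis by (simp add: mult_ac)
  next
    case False
    show ?thesis
    proof (cases "m < int k")
      case True
      define i where "i = nat m"
      have i: "m = int i" "i < k" using True False by (auto simp: i_def)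
      then have "((of_int m :: complex) gchoose k) = 0"
        by (simp add: binomial_gbinomial[symmetric])
      moreover have "Sum_any ?G = Sum_any (\<lambda>j::nat. 0 :: 'i fock)"
        by (rule Sum_any.cong) (use True False in auto)
      ultimately show ?thesis by simp
    next
      case ge: False
      define j0 where "j0 = nat (m - int k)"
      have m: "m = int (j0 + k)" using ge by (simp add: j0_def)
      have "((of_int m :: complex) gchoose k) = c j0"
        unfolding m c of_int_of_nat_eq binomial_gbinomial[symmetric]
        by (simp add: binomial_symmetric[of j0 "j0 + k"])
      moreover have "?G j = (if j = j0 then fock_scale (c j0 * ?br) (fock_nprod u (m + n - int k) w) else 0)" for j
        by (auto simp: m algebra_simps)
      ultimately show ?thesis by simp
    qed
  qed
  then show "Sum_any (\<lambda>j. fock_scale ((-1) ^ j * (of_int (- int k - 1) gchoose j))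
      ((if m + (- int k - 1 - int j) = - 1 then fock_scale ?br (fock_nprod u (n + int j) w) else 0)
      - fock_scale ?s (fock_nprod u (- int k - 1 + n - int j) (if m + int j = - 1 then fock_scale ?br w else 0))))
    = Sum_any (\<lambda>i::nat. fock_scale (of_int m gchoose i)
            (fock_nprod (if int i + (- int k - 1) = - 1 then fock_scale ?br u else 0) (m + n - int i) w))"
    unfolding right c_def .
qed (rule fock_field_letter letter_field_one letter_commutator)+

lemma letter_borcherds_identity:
  "borcherds_left (letter_field a) u l m n w = borcherds_right (letter_field a) u l m n w"
  by (rule borcherds_identity)
    (simp_all add: fock_field_letter letter_commutator_formula nprod_letter)

text \<open>The letter formula with the letter as acting state and the quadratic state
  \<open>a\<close> as its argument: mode j of the letter sends \<open>a\<close> to a combination of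
  \<open>x\<close> and \<open>y\<close> for j = 0 and to zero for j > 0. Hence a mode of
  \<open>a\<close> moves past a letter at the cost of other letters.\<close>

lemma letter_commutator_quadratic:
  fixes x y :: "'i letter"
  defines "a \<equiv> fock_var (x, 0) * fock_var (y, 0)"
  shows "fock_nprod a m (letter_field b p w) = letter_field b p (fock_nprod a m w)
    + (fock_scale (- letter_pairing b x) (letter_field y (m + p) w)
      + fock_scale (- letter_pairing b y) (letter_field x (m + p) w))"
proof -
  have d0: "letter_field b 0 a = fock_scale (letter_pairing b x) (fock_var (y, 0)) + fock_scale (letter_pairing b y) (fock_var (x, 0))"
    using letter_commutator[of b 0 x "-1" "fock_var (y, 0)"] letter_commutator[of b 0 y "-1" 1]
      letter_field_creation[of x 0] letter_field_creation[of y 0] letter_field_one[of b 0]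
    by (simp add: a_def letter_zero)
  have dj: "letter_field b (int j) a = 0" if "j > 0" for j
    using letter_commutator[of b "int j" x "-1" "fock_var (y, 0)"] letter_commutator[of b "int j" y "-1" 1]
      letter_field_creation[of x 0] letter_field_creation[of y 0] letter_field_one[of b j] that
    by (simp add: a_def letter_zero)
  have "borcherds_left (letter_field b) a 0 p m w
     = Sum_any (\<lambda>j::nat. if j = 0 then fock_nprod (letter_field b 0 a) (m + p) w else 0)"
    unfolding borcherds_left_def by (intro Sum_any.cong) (auto simp: dj add.commute)
  then have "borcherds_left (letter_field b) a 0 p m w = fock_scale (letter_pairing b x) (letter_field y (m + p) w)
      + fock_scale (letter_pairing b y) (letter_field x (m + p) w)"
    by (simp add: d0 nprod_add nprod_scale nprod_var)
  with letter_commutator_formula[of b p a m w] show ?thesis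
    by (simp add: algebra_simps)
qed

section \<open>Commutators of quadratic states with arbitrary states\<close>

lemma Sum_any_fock_linear_combination:
  fixes g h :: "nat \<Rightarrow> 'i fock"
  assumes "\<forall>\<^sub>F j in sequentially. g j = 0" "\<forall>\<^sub>F j in sequentially. h j = 0"
  shows "Sum_any (\<lambda>j. fock_scale c (g j) + fock_scale d (h j)) = fock_scale c (Sum_any g) + fock_scale d (Sum_any h)"
proof -
  have gh: "\<forall>\<^sub>F j in sequentially. fock_scale c (g j) + fock_scale d (h j) = 0"
    using assms by eventually_elim simp
  have "\<forall>\<^sub>F N in sequentially. Sum_any (\<lambda>j. fock_scale c (g j) + fock_scale d (h j)) = fock_scale c (Sum_any g) + fock_scale d (Sum_any h)"
    using Sum_any_eq_sum_eventually[OF assms(1)] Sum_any_eq_sum_eventually[OF assms(2)]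
      Sum_any_eq_sum_eventually[OF gh]
    by eventually_elim (simp add: sum.distrib fock.scale_sum_right)
  then show ?thesis by simp
qed

definition has_commutator_formula :: "'i fock \<Rightarrow> bool" where
  "has_commutator_formula a \<longleftrightarrow> (\<forall>u m n w.
     fock_nprod a m (fock_nprod u n w) - fock_nprod u n (fock_nprod a m w)
       = borcherds_left (fock_nprod a) u 0 m n w)"

text \<open>Supplies hypothesis \<open>K\<close> of \<open>commutator_formula_induct\<close> for
  quadratic states (with l = -k-1): there the corrections are letters, so \<open>K\<close> is a
  linear combination of two Borcherds identities for letters.\<close>

lemma letter_borcherds_linear_combination:
  fixes x y :: "'i letter"
  shows "Sum_any (\<lambda>j::nat. fock_scale ((-1) ^ j * (of_int l gchoose j))
          ((fock_scale c (letter_field y (m + (l - int j)) (fock_nprod u (n + int j) w))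
            + fock_scale d (letter_field x (m + (l - int j)) (fock_nprod u (n + int j) w)))
           - fock_scale ((-1) powi l) (fock_nprod u (l + n - int j)
               (fock_scale c (letter_field y (m + int j) w) + fock_scale d (letter_field x (m + int j) w)))))
        = Sum_any (\<lambda>i::nat. fock_scale (of_int m gchoose i)
            (fock_nprod (fock_scale c (letter_field y (int i + l) u)
               + fock_scale d (letter_field x (int i + l) u)) (m + n - int i) w))"
proof -
  have ev1: "\<forall>\<^sub>F j in sequentially. fock_scale (of_int l gchoose j)
     (fock_scale ((-1) ^ j) (letter_field a (m + l - int j) (fock_nprod u (n + int j) w)
       - fock_scale ((-1) powi l) (fock_nprod u (n + l - int j) (letter_field a (m + int j) w)))) = 0" for a :: "'i letter"
    using borcherds_right_ev[OF fock_field_letter, of a "m + l" u n w "(-1) powi l" "n + l" m]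
    by eventually_elim simp
  have ev2: "\<forall>\<^sub>F j in sequentially. fock_scale (of_int m gchoose j)
      (fock_nprod (letter_field a (l + int j) u) (m + n - int j) w) = 0" for a :: "'i letter"
    using fock_field_ev_nat[OF fock_field_letter, of a l u] by eventually_elim simp
  have "fock_scale c (borcherds_right (letter_field y) u l m n w) + fock_scale d (borcherds_right (letter_field x) u l m n w)
      = fock_scale c (borcherds_left (letter_field y) u l m n w) + fock_scale d (borcherds_left (letter_field x) u l m n w)"
    by (simp add: letter_borcherds_identity)
  then show ?thesis
    unfolding borcherds_right_def borcherds_left_def
      Sum_any_fock_linear_combination[OF ev1 ev1, symmetric]
      Sum_any_fock_linear_combination[OF ev2 ev2, symmetric]
    by (simp add: fock.scale_right_diff_distrib fock.scale_right_distrib nprod_add nprod_scale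
        nprod_add_right nprod_scale_right algebra_simps)
qed

lemma has_commutator_formula_quadratic:
  fixes x y :: "'i letter"
  shows "has_commutator_formula (fock_var (x, 0) * fock_var (y, 0))"
  unfolding has_commutator_formula_def
proof (intro allI, rule commutator_formula_induct[OF fock_field_nprod _ letter_commutator_quadratic])
qed (simp_all only: letter_borcherds_linear_combination, simp add: nprod_vacuum)

lemma has_commutator_formula_add:
  fixes a b :: "'i fock"
  assumes "has_commutator_formula a" "has_commutator_formula b"
  shows "has_commutator_formula (a + b)"
  unfolding has_commutator_formula_def
proof (intro allI)
  fix u w :: "'i fock" and m n
  have ev: "\<forall>\<^sub>F j in sequentially. fock_scale (of_int m gchoose j)
      (fock_nprod (fock_nprod a (0 + int j) u) (m + n - int j) w) = 0" for a :: "'i fock"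
    using fock_field_ev_nat[OF fock_field_nprod, of a 0 u] by eventually_elim simp
  have "borcherds_left (fock_nprod (a + b)) u 0 m n w
      = borcherds_left (fock_nprod a) u 0 m n w + borcherds_left (fock_nprod b) u 0 m n w"
    using Sum_any_fock_linear_combination[OF ev ev, of 1 a 1 b]
    by (simp add: borcherds_left_def nprod_add fock.scale_right_distrib)
  with assms show "fock_nprod (a + b) m (fock_nprod u n w) - fock_nprod u n (fock_nprod (a + b) m w)
       = borcherds_left (fock_nprod (a + b)) u 0 m n w"
    unfolding has_commutator_formula_def by (simp add: nprod_add nprod_add_right algebra_simps)
qed

lemma has_commutator_formula_scale:
  fixes a :: "'i fock"
  assumes "has_commutator_formula a"
  shows "has_commutator_formula (fock_scale c a)"
  unfolding has_commutator_formula_def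
proof (intro allI)
  fix u w :: "'i fock" and m n
  have ev: "\<forall>\<^sub>F j in sequentially. fock_scale (of_int m gchoose j)
      (fock_nprod (fock_nprod a (0 + int j) u) (m + n - int j) w) = 0" for a :: "'i fock"
    using fock_field_ev_nat[OF fock_field_nprod, of a 0 u] by eventually_elim simp
  have "borcherds_left (fock_nprod (fock_scale c a)) u 0 m n w = fock_scale c (borcherds_left (fock_nprod a) u 0 m n w)"
    using Sum_any_fock_linear_combination[OF ev ev, of c a 0 a]
    by (simp add: borcherds_left_def nprod_scale mult.commute)
  with assms show "fock_nprod (fock_scale c a) m (fock_nprod u n w) - fock_nprod u n (fock_nprod (fock_scale c a) m w)
       = borcherds_left (fock_nprod (fock_scale c a)) u 0 m n w"
    unfolding has_commutator_formula_def
    by (simp add: nprod_scale nprod_scale_right fock.scale_right_diff_distrib[symmetric])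
qed

lemma commutator_zero:
  assumes "has_commutator_formula a" "\<And>j. j \<ge> 0 \<Longrightarrow> fock_nprod a j u = 0"
  shows "fock_nprod a m (fock_nprod u n w) = fock_nprod u n (fock_nprod a m w)"
proof -
  have "borcherds_left (fock_nprod a) u 0 m n w = Sum_any (\<lambda>j::nat. 0)"
    unfolding borcherds_left_def by (rule Sum_any.cong) (simp add: assms(2))
  then have "fock_nprod a m (fock_nprod u n w) - fock_nprod u n (fock_nprod a m w) = 0"
    using assms(1) by (simp add: has_commutator_formula_def)
  then show ?thesis by simp
qed

lemma nprod_vacuum_nonneg: "n \<ge> 0 \<Longrightarrow> fock_nprod u n 1 = 0"
  by (simp add: nprod_vacuum)

section \<open>The two commuting algebras\<close>

definition quad :: "'i letter \<Rightarrow> 'i letter \<Rightarrow> 'i fock" where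
  "quad x y = fock_var (x, 0) * fock_var (y, 0)"

lemma quad_commute: "quad x y = quad y x"
  by (simp add: quad_def mult.commute)

text \<open>Wick's theorem for two quadratic states: the zeroth product collects the single
  contractions, the first product the double ones.\<close>

lemma nprod_quad_quad:
  fixes x y b c :: "'i letter"
  assumes "m \<ge> 0"
  shows "fock_nprod (quad x y) m (quad b c) =
    (if m = 0 then - (fock_scale (letter_pairing c x) (quad b y) + fock_scale (letter_pairing c y) (quad b x)
        + fock_scale (letter_pairing b x) (quad y c) + fock_scale (letter_pairing b y) (quad x c))
     else if m = 1 then fock_scale (- (letter_pairing b x * letter_pairing y c + letter_pairing b y * letter_pairing x c)) 1
     else 0)"
proof -
  have cr: "letter_field z (-1) w = fock_var (z, 0) * w" for z :: "'i letter" and w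
    using letter_field_creation[of z 0] by simp
  have one: "letter_field z k 1 = 0" if "k \<ge> 0" for z :: "'i letter" and k
    using letter_field_one[of z "nat k"] that by simp
  have on_var: "letter_field z k (fock_var (c, 0)) = (if k = 0 then fock_scale (letter_pairing z c) 1 else 0)"
    if "k \<ge> 0" for z k
    using letter_commutator[of z k c "-1" 1] that by (simp add: cr one)
  have eq: "fock_nprod (quad x y) m (quad b c) = letter_field b (-1) (letter_field c (-1) (fock_nprod (quad x y) m 1)
      + (fock_scale (- letter_pairing c x) (letter_field y (m + (-1)) 1)
      + fock_scale (- letter_pairing c y) (letter_field x (m + (-1)) 1)))
      + (fock_scale (- letter_pairing b x) (letter_field y (m + (-1)) (fock_var (c, 0)))
      + fock_scale (- letter_pairing b y) (letter_field x (m + (-1)) (fock_var (c, 0))))"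
    using letter_commutator_quadratic[of x y m b "-1" "fock_var (c, 0)"]
      letter_commutator_quadratic[of x y m c "-1" 1]
    by (simp add: cr quad_def)
  have "fock_nprod (quad x y) m 1 = 0" using assms by (simp add: nprod_vacuum)
  moreover have "m = 0 \<or> m = 1 \<or> m \<ge> 2" using assms by linarith
  ultimately show ?thesis
    unfolding eq
    by (auto simp: cr one on_var quad_def letter_zero fock.scale_left_distrib algebra_simps)
qed

definition cur_e :: "sl2_index fock" where
  "cur_e = fock_scale 4 (quad (Gamma Ih) (Gamma Ih) + quad (Gamma Ie) (Gamma If))"

definition cur_f :: "sl2_index fock" where
  "cur_f = fock_scale (- (1/16)) (quad (Beta Ih) (Beta Ih) + fock_scale 4 (quad (Beta Ie) (Beta If)))"

definition cur_h :: "sl2_index fock" where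
  "cur_h = quad (Beta Ih) (Gamma Ih) + quad (Beta Ie) (Gamma Ie) + quad (Beta If) (Gamma If)"

text \<open>For x = e, f the current is minus the sum, over basis vectors v of sl(2), of the Wick
  product of \<beta> at [x, v] with \<gamma> at the dual vector v'. The coefficients come from
  [e, h] = -2e, [e, f] = h and [f, e] = -h, [f, h] = 2f.\<close>

definition theta_e :: "sl2_index fock" where
  "theta_e = fock_scale 2 (quad (Beta Ie) (Gamma Ih)) + fock_scale (- 1) (quad (Beta Ih) (Gamma If))"

definition theta_f :: "sl2_index fock" where
  "theta_f = quad (Beta Ih) (Gamma Ie) + fock_scale (- 2) (quad (Beta If) (Gamma Ih))"

lemmas currents_def = cur_e_def cur_f_def cur_h_def theta_e_def theta_f_def

lemma has_commutator_formula_currents: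
  assumes "a \<in> {cur_e, cur_f, cur_h, theta_e, theta_f}"
  shows "has_commutator_formula a"
  using assms
  by (elim insertE emptyE) (simp_all only: currents_def quad_def
      has_commutator_formula_add has_commutator_formula_scale has_commutator_formula_quadratic)

text \<open>The zeroth products vanish because the forms behind the three generators are invariant
  under ad; the first products are traces of ad e and ad f, or have no double contraction at
  all.\<close>

lemma theta_nprod_currents:
  assumes "t \<in> {theta_e, theta_f}" "v \<in> {cur_e, cur_f, cur_h}" "m \<ge> 0"
  shows "fock_nprod t m v = 0"
proof -
  note c = quad_commute[of "Gamma Ih" "Beta Ih"] quad_commute[of "Gamma Ih" "Beta Ie"] quad_commute[of "Gamma Ih" "Beta If"]
    quad_commute[of "Gamma Ie" "Beta Ih"] quad_commute[of "Gamma Ie" "Beta Ie"] quad_commute[of "Gamma Ie" "Beta If"]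
    quad_commute[of "Gamma If" "Beta Ih"] quad_commute[of "Gamma If" "Beta Ie"] quad_commute[of "Gamma If" "Beta If"]
    quad_commute[of "Beta Ih" "Beta Ie"] quad_commute[of "Beta Ih" "Beta If"] quad_commute[of "Beta If" "Beta Ie"]
    quad_commute[of "Gamma Ih" "Gamma Ie"] quad_commute[of "Gamma Ih" "Gamma If"] quad_commute[of "Gamma If" "Gamma Ie"]
  have two: "coef (2 * p) M = 2 * coef p M" for p :: "sl2_index fock" and M
    by (simp only: mult_2 lookup_add)
  note lin = nprod_add nprod_scale nprod_add_right nprod_scale_right nprod_quad_quad[OF assms(3)]
  have "coef (fock_nprod t m v) M = 0" if "t = theta_e \<or> t = theta_f" "v = cur_e \<or> v = cur_f \<or> v = cur_h" for t v M
    using that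
    by (elim disjE; hypsubst; unfold currents_def lin)
      (simp_all add: c lookup_add lookup_minus two)
  then show ?thesis
    using assms by (intro poly_mapping_eqI) auto
qed

text \<open>Mirrors the induced module: words in the modes of the generators, applied to the vacuum.
  Closure under products of two general elements is obtained later from the equality with
  \<open>range \<psi>\<close>.\<close>

inductive_set sl2_words :: "sl2_index fock set" where
  one: "1 \<in> sl2_words"
| add: "u \<in> sl2_words \<Longrightarrow> v \<in> sl2_words \<Longrightarrow> u + v \<in> sl2_words"
| scale: "u \<in> sl2_words \<Longrightarrow> fock_scale c u \<in> sl2_words"
| step: "x \<in> {cur_e, cur_f, cur_h} \<Longrightarrow> u \<in> sl2_words \<Longrightarrow> fock_nprod x n u \<in> sl2_words"

lemma nprod_bg [simp]: "nprod beta_gamma_system = fock_nprod"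
  and scal_bg [simp]: "scal beta_gamma_system = fock_scale"
  and vac_bg [simp]: "vac beta_gamma_system = 1"
  by (simp_all add: beta_gamma_system_def)

lemma mem_Com_bg: "v \<in> Com U beta_gamma_system \<longleftrightarrow> (\<forall>u\<in>U. \<forall>n\<ge>0. fock_nprod u n v = 0)"
  by (simp add: Com_def)

text \<open>By the commutator formula all modes of the generators commute with those of
  \<open>w\<close>, which can therefore be moved to the right until they hit the vacuum.\<close>

lemma nprod_sl2_words_zero:
  assumes w: "\<And>x n. x \<in> {cur_e, cur_f, cur_h} \<Longrightarrow> n \<ge> 0 \<Longrightarrow> fock_nprod x n w = 0"
    and u: "u \<in> sl2_words" and n: "n \<ge> 0"
  shows "fock_nprod w n u = 0"
  using u
proof induction
  case (step x u k)
  have "fock_nprod w n (fock_nprod x k u) = fock_nprod x k (fock_nprod w n u)"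
    by (rule commutator_zero[symmetric]) (use step w has_commutator_formula_currents in auto)
  then show ?case using step by simp
qed (simp_all add: nprod_vacuum_nonneg n nprod_add_right nprod_scale_right)

lemma theta_nprod_words:
  assumes t: "t \<in> {theta_e, theta_f}" and u: "u \<in> sl2_words" and n: "n \<ge> 0"
  shows "fock_nprod t n u = 0"
  using u
proof induction
  case (step x u k)
  have "fock_nprod t n (fock_nprod x k u) = fock_nprod x k (fock_nprod t n u)"
    by (rule commutator_zero) (use step t has_commutator_formula_currents theta_nprod_currents in blast)+
  then show ?case using step by simp
qed (simp_all add: nprod_vacuum_nonneg n nprod_add_right nprod_scale_right)

text \<open>Annihilation of words by \<open>t\<close> is the opposite of what \<open>Com\<close>
  asks for. Commutation of the modes turns it around: u_n t = u_n t_(-1) 1 = t_(-1) u_n 1 = 0 for n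
  \<ge> 0.\<close>

lemma theta_in_Com:
  assumes t: "t \<in> {theta_e, theta_f}"
  shows "t \<in> Com sl2_words beta_gamma_system"
  unfolding mem_Com_bg
proof (intro ballI allI impI)
  fix u n assume u: "u \<in> sl2_words" and n: "n \<ge> (0::int)"
  have "fock_nprod t (-1) (fock_nprod u n 1) = fock_nprod u n (fock_nprod t (-1) 1)"
    by (rule commutator_zero) (use t u has_commutator_formula_currents theta_nprod_words in blast)+
  then show "fock_nprod u n t = 0"
    using n by (simp add: nprod_vacuum)
qed

lemma sl2_words_generators: "x \<in> {cur_e, cur_f, cur_h} \<Longrightarrow> x \<in> sl2_words"
proof -
  assume "x \<in> {cur_e, cur_f, cur_h}"
  then have "fock_nprod x (- 1) 1 \<in> sl2_words" by (rule sl2_words.step[OF _ sl2_words.one])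
  then show "x \<in> sl2_words" by (simp add: nprod_vacuum)
qed

lemma howe_pair_sl2_words:
  assumes "vertex_subalgebra beta_gamma_system sl2_words"
    and main: "\<And>v. (\<And>n. n \<ge> 0 \<Longrightarrow> fock_nprod theta_e n v = 0 \<and> fock_nprod theta_f n v = 0) \<Longrightarrow> v \<in> sl2_words"
  shows "howe_pair sl2_words beta_gamma_system"
  unfolding howe_pair_def
proof (intro conjI equalityI subsetI)
  fix u assume u: "u \<in> sl2_words"
  show "u \<in> Com (Com sl2_words beta_gamma_system) beta_gamma_system"
    unfolding mem_Com_bg
  proof (intro ballI allI impI)
    fix w n assume w: "w \<in> Com sl2_words beta_gamma_system" and n: "n \<ge> (0::int)"
    have "fock_nprod x k w = 0" if "x \<in> {cur_e, cur_f, cur_h}" "k \<ge> 0" for x k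
      using w sl2_words_generators[OF that(1)] that(2) unfolding mem_Com_bg by blast
    then show "fock_nprod w n u = 0"
      using u n by (rule nprod_sl2_words_zero)
  qed
next
  fix v assume v: "v \<in> Com (Com sl2_words beta_gamma_system) beta_gamma_system"
  have "theta_e \<in> Com sl2_words beta_gamma_system" "theta_f \<in> Com sl2_words beta_gamma_system"
    by (rule theta_in_Com, simp)+
  then show "v \<in> sl2_words"
    using v unfolding mem_Com_bg[of v] by (intro main) blast
qed (use assms in simp)

section \<open>The image of the current algebra\<close>

lemma UNIV_sl2_index: "UNIV = {Ie, If, Ih}"
  using sl2_index.exhaust by auto

lemma beta_gamma_basis:
  "beta sl2_e = fock_var (Beta Ie, 0)" "beta sl2_f = fock_var (Beta If, 0)" "beta sl2_h = fock_var (Beta Ih, 0)"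
  "gamma sl2_e = fock_var (Gamma Ie, 0)" "gamma sl2_f = fock_var (Gamma If, 0)" "gamma sl2_h = fock_var (Gamma Ih, 0)"
  by (simp_all add: beta_def gamma_def UNIV_sl2_index sl2_e_def sl2_f_def sl2_h_def axis_def)

lemma wick_var: "wick (fock_var (a, 0)) (fock_var (b, 0)) = quad a b"
  using letter_field_creation[of a 0] by (simp add: nprod_var quad_def)

text \<open>\<open>W\<close> is spanned by words applied to its vacuum, and \<psi> sends a mode of
  \<open>\<iota> x\<close> to a linear combination of modes of the three generators.\<close>

lemma range_eq_sl2_words:
  fixes W :: "('a::ab_group_add) vertex_data" and \<iota> :: "sl2 \<Rightarrow> 'a"
  assumes W: "current_algebra br B W \<iota>" and hom: "vertex_hom W beta_gamma_system \<psi>"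
    and e: "\<psi> (\<iota> sl2_e) = cur_e" and f: "\<psi> (\<iota> sl2_f) = cur_f" and h: "\<psi> (\<iota> sl2_h) = cur_h"
  shows "range \<psi> = sl2_words"
proof (intro equalityI subsetI)
  have add: "\<psi> (u + v) = \<psi> u + \<psi> v" and scale: "\<psi> (scal W c u) = fock_scale c (\<psi> u)"
    and vac: "\<psi> (vac W) = 1" and prod: "\<psi> (nprod W u n v) = fock_nprod (\<psi> u) n (\<psi> v)" for u v c n
    using hom by (simp_all add: vertex_hom_def)
  have zero: "\<psi> 0 = 0" using add[of 0 0] by simp
  have lin: "\<iota> (a *s x + b *s y) = scal W a (\<iota> x) + scal W b (\<iota> y)" for a b x y
    using W by (simp add: current_algebra_def)
  {
    fix p assume "p \<in> sl2_words"
    then show "p \<in> range \<psi>"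
    proof induction
      case one
      then show ?case using vac by (metis rangeI)
    next
      case (add u v)
      then show ?case using assms(2) by (auto simp: vertex_hom_def) (metis rangeI)
    next
      case (scale u c)
      then show ?case using hom by (auto simp: vertex_hom_def) (metis rangeI)
    next
      case (step x u n)
      then have "x \<in> range \<psi>" using e f h by (metis empty_iff insert_iff rangeI)
      then obtain v' u' where "x = \<psi> v'" "u = \<psi> u'" using step by auto
      then have "fock_nprod x n u = \<psi> (nprod W v' n u')" by (simp add: prod)
      then show ?case by simp
    qed
  next
    fix p assume "p \<in> range \<psi>"
    then obtain v where p: "p = \<psi> v" by auto
    obtain q where v: "v = eval_words W \<iota> q"
      using W unfolding current_algebra_def by metis
    have decomp: "\<psi> (\<iota> x) = fock_scale (x $ Ie) cur_e + (fock_scale (x $ If) cur_f + fock_scale (x $ Ih) cur_h)" for x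
    proof -
      \<comment> \<open>The factor \<open>1\<close> brings the decomposition into the shape
        \<open>a *s x + b *s y\<close>, to which linearity of \<iota> applies twice.\<close>
      have x: "x = (x $ Ie) *s sl2_e + 1 *s ((x $ If) *s sl2_f + (x $ Ih) *s sl2_h)"
        by (auto simp: vec_eq_iff sl2_e_def sl2_f_def sl2_h_def axis_def) (metis sl2_index.exhaust)
      show ?thesis
        by (subst x, simp only: lin add scale e f h) simp
    qed
    have words: "\<psi> (foldr (\<lambda>(x, n) v. nprod W (\<iota> x) n v) w (vac W)) \<in> sl2_words" for w
    proof (induction w)
      case (Cons a w)
      obtain x n where [simp]: "a = (x, n)" by (cases a)
      show ?case
        using Cons by (simp add: prod decomp nprod_add nprod_scale)
          (intro sl2_words.intros; simp)
    qed (simp add: vac sl2_words.one)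
    have zero_mem: "0 \<in> sl2_words" using sl2_words.scale[OF sl2_words.one, of 0] by simp
    have "\<psi> (\<Sum>w\<in>S. scal W (g w) (foldr (\<lambda>(x, n) v. nprod W (\<iota> x) n v) w (vac W))) \<in> sl2_words"
      if "finite S" for S g
      using that by induction
        (simp_all add: zero zero_mem add scale sl2_words.add sl2_words.scale words)
    then show "p \<in> sl2_words"
      by (simp add: p v eval_words_def)
  }
qed

section \<open>Evaluation of polynomials\<close>

definition poly_eval :: "('i mode \<Rightarrow> complex) \<Rightarrow> 'i fock \<Rightarrow> complex" where
  "poly_eval p f = (\<Sum>M\<in>Poly_Mapping.keys f. coef f M * prod_mset (image_mset p M))"

lemma poly_eval_superset:
  assumes "finite S" "Poly_Mapping.keys f \<subseteq> S"
  shows "poly_eval p f = (\<Sum>M\<in>S. coef f M * prod_mset (image_mset p M))"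
  unfolding poly_eval_def
  by (rule sum.mono_neutral_left) (use assms in \<open>auto simp: in_keys_iff\<close>)

lemma poly_eval_single [simp]:
  "poly_eval p (Poly_Mapping.single M c) = c * prod_mset (image_mset p M)"
  by (subst poly_eval_superset[of "{M}"]) auto

lemma poly_eval_add [simp]: "poly_eval p (f + g) = poly_eval p f + poly_eval p g"
proof -
  let ?S = "Poly_Mapping.keys f \<union> Poly_Mapping.keys g"
  have "Poly_Mapping.keys (f + g) \<subseteq> ?S" by (rule keys_add)
  then show ?thesis
    by (simp add: poly_eval_superset[of ?S] lookup_add ring_distribs sum.distrib)
qed

lemma poly_eval_scale [simp]: "poly_eval p (fock_scale c f) = c * poly_eval p f"
proof -
  have "Poly_Mapping.keys (fock_scale c f) \<subseteq> Poly_Mapping.keys f" by (auto simp: in_keys_iff)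
  then show ?thesis
    by (simp add: poly_eval_superset[of "Poly_Mapping.keys f"] sum_distrib_left mult.assoc)
qed

lemma poly_eval_one [simp]: "poly_eval p 1 = 1"
  using poly_eval_single[of p "{#}" 1] by (simp flip: single_one zero_multiset_def)

lemma poly_eval_zero [simp]: "poly_eval p 0 = 0"
  by (simp add: poly_eval_def)

lemma poly_eval_minus [simp]: "poly_eval p (- f) = - poly_eval p f"
  using poly_eval_add[of p f "- f"] by (simp add: add_eq_0_iff2)

lemma poly_eval_diff [simp]: "poly_eval p (f - g) = poly_eval p f - poly_eval p g"
  using poly_eval_add[of p f "- g"] by simp

lemma poly_eval_sum: "poly_eval p (sum f A) = (\<Sum>x\<in>A. poly_eval p (f x))"
  by (induction A rule: infinite_finite_induct) simp_all

lemma poly_eval_var_mult [simp]: "poly_eval p (fock_var x * f) = p x * poly_eval p f"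
  by (induction f rule: fock_induct_single)
    (simp_all add: single_add_mset[symmetric] distrib_left)

lemma poly_eval_mult [simp]: "poly_eval p (f * g) = poly_eval p f * poly_eval p g"
  by (induction f rule: fock_induct) (simp_all add: mult.assoc distrib_right)

lemma poly_eval_var [simp]: "poly_eval p (fock_var x) = p x"
  using poly_eval_var_mult[of p x 1] by simp

text \<open>Chain rule along an integral curve of the vector field \<open>D\<close>: both sides
  agree on variables and obey the Leibniz rule.\<close>

lemma poly_eval_has_field_derivative:
  assumes D: "fock_linear D" "D 1 = 0" "\<And>x f. D (fock_var x * f) = img x * f + fock_var x * D f"
    and P: "\<And>x. ((\<lambda>s. P s x) has_field_derivative poly_eval (P s) (img x)) (at s)"
  shows "((\<lambda>s. poly_eval (P s) f) has_field_derivative poly_eval (P s) (D f)) (at s)"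
proof (induction f rule: fock_induct)
  case (var x f)
  have "((\<lambda>s. P s x * poly_eval (P s) f) has_field_derivative
      poly_eval (P s) (img x) * poly_eval (P s) f + poly_eval (P s) (D f) * P s x) (at s)"
    by (rule DERIV_mult[OF P var])
  then show ?case unfolding poly_eval_var_mult D(3) by (simp add: mult.commute)
qed (use D in \<open>auto intro!: derivative_eq_intros simp: fock_pair.linear_add fock_pair.linear_scale\<close>)

section \<open>Polynomials are determined by their values\<close>

definition deg_lt :: "nat \<Rightarrow> 'i fock \<Rightarrow> bool" where
  "deg_lt d f \<longleftrightarrow> (\<forall>M. d \<le> size M \<longrightarrow> coef f M = 0)"

lemma deg_lt_exists: "\<exists>d. deg_lt d f"
proof -
  obtain d where "\<And>s. s \<in> size ` Poly_Mapping.keys f \<Longrightarrow> s < d"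
    using finite_nat_set_iff_bounded[of "size ` Poly_Mapping.keys f"] by auto
  then have "deg_lt d f"
    unfolding deg_lt_def by (metis imageI in_keys_iff not_le)
  then show ?thesis ..
qed

lemma deg_lt_0: "deg_lt 0 f \<Longrightarrow> f = 0"
  by (simp add: deg_lt_def poly_mapping_eqI)

text \<open>Induction on the degree: the values of a partial derivative are derivatives of functions
  that are identically zero, so the partial derivative vanishes. In characteristic 0 this kills all
  coefficients except the constant one, which is the value at the origin.\<close>

lemma poly_eval_eq_0_imp_eq_0:
  assumes "\<And>p. poly_eval p f = 0"
  shows "f = 0"
proof -
  have "f = 0" if "deg_lt d f" "\<And>p. poly_eval p f = 0" for d f
    using that
  proof (induction d arbitrary: f)
    case 0
    then show ?case by (simp add: deg_lt_0)
  next
    case (Suc d)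
    have deriv0: "fock_deriv x f = 0" for x
    proof (rule Suc.IH)
      show "deg_lt d (fock_deriv x f)"
        using Suc.prems(1) by (simp add: deg_lt_def)
      fix p
      have "((\<lambda>s. poly_eval (p(x := s)) f) has_field_derivative poly_eval (p(x := p x)) (fock_deriv x f)) (at (p x))"
        by (rule poly_eval_has_field_derivative[where img = "\<lambda>y. if x = y then 1 else 0"])
          (auto simp: fock_linear_deriv fock_deriv_var_mult add.commute intro!: derivative_eq_intros)
      moreover have "((\<lambda>s. poly_eval (p(x := s)) f) has_field_derivative 0) (at (p x))"
        by (simp add: Suc.prems(2))
      ultimately show "poly_eval p (fock_deriv x f) = 0"
        using DERIV_unique by fastforce
    qed
    have coef0: "coef f (add_mset x M) = 0" for x M
    proof -
      have "of_nat (count M x + 1) * coef f (add_mset x M) = 0"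
        using lookup_fock_deriv[of x f M] deriv0 by simp
      then show ?thesis
        by (simp only: mult_eq_0_iff of_nat_eq_0_iff) simp
    qed
    have f: "f = fock_scale (coef f {#}) 1"
    proof (rule poly_mapping_eqI)
      fix M show "coef f M = coef (fock_scale (coef f {#}) 1) M"
        by (cases M) (auto simp: coef0 lookup_one when_def)
    qed
    have "poly_eval (\<lambda>_. 0) f = coef f {#}" by (subst f) simp
    with Suc.prems(2) show ?case by (subst f) simp
  qed
  then show ?thesis using deg_lt_exists assms by blast
qed

lemma poly_eval_line:
  "\<exists>r. \<forall>s. poly_eval (\<lambda>x. p x + s * q x) f = poly r s"
proof (induction f rule: fock_induct)
  case one
  show ?case by (rule exI[of _ 1]) simp
next
  case (scale c f)
  then obtain r where "\<forall>s. poly_eval (\<lambda>x. p x + s * q x) f = poly r s" by blast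
  then show ?case by (intro exI[of _ "smult c r"]) simp
next
  case (add f g)
  then obtain r t where "\<forall>s. poly_eval (\<lambda>x. p x + s * q x) f = poly r s"
    "\<forall>s. poly_eval (\<lambda>x. p x + s * q x) g = poly t s" by blast
  then show ?case by (intro exI[of _ "r + t"]) simp
next
  case (var x f)
  then obtain r where "\<forall>s. poly_eval (\<lambda>x. p x + s * q x) f = poly r s" by blast
  then show ?case by (intro exI[of _ "[:p x, q x:] * r"]) (simp add: algebra_simps)
qed

text \<open>A polynomial that vanishes wherever a nonzero polynomial does not is zero: restrict both to a
  line.\<close>

lemma poly_eval_generic_eq_0:
  assumes g: "poly_eval p0 g \<noteq> 0" and f: "\<And>p. poly_eval p g \<noteq> 0 \<Longrightarrow> poly_eval p f = 0"
  shows "f = 0"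
proof (rule poly_eval_eq_0_imp_eq_0)
  fix p
  obtain r where r: "\<And>s. poly_eval (\<lambda>x. p0 x + s * (p x - p0 x)) f = poly r s"
    using poly_eval_line[of p0 "\<lambda>x. p x - p0 x" f] by blast
  obtain t where t: "\<And>s. poly_eval (\<lambda>x. p0 x + s * (p x - p0 x)) g = poly t s"
    using poly_eval_line[of p0 "\<lambda>x. p x - p0 x" g] by blast
  have "poly (r * t) s = 0" for s
    using f[of "\<lambda>x. p0 x + s * (p x - p0 x)"] r t by auto
  then have "r * t = 0" by (metis poly_all_0_iff_0)
  moreover have "t \<noteq> 0" using t[of 0] g by auto
  ultimately have "r = 0" by simp
  then show "poly_eval p f = 0" using r[of 1] by simp
qed

section \<open>Derivations\<close>

definition fock_vars :: "'i fock \<Rightarrow> 'i mode set" where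
  "fock_vars f = (\<Union>M\<in>Poly_Mapping.keys f. set_mset M)"

lemma finite_fock_vars: "finite (fock_vars f)"
  by (simp add: fock_vars_def)

lemma fock_varsI: "coef f M \<noteq> 0 \<Longrightarrow> x \<in># M \<Longrightarrow> x \<in> fock_vars f"
  unfolding fock_vars_def by (rule UN_I[of M]) (simp_all add: in_keys_iff)

lemma fock_deriv_eq_0: "x \<notin> fock_vars f \<Longrightarrow> fock_deriv x f = 0"
proof (rule poly_mapping_eqI)
  fix M
  assume "x \<notin> fock_vars f"
  then have "coef f (add_mset x M) = 0"
    using fock_varsI[of f "add_mset x M" x] by auto
  then show "coef (fock_deriv x f) M = coef 0 M" by simp
qed

definition derivation :: "('i mode \<Rightarrow> 'i fock) \<Rightarrow> 'i fock \<Rightarrow> 'i fock" where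
  "derivation img f = (\<Sum>x\<in>fock_vars f. img x * fock_deriv x f)"

lemma derivation_superset:
  assumes "finite V" "fock_vars f \<subseteq> V"
  shows "derivation img f = (\<Sum>x\<in>V. img x * fock_deriv x f)"
  unfolding derivation_def
  by (rule sum.mono_neutral_left) (use assms in \<open>auto simp: fock_deriv_eq_0\<close>)

lemma fock_vars_add: "fock_vars (f + g) \<subseteq> fock_vars f \<union> fock_vars g"
  using keys_add[of f g] by (auto simp: fock_vars_def)

lemma fock_vars_scale: "fock_vars (fock_scale c f) \<subseteq> fock_vars f"
  by (auto simp: fock_vars_def in_keys_iff)

lemma fock_vars_var_mult: "fock_vars (fock_var x * f) \<subseteq> insert x (fock_vars f)"
proof
  fix z assume "z \<in> fock_vars (fock_var x * f)"
  then obtain M where M: "coef (fock_var x * f) M \<noteq> 0" "z \<in># M"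
    by (auto simp: fock_vars_def in_keys_iff simp del: lookup_fock_var_mult)
  then have "coef f (M - {#x#}) \<noteq> 0" "x \<in># M" by (auto split: if_splits)
  moreover from this(2) M(2) have "z = x \<or> z \<in># M - {#x#}"
    by (metis insert_DiffM insert_noteq_member)
  ultimately show "z \<in> insert x (fock_vars f)"
    using fock_varsI by blast
qed

lemma fock_linear_derivation:
  fixes img :: "'i mode \<Rightarrow> 'i fock"
  shows "fock_linear (derivation img)"
proof (rule fock_linearI)
  fix f g :: "'i fock" and c
  let ?V = "fock_vars f \<union> fock_vars g"
  show "derivation img (f + g) = derivation img f + derivation img g"
    using fock_vars_add[of f g]
    by (simp add: derivation_superset[of ?V] finite_fock_vars fock_pair.linear_add[OF fock_linear_deriv]
        distrib_left sum.distrib)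
  show "derivation img (fock_scale c f) = fock_scale c (derivation img f)"
    using fock_vars_scale[of c f]
    by (simp add: derivation_superset[of "fock_vars f"] finite_fock_vars fock_pair.linear_scale[OF fock_linear_deriv]
        fock.scale_sum_right)
qed

lemma derivation_one [simp]: "derivation img 1 = 0"
  by (simp add: derivation_def)

lemma derivation_var_mult: "derivation img (fock_var y * f) = img y * f + fock_var y * derivation img f"
proof -
  let ?V = "insert y (fock_vars f)"
  have "derivation img (fock_var y * f) = (\<Sum>x\<in>?V. img x * fock_deriv x (fock_var y * f))"
    by (rule derivation_superset) (simp_all add: fock_vars_var_mult finite_fock_vars)
  also have "\<dots> = (\<Sum>x\<in>?V. fock_var y * (img x * fock_deriv x f)) + (\<Sum>x\<in>?V. if x = y then img x * f else 0)"
    unfolding sum.distrib[symmetric]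
    unfolding fock_deriv_var_mult by (intro sum.cong refl) (simp add: distrib_left mult.left_commute)
  also have "(\<Sum>x\<in>?V. if x = y then img x * f else 0) = img y * f"
    by (subst sum.delta) (simp_all add: finite_fock_vars)
  also have "(\<Sum>x\<in>?V. fock_var y * (img x * fock_deriv x f)) = fock_var y * derivation img f"
    unfolding sum_distrib_left[symmetric]
    by (subst derivation_superset[of ?V f]) (auto simp: finite_fock_vars)
  finally show ?thesis by (simp add: add.commute)
qed

section \<open>The degree filtration\<close>

text \<open>Extends a comparison of degrees from monomials to polynomials; \<open>r\<close> is
  instantiated with equality, strict decrease and non-increase.\<close>

lemma coef_linear_image:
  assumes T: "fock_linear T" and r: "\<And>K M. coef (T (Poly_Mapping.single K 1)) M \<noteq> 0 \<Longrightarrow> r (size K) (size M)"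
    and M: "coef (T w) M \<noteq> 0"
  obtains K where "coef w K \<noteq> 0" "r (size K) (size M)"
proof -
  have "w = (\<Sum>K\<in>Poly_Mapping.keys w. fock_scale (coef w K) (Poly_Mapping.single K 1))"
    by (rule poly_mapping_eqI)
      (simp add: lookup_sum lookup_single when_def if_distrib sum.delta in_keys_iff cong: if_cong)
  then have "T w = (\<Sum>K\<in>Poly_Mapping.keys w. fock_scale (coef w K) (T (Poly_Mapping.single K 1)))"
    using fock_pair.linear_sum[OF T] fock_pair.linear_scale[OF T]
    by (metis (no_types, lifting) sum.cong)
  then have "(\<Sum>K\<in>Poly_Mapping.keys w. coef w K * coef (T (Poly_Mapping.single K 1)) M) \<noteq> 0"
    using M by (simp add: lookup_sum)
  then obtain K where "K \<in> Poly_Mapping.keys w" "coef w K * coef (T (Poly_Mapping.single K 1)) M \<noteq> 0"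
    by (meson sum.neutral)
  then show ?thesis using r that by auto
qed

definition fhom :: "nat \<Rightarrow> 'i fock \<Rightarrow> 'i fock" where
  "fhom d f = (\<Sum>M\<in>{M\<in>Poly_Mapping.keys f. size M = d}. Poly_Mapping.single M (coef f M))"

lemma coef_fhom [simp]: "coef (fhom d f) M = (if size M = d then coef f M else 0)"
  by (auto simp: fhom_def lookup_sum lookup_single when_def in_keys_iff)

lemma fhom_add: "fhom d (f + g) = fhom d f + fhom d g"
  by (rule poly_mapping_eqI) (simp add: lookup_add)

lemma fhom_scale: "fhom d (fock_scale c f) = fock_scale c (fhom d f)"
  by (rule poly_mapping_eqI) simp

lemma deg_lt_fhom: "deg_lt (Suc d) f \<Longrightarrow> deg_lt d (f - fhom d f)"
  by (auto simp: deg_lt_def lookup_minus)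

lemma deg_lt_add: "deg_lt d f \<Longrightarrow> deg_lt d g \<Longrightarrow> deg_lt d (f + g)"
  by (simp add: deg_lt_def lookup_add)

lemma deg_lt_diff: "deg_lt d f \<Longrightarrow> deg_lt d g \<Longrightarrow> deg_lt d (f - g)"
  by (simp add: deg_lt_def lookup_minus)

lemma deg_lt_scale: "deg_lt d f \<Longrightarrow> deg_lt d (fock_scale c f)"
  by (simp add: deg_lt_def)

lemma deg_lt_mono: "deg_lt d f \<Longrightarrow> d \<le> e \<Longrightarrow> deg_lt e f"
  by (simp add: deg_lt_def)

lemma deg_lt_var_mult: "deg_lt d f \<Longrightarrow> deg_lt (Suc d) (fock_var x * f)"
  by (auto simp: deg_lt_def size_Diff_singleton)

lemma deg_lt_linear_image:
  assumes "fock_linear T" "\<And>K M. coef (T (Poly_Mapping.single K 1)) M \<noteq> 0 \<Longrightarrow> size M \<le> size K"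
    and "deg_lt d w"
  shows "deg_lt d (T w)"
  unfolding deg_lt_def
proof (intro allI impI, rule ccontr)
  fix M assume "d \<le> size M" "coef (T w) M \<noteq> 0"
  then obtain K where "coef w K \<noteq> 0" "size M \<le> size K"
    using coef_linear_image[where r = "\<lambda>k m. m \<le> k", OF assms(1,2)] by blast
  with \<open>d \<le> size M\<close> assms(3) show False by (auto simp: deg_lt_def)
qed

section \<open>The leading part of the adjoint currents\<close>

text \<open>The operator b \<mapsto> \<open>c b\<close> times \<open>l b\<close>, tensored with t^n,
  on the coefficient functions of an arc: multiplication by t^n moves coefficient k - n to place k.
  Sending each letter to a multiple of one letter covers both ad e and ad f.\<close>

definition shift_img :: "('i letter \<Rightarrow> complex) \<Rightarrow> ('i letter \<Rightarrow> 'i letter) \<Rightarrow> nat \<Rightarrow> 'i mode \<Rightarrow> 'i fock" where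
  "shift_img c l n = (\<lambda>(b, k). if n \<le> k then fock_scale (c b) (fock_var (l b, k - n)) else 0)"

lemma coef_letter_field_nonneg:
  assumes "coef (letter_field a (int j) w) M \<noteq> 0"
  obtains x where "coef w (add_mset x M) \<noteq> 0"
  using assms by (cases a) auto

lemma fock_linear_diff: "fock_linear S \<Longrightarrow> fock_linear T \<Longrightarrow> fock_linear (\<lambda>w. S w - T w)"
  by (intro fock_linearI)
    (simp_all add: fock_pair.linear_add fock_pair.linear_scale fock.scale_right_diff_distrib)

text \<open>Moving \<open>T\<close> past a creation mode with \<open>n \<le> k\<close> yields
  another creation mode, exactly as the derivation does; for \<open>k < n\<close> it yields an
  annihilation mode. So \<open>T\<close> minus the derivation strictly lowers the degree, and in
  degree \<open>d\<close> the equation \<open>T v = 0\<close> sees only the derivation applied to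
  the top part.\<close>

lemma derivation_shift_img_leading:
  fixes T :: "'i fock \<Rightarrow> 'i fock"
  assumes T: "fock_linear T" "T 1 = 0"
    and comm: "\<And>b p w. T (letter_field b p w) = letter_field b p (T w) + fock_scale (c b) (letter_field (l b) (int n + p) w)"
    and v: "T v = 0" "deg_lt (Suc d) v"
  shows "derivation (shift_img c l n) (fhom d v) = 0"
proof (rule poly_mapping_eqI)
  let ?D = "derivation (shift_img c l n)"
  define E where "E = (\<lambda>w. T w - ?D w)"
  have E: "fock_linear E"
    unfolding E_def by (rule fock_linear_diff[OF T(1) fock_linear_derivation])
  have E_var: "E (fock_var (b, k) * w) = fock_var (b, k) * E w
      + (if n \<le> k then 0 else fock_scale (c b) (letter_field (l b) (int (n - k - 1)) w))" for b k w
  proof -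
    have "T (fock_var (b, k) * w) = fock_var (b, k) * T w + fock_scale (c b) (letter_field (l b) (int n + (- int k - 1)) w)"
      using comm[of b "- int k - 1" w] by (simp only: letter_field_creation)
    moreover have "letter_field (l b) (int n + (- int k - 1)) w = fock_var (l b, k - n) * w" if "n \<le> k"
      using letter_field_creation[of "l b" "k - n" w] that by (simp add: of_nat_diff algebra_simps)
    moreover have "int n + (- int k - 1) = int (n - k - 1)" if "\<not> n \<le> k"
      using that by auto
    ultimately show ?thesis
      unfolding E_def derivation_var_mult by (auto simp: shift_img_def algebra_simps)
  qed
  have E_size: "size M < size K" if "coef (E (Poly_Mapping.single K 1)) M \<noteq> 0" for K M
    using that
  proof (induction K arbitrary: M)
    case empty
    then show ?case by (simp add: E_def T flip: zero_multiset_def)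
  next
    case (add x K)
    obtain b k where x: "x = (b, k)" by (cases x)
    have "coef (fock_var x * E (Poly_Mapping.single K 1)) M \<noteq> 0
      \<or> coef (letter_field (l b) (int (n - k - 1)) (Poly_Mapping.single K 1)) M \<noteq> 0"
      using add.prems unfolding single_add_mset x E_var
      by (auto simp: lookup_add simp del: lookup_fock_var_mult split: if_splits)
    then show ?case
    proof
      assume "coef (fock_var x * E (Poly_Mapping.single K 1)) M \<noteq> 0"
      then have "x \<in># M" "coef (E (Poly_Mapping.single K 1)) (M - {#x#}) \<noteq> 0"
        by (auto split: if_splits)
      then show ?thesis using add.IH[of "M - {#x#}"] by (auto simp: size_Diff_singleton)
    next
      assume "coef (letter_field (l b) (int (n - k - 1)) (Poly_Mapping.single K 1)) M \<noteq> 0"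
      then obtain y where "coef (Poly_Mapping.single K 1) (add_mset y M) \<noteq> 0"
        by (rule coef_letter_field_nonneg)
      then have "K = add_mset y M" by (auto simp: lookup_single when_def split: if_splits)
      then show ?thesis by simp
    qed
  qed
  have D_size: "size K = size M" if "coef (?D (Poly_Mapping.single K 1)) M \<noteq> 0" for K M
    using that
  proof (induction K arbitrary: M)
    case empty
    then show ?case by (simp flip: zero_multiset_def)
  next
    case (add x K)
    obtain b k where x: "x = (b, k)" by (cases x)
    have "coef (fock_var x * ?D (Poly_Mapping.single K 1)) M \<noteq> 0
      \<or> coef (fock_var (l b, k - n) * Poly_Mapping.single K 1) M \<noteq> 0"
      using add.prems unfolding single_add_mset derivation_var_mult
      by (auto simp: lookup_add shift_img_def x simp del: lookup_fock_var_mult split: if_splits)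
    then show ?case
    proof
      assume "coef (fock_var x * ?D (Poly_Mapping.single K 1)) M \<noteq> 0"
      then have "x \<in># M" "coef (?D (Poly_Mapping.single K 1)) (M - {#x#}) \<noteq> 0"
        by (auto split: if_splits)
      then show ?thesis using add.IH[of "M - {#x#}"]
        by (auto simp: size_Diff_singleton dest!: multi_member_split)
    next
      assume "coef (fock_var (l b, k - n) * Poly_Mapping.single K 1) M \<noteq> 0"
      then have "M = add_mset (l b, k - n) K"
        by (auto simp: lookup_single when_def split: if_splits)
      then show ?thesis by simp
    qed
  qed
  fix M
  show "coef (?D (fhom d v)) M = coef 0 M"
  proof (rule ccontr)
    assume "coef (?D (fhom d v)) M \<noteq> coef 0 M"
    then have ne: "coef (?D (fhom d v)) M \<noteq> 0" by simp
    then obtain K where "coef (fhom d v) K \<noteq> 0" "size K = size M"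
      using coef_linear_image[OF fock_linear_derivation, where r = "(=)"] D_size by metis
    then have M: "size M = d" by (auto split: if_splits)
    have "coef (?D (v - fhom d v)) M = 0"
    proof (rule ccontr)
      assume "coef (?D (v - fhom d v)) M \<noteq> 0"
      then obtain K where "coef (v - fhom d v) K \<noteq> 0" "size K = size M"
        using coef_linear_image[OF fock_linear_derivation, where r = "(=)"] D_size by metis
      then show False using deg_lt_fhom[OF v(2)] M by (simp add: deg_lt_def)
    qed
    then have "coef (?D v) M \<noteq> 0"
      using ne by (simp add: fock_pair.linear_diff[OF fock_linear_derivation] lookup_minus)
    then have "coef (E v) M \<noteq> 0" by (simp add: E_def v(1))
    then obtain K where "coef v K \<noteq> 0" "size M < size K"
      using coef_linear_image[OF E, where r = "\<lambda>k m. m < k"] E_size by metis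
    then show False using v(2) M by (simp add: deg_lt_def)
  qed
qed

section \<open>Leading terms of the generated subalgebra\<close>

text \<open>The coefficient of z^k in c(z) applied to the vacuum. For a quadratic state it is a
  quadratic polynomial that reads off coefficient k of a product of power series.\<close>

definition symbol :: "'i fock \<Rightarrow> nat \<Rightarrow> 'i fock" where
  "symbol c k = fock_nprod c (- int k - 1) 1"

lemma symbol_quad: "symbol (quad x y) k = (\<Sum>i\<le>k. fock_var (x, i) * fock_var (y, k - i))"
proof -
  have "symbol (quad x y) k = Sum_any (circle_term (letter_field x) (- 1) (fock_nprod (fock_var (y, 0))) (- int k - 1) 1)"
    using nprod_var_mult[of x 0 "fock_var (y, 0)"] by (simp add: symbol_def quad_def circle_prod_eq)
  also have "\<dots> = (\<Sum>j<Suc k. circle_term (letter_field x) (- 1) (fock_nprod (fock_var (y, 0))) (- int k - 1) 1 j)"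
  proof (rule Sum_any_eq_sum_lessThan)
    fix j assume "Suc k \<le> j"
    then have j: "- int k - 1 + int j = int (j - Suc k)" by (simp add: of_nat_diff)
    show "circle_term (letter_field x) (- 1) (fock_nprod (fock_var (y, 0))) (- int k - 1) 1 j = 0"
      unfolding circle_term_def nprod_var j letter_field_one by (simp add: letter_zero)
  qed
  also have "\<dots> = (\<Sum>i\<le>k. fock_var (x, i) * fock_var (y, k - i))"
    unfolding lessThan_Suc_atMost
  proof (intro sum.cong refl)
    fix j assume "j \<in> {..k}"
    then have 1: "- int k - 1 + int j = - int (k - j) - 1" by (simp add: of_nat_diff)
    have 2: "-1 - int j = - int j - 1" by simp
    show "circle_term (letter_field x) (- 1) (fock_nprod (fock_var (y, 0))) (- int k - 1) 1 j
        = fock_var (x, j) * fock_var (y, k - j)"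
      unfolding circle_term_def nprod_var letter_field_one 1 2 letter_field_creation
      by (simp add: minus_one_gchoose letter_zero power_mult_distrib[symmetric])
  qed
  finally show ?thesis .
qed

text \<open>Homogeneity of degree two, phrased through the effect of multiplication by
  \<open>q\<close>: this form passes to sums and is what the comparison of leading terms
  uses.\<close>

definition quadratic_symbol :: "'i fock \<Rightarrow> bool" where
  "quadratic_symbol q \<longleftrightarrow> (\<forall>f. fhom 0 (q * f) = 0 \<and> fhom (Suc 0) (q * f) = 0
     \<and> (\<forall>d. fhom (Suc (Suc d)) (q * f) = q * fhom d f) \<and> (\<forall>d. deg_lt d f \<longrightarrow> deg_lt (Suc (Suc d)) (q * f)))"

lemma fhom_var_mult: "fhom (Suc d) (fock_var x * f) = fock_var x * fhom d f"
  "fhom 0 (fock_var x * f) = 0"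
  by (auto intro!: poly_mapping_eqI simp: size_Diff_singleton dest!: multi_member_split)

lemma quadratic_symbol_var: "quadratic_symbol (fock_var x * fock_var y)"
  by (simp add: quadratic_symbol_def mult.assoc fhom_var_mult deg_lt_var_mult)

lemma fhom_zero [simp]: "fhom d 0 = 0"
  by (rule poly_mapping_eqI) simp

lemma quadratic_symbol_add: "quadratic_symbol p \<Longrightarrow> quadratic_symbol q \<Longrightarrow> quadratic_symbol (p + q)"
  by (simp add: quadratic_symbol_def distrib_right fhom_add deg_lt_add)

lemma quadratic_symbol_scale: "quadratic_symbol p \<Longrightarrow> quadratic_symbol (fock_scale c p)"
  by (simp add: quadratic_symbol_def fhom_scale deg_lt_scale)

lemma quadratic_symbol_zero: "quadratic_symbol 0"
  by (simp add: quadratic_symbol_def deg_lt_def)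

lemma quadratic_symbol_sum: "(\<And>i. i \<in> A \<Longrightarrow> quadratic_symbol (g i)) \<Longrightarrow> quadratic_symbol (sum g A)"
  by (induction A rule: infinite_finite_induct) (auto simp: quadratic_symbol_zero quadratic_symbol_add)

definition has_leading_symbol :: "'i fock \<Rightarrow> bool" where
  "has_leading_symbol c \<longleftrightarrow> (\<forall>k. quadratic_symbol (symbol c k)
     \<and> (\<forall>d w. deg_lt d w \<longrightarrow> deg_lt d (fock_nprod c (- int k - 1) w - symbol c k * w)))"

text \<open>In a normally ordered mode the terms with two creation modes add up to the symbol; all
  others contain an annihilation mode and do not raise the degree. \<open>E_var\<close> shows this
  recursively: passing a creation mode only trades it for another one.\<close>

lemma has_leading_symbol_quad:
  fixes x y :: "'i letter"
  shows "has_leading_symbol (quad x y)"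
  unfolding has_leading_symbol_def
proof (intro conjI allI impI)
  fix k d and w :: "'i fock"
  show "quadratic_symbol (symbol (quad x y) k)"
    by (simp add: symbol_quad quadratic_symbol_sum quadratic_symbol_var)
  define E where "E = (\<lambda>w. fock_nprod (quad x y) (- int k - 1) w - symbol (quad x y) k * w)"
  have E: "fock_linear E"
    unfolding E_def by (intro fock_linear_diff fock_linear_mult fock_field_linear fock_field_nprod)
  have E_var: "E (fock_var (b, j) * w) = fock_var (b, j) * E w
      + (fock_scale (- letter_pairing b x) (fock_var (y, k + j + 1) * w)
        + fock_scale (- letter_pairing b y) (fock_var (x, k + j + 1) * w))" for b j w
  proof -
    have m: "- int k - 1 + (- int j - 1) = - int (k + j + 1) - 1" by simp
    show ?thesis
      using letter_commutator_quadratic[of x y "- int k - 1" b "- int j - 1" w]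
      unfolding m letter_field_creation E_def quad_def[symmetric]
      by (simp add: algebra_simps)
  qed
  have "size M \<le> size K" if "coef (E (Poly_Mapping.single K 1)) M \<noteq> 0" for K M
    using that
  proof (induction K arbitrary: M)
    case empty
    then show ?case by (simp add: E_def symbol_def flip: zero_multiset_def)
  next
    case (add z K)
    obtain b j where z: "z = (b, j)" by (cases z)
    have "coef (fock_var z * E (Poly_Mapping.single K 1)) M \<noteq> 0
      \<or> coef (fock_var (y, k + j + 1) * Poly_Mapping.single K 1) M \<noteq> 0
      \<or> coef (fock_var (x, k + j + 1) * Poly_Mapping.single K 1) M \<noteq> 0"
      using add.prems unfolding single_add_mset z E_var
      by (auto simp: lookup_add lookup_minus simp del: lookup_fock_var_mult)
    then show ?case
      using add.IH[of "M - {#z#}"]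
      by (auto simp: lookup_single when_def size_Diff_singleton split: if_splits dest!: multi_member_split)
  qed
  then show "deg_lt d (fock_nprod (quad x y) (- int k - 1) w - symbol (quad x y) k * w)" if "deg_lt d w"
    using deg_lt_linear_image[OF E _ that] by (simp add: E_def)
qed

lemma symbol_add: "symbol (a + b) k = symbol a k + symbol b k"
  and symbol_scale: "symbol (fock_scale c a) k = fock_scale c (symbol a k)"
  by (simp_all add: symbol_def nprod_add nprod_scale)

lemma has_leading_symbol_add:
  assumes "has_leading_symbol a" "has_leading_symbol b"
  shows "has_leading_symbol (a + b)"
  unfolding has_leading_symbol_def symbol_add nprod_add
proof (intro conjI allI impI)
  fix k d and w :: "'a fock" assume "deg_lt d w"
  then have "deg_lt d ((fock_nprod a (- int k - 1) w - symbol a k * w) + (fock_nprod b (- int k - 1) w - symbol b k * w))"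
    using assms by (intro deg_lt_add) (auto simp: has_leading_symbol_def)
  then show "deg_lt d (fock_nprod a (- int k - 1) w + fock_nprod b (- int k - 1) w - (symbol a k + symbol b k) * w)"
    by (simp add: algebra_simps)
qed (use assms in \<open>simp add: has_leading_symbol_def quadratic_symbol_add\<close>)

lemma has_leading_symbol_scale:
  assumes "has_leading_symbol a"
  shows "has_leading_symbol (fock_scale c a)"
  using assms unfolding has_leading_symbol_def symbol_scale nprod_scale
  by (simp add: quadratic_symbol_scale deg_lt_scale fock.scale_right_diff_distrib[symmetric])

lemma has_leading_symbol_currents: "x \<in> {cur_e, cur_f, cur_h} \<Longrightarrow> has_leading_symbol x"
  by (elim insertE emptyE) (simp_all only: currents_def has_leading_symbol_quad has_leading_symbol_add has_leading_symbol_scale)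

inductive_set symbol_ring :: "sl2_index fock set" where
  one: "1 \<in> symbol_ring"
| add: "f \<in> symbol_ring \<Longrightarrow> g \<in> symbol_ring \<Longrightarrow> f + g \<in> symbol_ring"
| scale: "f \<in> symbol_ring \<Longrightarrow> fock_scale c f \<in> symbol_ring"
| step: "x \<in> {cur_e, cur_f, cur_h} \<Longrightarrow> f \<in> symbol_ring \<Longrightarrow> symbol x k * f \<in> symbol_ring"

lemma sl2_words_zero: "0 \<in> sl2_words"
  using sl2_words.scale[OF sl2_words.one, of 0] by simp

text \<open>Elements of \<open>symbol_ring\<close> need not be homogeneous, so the induction lifts
  all homogeneous parts at once; a product with a symbol is lifted by applying the corresponding
  mode to a lift of the other factor.\<close>

lemma sl2_words_leading:
  assumes "f \<in> symbol_ring"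
  shows "\<exists>a\<in>sl2_words. deg_lt d (a - fhom d f)"
  using assms
proof (induction arbitrary: d)
  case one
  have "fhom d 1 = (if d = 0 then 1 else 0 :: sl2_index fock)"
    by (rule poly_mapping_eqI) (auto simp: lookup_one when_def)
  moreover have "deg_lt d 0" by (simp add: deg_lt_def)
  ultimately show ?case
    by (cases "d = 0") (use sl2_words.one sl2_words_zero in force)+
next
  case (add f g)
  obtain a b where "a \<in> sl2_words" "deg_lt d (a - fhom d f)" "b \<in> sl2_words" "deg_lt d (b - fhom d g)"
    using add.IH by meson
  then show ?case
    by (intro bexI[of _ "a + b"])
      (use deg_lt_add in \<open>auto simp: fhom_add add_diff_add sl2_words.add\<close>)
next
  case (scale f c)
  then obtain a where "a \<in> sl2_words" "deg_lt d (a - fhom d f)" by meson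
  then show ?case
    by (intro bexI[of _ "fock_scale c a"])
      (auto simp: fhom_scale fock.scale_right_diff_distrib[symmetric] sl2_words.scale deg_lt_scale)
next
  case (step x f k)
  have x: "has_leading_symbol x" using step by (intro has_leading_symbol_currents)
  then have q: "quadratic_symbol (symbol x k)" by (simp add: has_leading_symbol_def)
  show ?case
  proof (cases "\<exists>e. d = Suc (Suc e)")
    case True
    then obtain e where d: "d = Suc (Suc e)" ..
    obtain a where a: "a \<in> sl2_words" "deg_lt e (a - fhom e f)" using step by meson
    have "deg_lt (Suc e) a"
    proof -
      have "deg_lt (Suc e) (fhom e f)" by (simp add: deg_lt_def)
      from deg_lt_add[OF this deg_lt_mono[OF a(2), of "Suc e"]] show ?thesis by simp
    qed
    then have "deg_lt (Suc e) (fock_nprod x (- int k - 1) a - symbol x k * a)"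
      using x by (simp add: has_leading_symbol_def)
    then have "deg_lt d (fock_nprod x (- int k - 1) a - symbol x k * a)"
      by (rule deg_lt_mono) (simp add: d)
    moreover have "deg_lt d (symbol x k * (a - fhom e f))"
      using q a(2) by (simp add: quadratic_symbol_def d)
    moreover have "fhom d (symbol x k * f) = symbol x k * fhom e f"
      using q by (simp add: quadratic_symbol_def d)
    ultimately have "deg_lt d (fock_nprod x (- int k - 1) a - fhom d (symbol x k * f))"
      using deg_lt_add by (fastforce simp: algebra_simps)
    then show ?thesis using sl2_words.step a(1) step(1) by blast
  next
    case False
    then have "d = 0 \<or> d = Suc 0" by (metis not0_implies_Suc)
    then have "fhom d (symbol x k * f) = 0"
      using q by (auto simp: quadratic_symbol_def)
    then show ?thesis
      using sl2_words_zero by (intro bexI[of _ 0]) (auto simp: deg_lt_def)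
  qed
qed

section \<open>Invariance under the arc group\<close>

notation fps_nth (infixl "$$" 75)

definition arc_point :: "('i letter \<Rightarrow> complex fps) \<Rightarrow> 'i mode \<Rightarrow> complex" where
  "arc_point X = (\<lambda>(b, k). X b $$ k)"

text \<open>A power series in t acts as an infinite sum of shifts, but the n-th shift kills every
  mode \<open>(b, k)\<close> with \<open>k < n\<close>, and \<open>f\<close> involves only finitely
  many modes.\<close>

lemma derivation_shift_img_series:
  assumes "\<And>n. derivation (shift_img c l n) f = 0"
  shows "derivation (\<lambda>x. \<Sum>n\<le>snd x. fock_scale (a n) (shift_img c l n x)) f = 0"
proof -
  have "finite (snd ` fock_vars f)" by (simp add: finite_fock_vars)
  then obtain N where N: "\<And>k. k \<in> snd ` fock_vars f \<Longrightarrow> k < N"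
    unfolding finite_nat_set_iff_bounded by auto
  have "derivation (\<lambda>x. \<Sum>n\<le>snd x. fock_scale (a n) (shift_img c l n x)) f
      = (\<Sum>x\<in>fock_vars f. \<Sum>n<N. fock_scale (a n) (shift_img c l n x * fock_deriv x f))"
    unfolding derivation_def
  proof (intro sum.cong refl)
    fix x assume "x \<in> fock_vars f"
    then have "snd x < N" by (intro N) auto
    then have "(\<Sum>n\<le>snd x. fock_scale (a n) (shift_img c l n x)) = (\<Sum>n<N. fock_scale (a n) (shift_img c l n x))"
      by (intro sum.mono_neutral_left) (auto simp: shift_img_def split: prod.splits)
    then show "(\<Sum>n\<le>snd x. fock_scale (a n) (shift_img c l n x)) * fock_deriv x f
        = (\<Sum>n<N. fock_scale (a n) (shift_img c l n x * fock_deriv x f))"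
      by (simp add: sum_distrib_right)
  qed
  also have "\<dots> = (\<Sum>n<N. fock_scale (a n) (derivation (shift_img c l n) f))"
    unfolding derivation_def by (subst sum.swap) (simp add: fock.scale_sum_right)
  finally show ?thesis by (simp add: assms)
qed

text \<open>The nilpotency condition makes the flow of the derivation quadratic in time.\<close>

lemma poly_eval_flow:
  fixes X :: "'i letter \<Rightarrow> complex fps"
  assumes f: "\<And>n. derivation (shift_img c l n) f = 0"
    and nil: "\<And>b. c b * (c (l b) * c (l (l b))) = 0"
  shows "poly_eval (arc_point (\<lambda>b. X b + fps_const (c b) * (a * X (l b))
      + fps_const (c b * c (l b) / 2) * (a * (a * X (l (l b)))))) f = poly_eval (arc_point X) f"
proof -
  define Z where "Z s b = X b + fps_const (s * c b) * (a * X (l b))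
      + fps_const (s ^ 2 * (c b * c (l b) / 2)) * (a * (a * X (l (l b))))" for s b
  define img where "img x = (\<Sum>n\<le>snd x. fock_scale (a $$ n) (shift_img c l n x))" for x :: "'i mode"
  have img0: "derivation img f = 0"
    unfolding img_def by (rule derivation_shift_img_series) (rule f)
  have ev: "poly_eval (arc_point (Z s)) (img (b, k)) = c b * (a * Z s (l b)) $$ k" for s b k
    by (simp add: img_def poly_eval_sum shift_img_def arc_point_def fps_mult_nth atLeast0AtMost sum_distrib_left mult_ac)
  have aZ: "c b * (a * Z s (l b)) $$ k = c b * (a * X (l b)) $$ k + s * (c b * c (l b)) * (a * (a * X (l (l b)))) $$ k" for s b k
  proof -
    have "a * Z s (l b) = a * X (l b) + fps_const (s * c (l b)) * (a * (a * X (l (l b))))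
        + fps_const (s ^ 2 * (c (l b) * c (l (l b)) / 2)) * (a * (a * (a * X (l (l (l b))))))"
      by (simp add: Z_def algebra_simps)
    then have "c b * (a * Z s (l b)) $$ k = c b * (a * X (l b)) $$ k + s * (c b * c (l b)) * (a * (a * X (l (l b)))) $$ k
      + (c b * (c (l b) * c (l (l b)))) * (s ^ 2 / 2 * (a * (a * (a * X (l (l (l b)))))) $$ k)"
      by (simp only: fps_add_nth fps_mult_left_const_nth) (simp add: field_simps)
    then show ?thesis unfolding nil by simp
  qed
  have "((\<lambda>s. poly_eval (arc_point (Z s)) f) has_field_derivative poly_eval (arc_point (Z s)) (derivation img f)) (at s)" for s
  proof (rule poly_eval_has_field_derivative)
    fix x :: "'i mode"
    obtain b k where x: "x = (b, k)" by (cases x)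
    have "((\<lambda>s. X b $$ k + s * c b * (a * X (l b)) $$ k + s ^ 2 * (c b * c (l b) / 2) * (a * (a * X (l (l b)))) $$ k)
        has_field_derivative (c b * (a * X (l b)) $$ k + s * (c b * c (l b)) * (a * (a * X (l (l b)))) $$ k)) (at s)"
      by (auto intro!: derivative_eq_intros)
    then show "((\<lambda>s. arc_point (Z s) x) has_field_derivative poly_eval (arc_point (Z s)) (img x)) (at s)"
      by (simp only: x ev aZ) (simp add: arc_point_def Z_def)
  qed (simp_all add: fock_linear_derivation derivation_var_mult)
  then have "\<exists>k. \<forall>s\<in>UNIV. poly_eval (arc_point (Z s)) f = k"
    by (intro has_field_derivative_zero_constant) (auto simp: img0)
  then have "poly_eval (arc_point (Z 1)) f = poly_eval (arc_point (Z 0)) f" by auto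
  then show ?thesis by (simp add: Z_def[abs_def])
qed

text \<open>A pair of traceless 2-by-2 matrices of power series with entries \<open>xh, xe, xf, -xh\<close>. Rescaling
  the coordinates turns the coadjoint actions on the \<open>\<beta>\<close> and on the \<open>\<gamma>\<close> into conjugation.\<close>

fun matrix_coords where
  "matrix_coords xe xf xh ye yf yh (Beta Ie) = (xe :: complex fps)"
| "matrix_coords xe xf xh ye yf yh (Beta If) = xf"
| "matrix_coords xe xf xh ye yf yh (Beta Ih) = 2 * xh"
| "matrix_coords xe xf xh ye yf yh (Gamma Ie) = yf"
| "matrix_coords xe xf xh ye yf yh (Gamma If) = ye"
| "matrix_coords xe xf xh ye yf yh (Gamma Ih) = yh"

text \<open>Read off from the commutators of \<open>theta_e\<close> with letters, see
  \<open>theta_letter\<close>. The letters form two chains of length three, each ending with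
  coefficient 0, whence the nilpotency; the letter that \<open>ad_e_letter\<close> assigns at the
  end of a chain is a placeholder.\<close>

fun ad_e_coef :: "sl2_index letter \<Rightarrow> complex" where
  "ad_e_coef (Beta Ih) = - 2" | "ad_e_coef (Beta If) = 1" | "ad_e_coef (Beta Ie) = 0"
| "ad_e_coef (Gamma Ih) = - 1" | "ad_e_coef (Gamma Ie) = 2" | "ad_e_coef (Gamma If) = 0"

fun ad_e_letter :: "sl2_index letter \<Rightarrow> sl2_index letter" where
  "ad_e_letter (Beta Ih) = Beta Ie" | "ad_e_letter (Beta If) = Beta Ih" | "ad_e_letter (Beta Ie) = Beta Ie"
| "ad_e_letter (Gamma Ih) = Gamma If" | "ad_e_letter (Gamma Ie) = Gamma Ih" | "ad_e_letter (Gamma If) = Gamma If"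

fun ad_f_coef :: "sl2_index letter \<Rightarrow> complex" where
  "ad_f_coef (Beta Ih) = 2" | "ad_f_coef (Beta Ie) = - 1" | "ad_f_coef (Beta If) = 0"
| "ad_f_coef (Gamma Ih) = 1" | "ad_f_coef (Gamma If) = - 2" | "ad_f_coef (Gamma Ie) = 0"

fun ad_f_letter :: "sl2_index letter \<Rightarrow> sl2_index letter" where
  "ad_f_letter (Beta Ih) = Beta If" | "ad_f_letter (Beta Ie) = Beta Ih" | "ad_f_letter (Beta If) = Beta If"
| "ad_f_letter (Gamma Ih) = Gamma Ie" | "ad_f_letter (Gamma If) = Gamma Ih" | "ad_f_letter (Gamma Ie) = Gamma Ie"

section \<open>Action of the adjoint currents on letters and on arcs\<close>

lemma letter_cases: "b \<in> {Beta Ie, Beta If, Beta Ih, Gamma Ie, Gamma If, Gamma Ih}"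
proof (cases b)
  case (Beta i)
  then show ?thesis by (cases i) simp_all
next
  case (Gamma i)
  then show ?thesis by (cases i) simp_all
qed

lemma theta_letter:
  "fock_nprod theta_e m (letter_field b p w) = letter_field b p (fock_nprod theta_e m w)
     + fock_scale (ad_e_coef b) (letter_field (ad_e_letter b) (m + p) w)"
  "fock_nprod theta_f m (letter_field b p w) = letter_field b p (fock_nprod theta_f m w)
     + fock_scale (ad_f_coef b) (letter_field (ad_f_letter b) (m + p) w)"
proof -
  note comm = letter_commutator_quadratic[folded quad_def, of _ _ m b p w]
  show "fock_nprod theta_e m (letter_field b p w) = letter_field b p (fock_nprod theta_e m w)
     + fock_scale (ad_e_coef b) (letter_field (ad_e_letter b) (m + p) w)"
    using letter_cases[of b] unfolding theta_e_def nprod_add nprod_scale comm letter_add letter_scale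
    by (elim insertE emptyE) (simp_all add: fock.scale_right_distrib fock.scale_right_diff_distrib)
  show "fock_nprod theta_f m (letter_field b p w) = letter_field b p (fock_nprod theta_f m w)
     + fock_scale (ad_f_coef b) (letter_field (ad_f_letter b) (m + p) w)"
    using letter_cases[of b] unfolding theta_f_def nprod_add nprod_scale comm letter_add letter_scale
    by (elim insertE emptyE) (simp_all add: fock.scale_right_distrib fock.scale_right_diff_distrib)
qed

definition arc_invariant :: "sl2_index fock \<Rightarrow> bool" where
  "arc_invariant f \<longleftrightarrow> (\<forall>n. derivation (shift_img ad_e_coef ad_e_letter n) f = 0
     \<and> derivation (shift_img ad_f_coef ad_f_letter n) f = 0)"

lemma arc_invariant_leading:
  assumes "\<And>n. n \<ge> 0 \<Longrightarrow> fock_nprod theta_e n v = 0 \<and> fock_nprod theta_f n v = 0"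
    and "deg_lt (Suc d) v"
  shows "arc_invariant (fhom d v)"
  unfolding arc_invariant_def
proof (intro allI conjI)
  fix n
  show "derivation (shift_img ad_e_coef ad_e_letter n) (fhom d v) = 0"
    by (rule derivation_shift_img_leading[where T = "fock_nprod theta_e (int n)"])
      (use assms in \<open>simp_all add: theta_letter fock_field_linear fock_field_nprod nprod_vacuum_nonneg\<close>)
  show "derivation (shift_img ad_f_coef ad_f_letter n) (fhom d v) = 0"
    by (rule derivation_shift_img_leading[where T = "fock_nprod theta_f (int n)"])
      (use assms in \<open>simp_all add: theta_letter fock_field_linear fock_field_nprod nprod_vacuum_nonneg\<close>)
qed

text \<open>The time-one flows are simultaneous conjugations of both matrices: for e by the matrix
  with rows (1, 0), (a, 1), for f by the one with rows (1, a), (0, 1).\<close>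

lemma arc_invariant_elementary:
  assumes "arc_invariant f"
  shows "poly_eval (arc_point (matrix_coords xe (xf + 2 * a * xh - a * a * xe) (xh - a * xe)
      ye (yf + 2 * a * yh - a * a * ye) (yh - a * ye))) f
    = poly_eval (arc_point (matrix_coords xe xf xh ye yf yh)) f"
    and "poly_eval (arc_point (matrix_coords (xe - 2 * a * xh - a * a * xf) xf (xh + a * xf)
      (ye - 2 * a * yh - a * a * yf) yf (yh + a * yf))) f
    = poly_eval (arc_point (matrix_coords xe xf xh ye yf yh)) f"
proof -
  let ?X = "matrix_coords xe xf xh ye yf yh"
  have "matrix_coords xe (xf + 2 * a * xh - a * a * xe) (xh - a * xe) ye (yf + 2 * a * yh - a * a * ye) (yh - a * ye)
      = (\<lambda>b. ?X b + fps_const (ad_e_coef b) * (a * ?X (ad_e_letter b))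
      + fps_const (ad_e_coef b * ad_e_coef (ad_e_letter b) / 2) * (a * (a * ?X (ad_e_letter (ad_e_letter b)))))"
    (is "?l = ?r")
  proof
    fix b show "?l b = ?r b"
      using letter_cases[of b]
      by (elim insertE emptyE) (simp_all add: algebra_simps numeral_fps_const neg_numeral_fps_const flip: fps_const_neg)
  qed
  moreover have "ad_e_coef b * (ad_e_coef (ad_e_letter b) * ad_e_coef (ad_e_letter (ad_e_letter b))) = 0" for b
    using letter_cases[of b] by (elim insertE emptyE) simp_all
  ultimately show "poly_eval (arc_point (matrix_coords xe (xf + 2 * a * xh - a * a * xe) (xh - a * xe)
      ye (yf + 2 * a * yh - a * a * ye) (yh - a * ye))) f = poly_eval (arc_point ?X) f"
    using poly_eval_flow[of ad_e_coef ad_e_letter f ?X a] assms by (simp only: arc_invariant_def)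
  have "matrix_coords (xe - 2 * a * xh - a * a * xf) xf (xh + a * xf) (ye - 2 * a * yh - a * a * yf) yf (yh + a * yf)
      = (\<lambda>b. ?X b + fps_const (ad_f_coef b) * (a * ?X (ad_f_letter b))
      + fps_const (ad_f_coef b * ad_f_coef (ad_f_letter b) / 2) * (a * (a * ?X (ad_f_letter (ad_f_letter b)))))"
    (is "?l = ?r")
  proof
    fix b show "?l b = ?r b"
      using letter_cases[of b]
      by (elim insertE emptyE) (simp_all add: algebra_simps numeral_fps_const neg_numeral_fps_const flip: fps_const_neg)
  qed
  moreover have "ad_f_coef b * (ad_f_coef (ad_f_letter b) * ad_f_coef (ad_f_letter (ad_f_letter b))) = 0" for b
    using letter_cases[of b] by (elim insertE emptyE) simp_all
  ultimately show "poly_eval (arc_point (matrix_coords (xe - 2 * a * xh - a * a * xf) xf (xh + a * xf)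
      (ye - 2 * a * yh - a * a * yf) yf (yh + a * yf))) f = poly_eval (arc_point ?X) f"
    using poly_eval_flow[of ad_f_coef ad_f_letter f ?X a] assms by (simp only: arc_invariant_def)
qed

section \<open>Normal forms of pairs of traceless matrices\<close>

lemma fps_sqrt_exists:
  fixes a :: "complex fps"
  assumes "a $$ 0 \<noteq> 0"
  shows "\<exists>r. r * r = a"
proof -
  have "(csqrt (a $$ 0)) ^ Suc 1 = a $$ 0" by (simp add: power2_eq_square[symmetric])
  then have "fps_radical (\<lambda>_. csqrt) (Suc 1) a ^ Suc 1 = a"
    using power_radical[OF assms, of "\<lambda>_. csqrt" 1] by simp
  then show ?thesis by (intro exI[of _ "fps_radical (\<lambda>_. csqrt) (Suc 1) a"]) simp
qed

text \<open>Diagonalise the second matrix, then rescale the first one by the torus.\<close>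

lemma elementary_normal_form:
  fixes F :: "complex fps \<Rightarrow> complex fps \<Rightarrow> complex fps \<Rightarrow> complex fps \<Rightarrow> complex fps \<Rightarrow> complex fps \<Rightarrow> 'b"
  assumes L: "\<And>a xe xf xh ye yf yh. F xe (xf + 2 * a * xh - a * a * xe) (xh - a * xe)
      ye (yf + 2 * a * yh - a * a * ye) (yh - a * ye) = F xe xf xh ye yf yh"
    and U: "\<And>a xe xf xh ye yf yh. F (xe - 2 * a * xh - a * a * xf) xf (xh + a * xf)
      (ye - 2 * a * yh - a * a * yf) yf (yh + a * yf) = F xe xf xh ye yf yh"
    and s: "s * s = yh * yh + ye * yf" "s $$ 0 \<noteq> 0" and yf: "yf $$ 0 \<noteq> 0"
    and w: "2 * s * w = 2 * xh * yh + xe * yf + xf * ye"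
    and det: "(xh * xh + xe * xf - w * w) $$ 0 \<noteq> 0"
  shows "F xe xf xh ye yf yh = F 1 (xh * xh + xe * xf - w * w) w 0 0 s"
proof -
  \<comment> \<open>Upper u, lower -v, upper u multiply to the Weyl element with rows (0, u), (-v,
    0) when u v = 1; this is conjugation by it.\<close>
  have W: "F (- (u * u * xf)) (- (v * v * xe)) (- xh) (- (u * u * yf)) (- (v * v * ye)) (- yh) = F xe xf xh ye yf yh"
    if uv: "u * v = 1" for u v xe xf xh ye yf yh
  proof -
    let ?e = "\<lambda>e f h. e - 2 * u * h - u * u * f" and ?h = "\<lambda>f h. h + u * f"
    let ?f = "\<lambda>e f h. f + 2 * (- v) * ?h f h - (- v) * (- v) * ?e e f h"
    let ?k = "\<lambda>e f h. ?h f h - (- v) * ?e e f h"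
    have k: "?k e f h = v * e - h" and f: "?f e f h = - (v * v * e)" for e f h
      using uv by algebra+
    have "F xe xf xh ye yf yh = F (?e xe xf xh) (?f xe xf xh) (?k xe xf xh) (?e ye yf yh) (?f ye yf yh) (?k ye yf yh)"
      by (simp only: L U)
    also have "\<dots> = F (?e xe xf xh) (- (v * v * xe)) (v * xe - xh) (?e ye yf yh) (- (v * v * ye)) (v * ye - yh)"
      by (simp only: k f)
    also have "\<dots> = F (?e (?e xe xf xh) (- (v * v * xe)) (v * xe - xh)) (- (v * v * xe)) (?h (- (v * v * xe)) (v * xe - xh))
        (?e (?e ye yf yh) (- (v * v * ye)) (v * ye - yh)) (- (v * v * ye)) (?h (- (v * v * ye)) (v * ye - yh))"
      by (simp only: U)
    also have "?e (?e xe xf xh) (- (v * v * xe)) (v * xe - xh) = - (u * u * xf)" using uv by algebra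
    also have "?e (?e ye yf yh) (- (v * v * ye)) (v * ye - yh) = - (u * u * yf)" using uv by algebra
    also have "?h (- (v * v * xe)) (v * xe - xh) = - xh" using uv by algebra
    also have "?h (- (v * v * ye)) (v * ye - yh) = - yh" using uv by algebra
    finally show ?thesis by simp
  qed
  \<comment> \<open>The Weyl elements for the parameters u and 1 compose, up to sign, to diag(u,
    v).\<close>
  have torus: "F (u * u * xe) (v * v * xf) xh (u * u * ye) (v * v * yf) yh = F xe xf xh ye yf yh"
    if uv: "u * v = 1" for u v xe xf xh ye yf yh
    using W[OF uv, of "- xe" "- xf" "- xh" "- ye" "- yf" "- yh"] W[of 1 1 xf xe xh yf ye yh] by simp
  \<comment> \<open>\<open>a\<close> solves yh + a yf = s, which kills the upper right entry of y
    because s squares to -det y; \<open>b\<close> then solves yf + 2 b s = 0 and clears the lower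
    left entry.\<close>
  define a where "a = (s - yh) * inverse yf"
  define half :: "complex fps" where "half = fps_const (1/2)"
  define b where "b = - (half * (yf * inverse s))"
  have a: "a * yf = s - yh"
    using inverse_mult_eq_1[OF yf] by (simp add: a_def mult.assoc)
  have "2 * s * b = - ((2 * half) * yf * (inverse s * s))" by (simp add: b_def mult_ac)
  moreover have "2 * half = 1" by (simp add: half_def numeral_fps_const)
  ultimately have b: "2 * s * b = - yf"
    using inverse_mult_eq_1[OF s(2)] by simp
  define x1e x1h where "x1e = xe - 2 * a * xh - a * a * xf" and "x1h = xh + a * xf"
  define x2f x2h where "x2f = xf + 2 * b * x1h - b * b * x1e" and "x2h = x1h - b * x1e"
  have "yf * (ye - 2 * a * yh - a * a * yf) = 0" using a s(1) by algebra
  moreover have "yf \<noteq> 0" "s \<noteq> 0" using yf s(2) by auto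
  ultimately have y1: "ye - 2 * a * yh - a * a * yf = 0" by simp
  have "F xe xf xh ye yf yh = F x1e xf x1h 0 yf s"
    using U[of xe a xh xf ye yh yf] a by (simp add: y1 x1e_def x1h_def)
  also have "\<dots> = F x1e x2f x2h 0 0 s"
    using L[of x1e xf b x1h 0 yf s] b by (simp add: x2f_def x2h_def mult_ac)
  finally have F2: "F xe xf xh ye yf yh = F x1e x2f x2h 0 0 s" .
  \<comment> \<open>Both sides are the invariant tr(xy); on the left y has already become diag(s,
    -s).\<close>
  have "2 * s * x2h = 2 * s * w"
  proof -
    have "2 * s * x2h = 2 * s * x1h + yf * x1e" using b unfolding x2h_def by algebra
    also have "\<dots> = 2 * xh * yh + xe * yf + xf * ye"
      using a y1 unfolding x1h_def x1e_def by algebra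
    finally show ?thesis using w by simp
  qed
  then have x2h: "x2h = w" using \<open>s \<noteq> 0\<close> by simp
  \<comment> \<open>Invariance of -det x. By \<open>det\<close> the product is a unit, hence so is
    x1e, and the torus can scale it to 1.\<close>
  have x2: "x1e * x2f = xh * xh + xe * xf - w * w"
    unfolding x2h[symmetric] x2f_def x2h_def x1e_def x1h_def by algebra
  with det have "x1e $$ 0 \<noteq> 0" by (metis fps_mult_nth_0 mult_zero_left)
  then obtain v where v: "v * v = x1e" using fps_sqrt_exists by blast
  then have v0: "v $$ 0 \<noteq> 0" using \<open>x1e $$ 0 \<noteq> 0\<close> by auto
  define u where "u = inverse v"
  have uv: "u * v = 1" unfolding u_def using v0 by (rule inverse_mult_eq_1)
  have "F x1e x2f x2h 0 0 s = F (u * u * x1e) (v * v * x2f) x2h 0 0 s"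
    using torus[OF uv, of x1e x2f x2h 0 0 s] by simp
  also have "u * u * x1e = 1" using uv v by algebra
  also have "v * v * x2f = xh * xh + xe * xf - w * w" using v x2 by simp
  finally show ?thesis using F2 x2h by simp
qed

section \<open>Arc invariants are generated by the symbols\<close>

text \<open>In the matrices x, y of \<open>matrix_coords\<close> the three forms are -det x, -det y
  and tr(xy); the factor 1/4 is due to \<open>Beta Ih\<close> being twice the entry xh.\<close>

abbreviation (input) xx_form where "xx_form X \<equiv> fps_const (1/4) * (X (Beta Ih) * X (Beta Ih)) + X (Beta Ie) * X (Beta If)"
abbreviation (input) yy_form where "yy_form X \<equiv> X (Gamma Ih) * X (Gamma Ih) + X (Gamma If) * X (Gamma Ie)"
abbreviation (input) xy_form where "xy_form X \<equiv> X (Beta Ih) * X (Gamma Ih) + X (Beta Ie) * X (Gamma Ie) + X (Beta If) * X (Gamma If)"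

lemma poly_eval_symbol_quad: "poly_eval (arc_point X) (symbol (quad a b) k) = (X a * X b) $$ k"
  by (simp add: symbol_quad poly_eval_sum arc_point_def fps_mult_nth atLeast0AtMost)

lemma poly_eval_symbol_currents:
  "poly_eval (arc_point X) (symbol cur_e k) = 4 * yy_form X $$ k"
  "poly_eval (arc_point X) (symbol cur_f k) = - (1/4) * xx_form X $$ k"
  "poly_eval (arc_point X) (symbol cur_h k) = xy_form X $$ k"
  unfolding currents_def symbol_add symbol_scale poly_eval_add poly_eval_scale poly_eval_symbol_quad
  by (simp_all add: mult.commute)

lemma arc_point_surj: "\<exists>X. p = arc_point X"
  by (rule exI[of _ "\<lambda>b. Abs_fps (\<lambda>k. p (b, k))"]) (auto simp: arc_point_def)

text \<open>Witness: x lower triangular with diagonal r, -r, and y with zero diagonal. The entry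
  \<open>c\<close> is arbitrary, so the other two forms are free also where the constant coefficient
  of \<open>c\<close> is 0.\<close>

lemma gram_surj:
  fixes a b c :: "complex fps"
  assumes "a $$ 0 \<noteq> 0"
  shows "\<exists>X. xx_form X = a \<and> xy_form X = b \<and> yy_form X = c"
proof -
  obtain r where "r * r = a" using fps_sqrt_exists[OF assms] by blast
  then have "fps_const (1/4) * (2 * r * (2 * r)) = a"
    by (simp add: numeral_fps_const mult_ac)
  then show ?thesis
    by (intro exI[of _ "matrix_coords 0 b r 1 c 0"]) simp
qed

lemma symbol_ring_zero: "0 \<in> symbol_ring"
  using symbol_ring.scale[OF symbol_ring.one, of 0] by simp

lemma symbol_ring_mult: "f \<in> symbol_ring \<Longrightarrow> g \<in> symbol_ring \<Longrightarrow> f * g \<in> symbol_ring"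
  by (induction f rule: symbol_ring.induct)
    (auto simp: distrib_right mult.assoc intro: symbol_ring.intros)

lemma symbol_in_ring: "x \<in> {cur_e, cur_f, cur_h} \<Longrightarrow> symbol x k \<in> symbol_ring"
  using symbol_ring.step[OF _ symbol_ring.one, of x k] by simp

subsection \<open>Cancelling the denominator\<close>

text \<open>Home of the remainders on division by \<open>symbol cur_e 0\<close>, which is four times
  the constant coefficient of \<open>yy_form\<close>.\<close>

inductive_set reduced_ring :: "sl2_index fock set" where
  one: "1 \<in> reduced_ring"
| add: "f \<in> reduced_ring \<Longrightarrow> g \<in> reduced_ring \<Longrightarrow> f + g \<in> reduced_ring"
| scale: "f \<in> reduced_ring \<Longrightarrow> fock_scale c f \<in> reduced_ring"
| step: "x \<in> {cur_e, cur_f, cur_h} \<Longrightarrow> \<not> (x = cur_e \<and> k = 0) \<Longrightarrow> f \<in> reduced_ring \<Longrightarrow> symbol x k * f \<in> reduced_ring"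

lemma symbol_ring_split:
  assumes "f \<in> symbol_ring"
  shows "\<exists>f0\<in>reduced_ring. \<exists>f1\<in>symbol_ring. f = f0 + symbol cur_e 0 * f1"
  using assms
proof induction
  case one
  then show ?case using reduced_ring.one symbol_ring_zero by force
next
  case (add f g)
  then obtain f0 f1 g0 g1 where "f0 \<in> reduced_ring" "f1 \<in> symbol_ring" "f = f0 + symbol cur_e 0 * f1"
    "g0 \<in> reduced_ring" "g1 \<in> symbol_ring" "g = g0 + symbol cur_e 0 * g1" by metis
  then show ?case
    by (intro bexI[of _ "f0 + g0"] bexI[of _ "f1 + g1"])
      (auto simp: distrib_left intro: reduced_ring.add symbol_ring.add)
next
  case (scale f c)
  then obtain f0 f1 where "f0 \<in> reduced_ring" "f1 \<in> symbol_ring" "f = f0 + symbol cur_e 0 * f1" by metis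
  then show ?case
    by (intro bexI[of _ "fock_scale c f0"] bexI[of _ "fock_scale c f1"])
      (auto simp: fock.scale_right_distrib intro: reduced_ring.scale symbol_ring.scale)
next
  case (step x f k)
  then obtain f0 f1 where f: "f0 \<in> reduced_ring" "f1 \<in> symbol_ring" "f = f0 + symbol cur_e 0 * f1" by metis
  show ?case
  proof (cases "x = cur_e \<and> k = 0")
    case True
    have "0 \<in> reduced_ring" using reduced_ring.scale[OF reduced_ring.one, of 0] by simp
    then show ?thesis using True step(2) by force
  next
    case False
    have "symbol x k * f = symbol x k * f0 + symbol cur_e 0 * (symbol x k * f1)"
      by (simp add: f(3) algebra_simps)
    then show ?thesis
      using reduced_ring.step[OF step(1) False f(1)] symbol_ring.step[OF step(1) f(2)] by blast
  qed
qed

lemma reduced_ring_eval_cong: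
  assumes "f \<in> reduced_ring" and "xx_form X = xx_form Z" "xy_form X = xy_form Z"
    and "\<And>k. k > 0 \<Longrightarrow> yy_form X $$ k = yy_form Z $$ k"
  shows "poly_eval (arc_point X) f = poly_eval (arc_point Z) f"
  using assms(1)
proof induction
  case (step x k f)
  have "poly_eval (arc_point X) (symbol x k) = poly_eval (arc_point Z) (symbol x k)"
    using step(1,2) assms(2,3) assms(4)[of k]
    by (elim insertE emptyE; hypsubst) (simp_all only: poly_eval_symbol_currents, auto)
  then show ?case using step by simp
qed simp_all

lemma generic_point:
  "poly_eval (arc_point (matrix_coords 0 0 1 1 1 0)) (symbol cur_f 0) \<noteq> 0"
  "poly_eval (arc_point (matrix_coords 0 0 1 1 1 0)) (symbol cur_e 0) \<noteq> 0"
  by (simp_all add: poly_eval_symbol_currents)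

text \<open>The remainder \<open>f0\<close> is zero: its value does not change when the constant
  coefficient of \<open>yy_form\<close> is moved to 0, and at such a point the equation reads f0 =
  0.\<close>

lemma symbol_ring_cancel:
  assumes "symbol cur_e 0 * f \<in> symbol_ring"
  shows "f \<in> symbol_ring"
proof -
  obtain f0 f1 where f0: "f0 \<in> reduced_ring" and f1: "f1 \<in> symbol_ring"
    and eq: "symbol cur_e 0 * f = f0 + symbol cur_e 0 * f1"
    using symbol_ring_split[OF assms] by metis
  have "f0 = 0"
  proof (rule poly_eval_generic_eq_0[OF generic_point(1)])
    fix p assume p: "poly_eval p (symbol cur_f 0) \<noteq> 0"
    obtain X where X: "p = arc_point X" using arc_point_surj by blast
    have "xx_form X $$ 0 \<noteq> 0" using p by (simp add: X poly_eval_symbol_currents)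
    then obtain Z where Z: "xx_form Z = xx_form X" "xy_form Z = xy_form X"
      "yy_form Z = yy_form X - fps_const (yy_form X $$ 0)"
      using gram_surj by blast
    have "poly_eval p f0 = poly_eval (arc_point Z) f0"
      unfolding X by (rule reduced_ring_eval_cong[OF f0]) (simp_all only: Z, simp)
    also have "\<dots> = 0"
    proof -
      have "poly_eval (arc_point Z) (symbol cur_e 0) = 0"
        unfolding poly_eval_symbol_currents Z by simp
      then show ?thesis
        using arg_cong[OF eq, of "poly_eval (arc_point Z)"] by simp
    qed
    finally show "poly_eval p f0 = 0" .
  qed
  then have eq': "symbol cur_e 0 * f = symbol cur_e 0 * f1" using eq by simp
  have "f - f1 = 0"
  proof (rule poly_eval_generic_eq_0[OF generic_point(2)])
    fix p assume "poly_eval p (symbol cur_e 0) \<noteq> 0"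
    then show "poly_eval p (f - f1) = 0"
      using arg_cong[OF eq', of "poly_eval p"] by simp
  qed
  then show ?thesis using f1 by simp
qed

subsection \<open>Functions of the Gram matrix and a square root\<close>

text \<open>With \<open>s\<close> a square root of \<open>yy_form X\<close>, these are the functions of \<open>X\<close> and \<open>s\<close> in the ring
  generated by the symbols and \<open>s $$ 0\<close>, respectively in its localisation at \<open>s $$ 0\<close>.\<close>

definition root_poly :: "((sl2_index letter \<Rightarrow> complex fps) \<Rightarrow> complex fps \<Rightarrow> complex) \<Rightarrow> bool" where
  "root_poly \<phi> \<longleftrightarrow> (\<exists>f0\<in>symbol_ring. \<exists>f1\<in>symbol_ring. \<forall>X s. s * s = yy_form X \<longrightarrow> s $$ 0 \<noteq> 0 \<longrightarrow>
     \<phi> X s = poly_eval (arc_point X) f0 + s $$ 0 * poly_eval (arc_point X) f1)"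

definition root_regular :: "((sl2_index letter \<Rightarrow> complex fps) \<Rightarrow> complex fps \<Rightarrow> complex) \<Rightarrow> bool" where
  "root_regular \<phi> \<longleftrightarrow> (\<exists>N. root_poly (\<lambda>X s. (s $$ 0) ^ N * \<phi> X s))"

lemma root_poly_symbol_ring:
  assumes "f \<in> symbol_ring" shows "root_poly (\<lambda>X s. poly_eval (arc_point X) f)"
  unfolding root_poly_def by (rule bexI[OF _ assms], rule bexI[OF _ symbol_ring_zero]) simp

lemma root_poly_const: "root_poly (\<lambda>X s. c)"
  using root_poly_symbol_ring[OF symbol_ring.scale[OF symbol_ring.one], of c] by simp

lemma root_poly_root: "root_poly (\<lambda>X s. s $$ 0)"
  unfolding root_poly_def by (rule bexI[OF _ symbol_ring_zero], rule bexI[OF _ symbol_ring.one]) simp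

lemma root_poly_add: "root_poly \<phi> \<Longrightarrow> root_poly \<psi> \<Longrightarrow> root_poly (\<lambda>X s. \<phi> X s + \<psi> X s)"
  unfolding root_poly_def
proof (elim bexE)
  fix f0 f1 g0 g1
  assume "f0 \<in> symbol_ring" "f1 \<in> symbol_ring" "g0 \<in> symbol_ring" "g1 \<in> symbol_ring"
    and "\<forall>X s. s * s = yy_form X \<longrightarrow> s $$ 0 \<noteq> 0 \<longrightarrow> \<phi> X s = poly_eval (arc_point X) f0 + s $$ 0 * poly_eval (arc_point X) f1"
    and "\<forall>X s. s * s = yy_form X \<longrightarrow> s $$ 0 \<noteq> 0 \<longrightarrow> \<psi> X s = poly_eval (arc_point X) g0 + s $$ 0 * poly_eval (arc_point X) g1"
  then show "\<exists>f0\<in>symbol_ring. \<exists>f1\<in>symbol_ring. \<forall>X s. s * s = yy_form X \<longrightarrow> s $$ 0 \<noteq> 0 \<longrightarrow>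
     \<phi> X s + \<psi> X s = poly_eval (arc_point X) f0 + s $$ 0 * poly_eval (arc_point X) f1"
    by (intro bexI[of _ "f0 + g0"] bexI[of _ "f1 + g1"])
      (auto simp: distrib_left intro: symbol_ring.add)
qed

lemma root_square:
  assumes "s * s = yy_form X"
  shows "s $$ 0 * s $$ 0 = poly_eval (arc_point X) (fock_scale (1/4) (symbol cur_e 0))"
  using arg_cong[OF assms, of "\<lambda>f. f $$ 0"] by (simp add: poly_eval_symbol_currents)

text \<open>Even and odd parts multiply as in a quadratic extension, since the square of
  \<open>s $$ 0\<close> lies in the ring by \<open>root_square\<close>.\<close>

lemma root_poly_mult: "root_poly \<phi> \<Longrightarrow> root_poly \<psi> \<Longrightarrow> root_poly (\<lambda>X s. \<phi> X s * \<psi> X s)"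
  unfolding root_poly_def
proof (elim bexE)
  fix f0 f1 g0 g1
  let ?q = "fock_scale (1/4) (symbol cur_e 0)"
  assume m: "f0 \<in> symbol_ring" "f1 \<in> symbol_ring" "g0 \<in> symbol_ring" "g1 \<in> symbol_ring"
    and f: "\<forall>X s. s * s = yy_form X \<longrightarrow> s $$ 0 \<noteq> 0 \<longrightarrow> \<phi> X s = poly_eval (arc_point X) f0 + s $$ 0 * poly_eval (arc_point X) f1"
    and g: "\<forall>X s. s * s = yy_form X \<longrightarrow> s $$ 0 \<noteq> 0 \<longrightarrow> \<psi> X s = poly_eval (arc_point X) g0 + s $$ 0 * poly_eval (arc_point X) g1"
  have q: "?q \<in> symbol_ring" by (intro symbol_ring.scale symbol_in_ring) simp
  show "\<exists>f0\<in>symbol_ring. \<exists>f1\<in>symbol_ring. \<forall>X s. s * s = yy_form X \<longrightarrow> s $$ 0 \<noteq> 0 \<longrightarrow>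
     \<phi> X s * \<psi> X s = poly_eval (arc_point X) f0 + s $$ 0 * poly_eval (arc_point X) f1"
  proof (rule bexI[of _ "f0 * g0 + ?q * (f1 * g1)"], rule bexI[of _ "f0 * g1 + f1 * g0"], intro allI impI)
    show "f0 * g0 + ?q * (f1 * g1) \<in> symbol_ring"
      by (intro symbol_ring.add symbol_ring_mult m q)
    show "f0 * g1 + f1 * g0 \<in> symbol_ring"
      by (intro symbol_ring.add symbol_ring_mult m)
    fix X :: "sl2_index letter \<Rightarrow> complex fps" and s assume s: "s * s = yy_form X" "s $$ 0 \<noteq> 0"
    let ?e = "poly_eval (arc_point X)"
    have "\<phi> X s * \<psi> X s = ?e f0 * ?e g0 + (s $$ 0 * s $$ 0) * (?e f1 * ?e g1) + s $$ 0 * (?e f0 * ?e g1 + ?e f1 * ?e g0)"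
      using f g s by (simp add: algebra_simps)
    then show "\<phi> X s * \<psi> X s = ?e (f0 * g0 + ?q * (f1 * g1)) + s $$ 0 * ?e (f0 * g1 + f1 * g0)"
      unfolding root_square[OF s(1)] by (simp only: poly_eval_add poly_eval_mult)
  qed
qed

lemma root_poly_power: "root_poly (\<lambda>X s. (s $$ 0) ^ n)"
  by (induction n) (simp_all add: root_poly_const root_poly_mult root_poly_root)

lemma root_regular_poly: "root_poly \<phi> \<Longrightarrow> root_regular \<phi>"
  unfolding root_regular_def by (rule exI[of _ 0]) simp

lemma root_regular_add:
  assumes "root_regular \<phi>" "root_regular \<psi>"
  shows "root_regular (\<lambda>X s. \<phi> X s + \<psi> X s)"
proof -
  obtain M N where M: "root_poly (\<lambda>X s. (s $$ 0) ^ M * \<phi> X s)" and N: "root_poly (\<lambda>X s. (s $$ 0) ^ N * \<psi> X s)"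
    using assms by (auto simp: root_regular_def)
  have "root_poly (\<lambda>X s. (s $$ 0) ^ N * ((s $$ 0) ^ M * \<phi> X s) + (s $$ 0) ^ M * ((s $$ 0) ^ N * \<psi> X s))"
    by (intro root_poly_add root_poly_mult[OF root_poly_power] M N)
  then show ?thesis
    unfolding root_regular_def by (intro exI[of _ "M + N"]) (simp add: power_add algebra_simps)
qed

lemma root_regular_mult:
  assumes "root_regular \<phi>" "root_regular \<psi>"
  shows "root_regular (\<lambda>X s. \<phi> X s * \<psi> X s)"
proof -
  obtain M N where M: "root_poly (\<lambda>X s. (s $$ 0) ^ M * \<phi> X s)" and N: "root_poly (\<lambda>X s. (s $$ 0) ^ N * \<psi> X s)"
    using assms by (auto simp: root_regular_def)
  have "root_poly (\<lambda>X s. ((s $$ 0) ^ M * \<phi> X s) * ((s $$ 0) ^ N * \<psi> X s))"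
    by (intro root_poly_mult M N)
  then show ?thesis
    unfolding root_regular_def by (intro exI[of _ "M + N"]) (simp add: power_add mult_ac)
qed

lemma root_regular_const: "root_regular (\<lambda>X s. c)"
  by (rule root_regular_poly[OF root_poly_const])

lemma root_regular_sum: "(\<And>i. i \<in> A \<Longrightarrow> root_regular (\<phi> i)) \<Longrightarrow> root_regular (\<lambda>X s. \<Sum>i\<in>A. \<phi> i X s)"
  by (induction A rule: infinite_finite_induct) (simp_all add: root_regular_const root_regular_add)

lemma root_regular_cong:
  assumes "root_regular \<phi>" "\<And>X s. s * s = yy_form X \<Longrightarrow> s $$ 0 \<noteq> 0 \<Longrightarrow> \<phi> X s = \<psi> X s"
  shows "root_regular \<psi>"
  using assms unfolding root_regular_def root_poly_def by auto

lemma root_regular_inverse: "root_regular (\<lambda>X s. inverse (s $$ 0))"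
proof -
  have "root_poly (\<lambda>X s. (s $$ 0) ^ 1 * inverse (s $$ 0))"
    using root_poly_const[of 1] unfolding root_poly_def by auto
  then show ?thesis unfolding root_regular_def by blast
qed

lemma root_regular_yy: "root_regular (\<lambda>X s. yy_form X $$ k)"
  and root_regular_xx: "root_regular (\<lambda>X s. xx_form X $$ k)"
  and root_regular_xy: "root_regular (\<lambda>X s. xy_form X $$ k)"
proof -
  have reg: "root_regular (\<lambda>X s. poly_eval (arc_point X) (fock_scale c (symbol x k)))"
    if "x \<in> {cur_e, cur_f, cur_h}" for x c
    by (intro root_regular_poly root_poly_symbol_ring symbol_ring.scale symbol_in_ring that)
  show "root_regular (\<lambda>X s. yy_form X $$ k)"
    by (rule root_regular_cong[OF reg[of cur_e "1/4"]]) (simp_all add: poly_eval_symbol_currents)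
  show "root_regular (\<lambda>X s. xx_form X $$ k)"
    by (rule root_regular_cong[OF reg[of cur_f "-4"]]) (simp_all add: poly_eval_symbol_currents)
  show "root_regular (\<lambda>X s. xy_form X $$ k)"
    by (rule root_regular_cong[OF reg[of cur_h 1]]) (simp_all add: poly_eval_symbol_currents)
qed

text \<open>Coefficient k of \<open>s * s = yy_form X\<close> expresses \<open>s $$ k\<close>
  through earlier coefficients of s, dividing only by \<open>2 * s $$ 0\<close>.\<close>

lemma root_regular_root: "root_regular (\<lambda>X s. s $$ k)"
proof (induction k rule: less_induct)
  case (less k)
  show ?case
  proof (cases "k = 0")
    case True
    then show ?thesis by (simp add: root_regular_poly[OF root_poly_root])
  next
    case False
    have "root_regular (\<lambda>X s. (1/2) * (inverse (s $$ 0) * (yy_form X $$ k + (-1) * (\<Sum>i\<in>{1..<k}. s $$ i * s $$ (k - i)))))"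
      using less False by (intro root_regular_add root_regular_mult root_regular_sum root_regular_const
          root_regular_inverse root_regular_yy) auto
    then show ?thesis
    proof (rule root_regular_cong)
      fix X :: "sl2_index letter \<Rightarrow> complex fps" and s assume s: "s * s = yy_form X" "s $$ 0 \<noteq> 0"
      have "yy_form X $$ k = (\<Sum>i\<in>{0..k}. s $$ i * s $$ (k - i))"
        unfolding s(1)[symmetric] by (simp add: fps_mult_nth)
      also have "{0..k} = insert 0 (insert k {1..<k})" using False by auto
      also have "(\<Sum>i\<in>insert 0 (insert k {1..<k}). s $$ i * s $$ (k - i)) = 2 * s $$ 0 * s $$ k + (\<Sum>i\<in>{1..<k}. s $$ i * s $$ (k - i))"
        using False by simp
      finally show "(1/2) * (inverse (s $$ 0) * (yy_form X $$ k + (-1) * (\<Sum>i\<in>{1..<k}. s $$ i * s $$ (k - i)))) = s $$ k"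
        using s(2) by (simp add: field_simps)
    qed
  qed
qed

lemma root_regular_inverse_root: "root_regular (\<lambda>X s. inverse s $$ k)"
proof (induction k rule: less_induct)
  case (less k)
  show ?case
  proof (cases "k = 0")
    case True
    then show ?thesis using root_regular_inverse by simp
  next
    case False
    have "root_regular (\<lambda>X s. (-1) * (inverse (s $$ 0) * (\<Sum>i\<in>{1..k}. s $$ i * inverse s $$ (k - i))))"
      using less False by (intro root_regular_mult root_regular_sum root_regular_const
          root_regular_inverse root_regular_root) auto
    then show ?thesis
    proof (rule root_regular_cong)
      fix s :: "complex fps" assume s: "s $$ 0 \<noteq> 0"
      have "0 = (s * inverse s) $$ k" using inverse_mult_eq_1'[OF s] False by simp
      also have "\<dots> = (\<Sum>i\<in>{0..k}. s $$ i * inverse s $$ (k - i))" by (simp add: fps_mult_nth)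
      also have "{0..k} = insert 0 {1..k}" by auto
      also have "(\<Sum>i\<in>insert 0 {1..k}. s $$ i * inverse s $$ (k - i)) = s $$ 0 * inverse s $$ k + (\<Sum>i\<in>{1..k}. s $$ i * inverse s $$ (k - i))"
        by simp
      finally have "(\<Sum>i\<in>{1..k}. s $$ i * inverse s $$ (k - i)) = - (s $$ 0 * inverse s $$ k)"
        by (simp only: eq_neg_iff_add_eq_0 add.commute)
      then show "(-1) * (inverse (s $$ 0) * (\<Sum>i\<in>{1..k}. s $$ i * inverse s $$ (k - i))) = inverse s $$ k"
        using s by simp
    qed
  qed
qed

section \<open>The normal form as a function of the Gram matrix and the root\<close>

lemma root_regular_fps_mult:
  assumes "\<And>k. root_regular (\<lambda>X s. \<Phi> X s $$ k)" "\<And>k. root_regular (\<lambda>X s. \<Psi> X s $$ k)"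
  shows "root_regular (\<lambda>X s. (\<Phi> X s * \<Psi> X s) $$ k)"
  unfolding fps_mult_nth by (intro root_regular_sum root_regular_mult assms)

lemma root_regular_poly_eval:
  assumes "\<And>b k. root_regular (\<lambda>X s. \<Phi> X s b $$ k)"
  shows "root_regular (\<lambda>X s. poly_eval (arc_point (\<Phi> X s)) f)"
proof (induction f rule: fock_induct)
  case (var x f)
  obtain b k where "x = (b, k)" by (cases x)
  then show ?case using root_regular_mult[OF assms[of b k] var] by (simp add: arc_point_def)
qed (simp_all add: root_regular_const root_regular_add root_regular_mult)

text \<open>The upper left entry w of x once y is diag(s, -s): the invariant tr(xy) is then 2 s
  w.\<close>

definition normal_w where
  "normal_w X s = fps_const (1/2) * (inverse s * xy_form X)"

definition normal_point where
  "normal_point X s = matrix_coords 1 (xx_form X - normal_w X s * normal_w X s) (normal_w X s) 0 0 s"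

lemma root_regular_normal_point: "root_regular (\<lambda>X s. normal_point X s b $$ k)"
proof -
  have w: "root_regular (\<lambda>X s. normal_w X s $$ k)" for k
    unfolding normal_w_def fps_mult_left_const_nth
    by (intro root_regular_mult root_regular_const root_regular_fps_mult root_regular_inverse_root root_regular_xy)
  have w2: "root_regular (\<lambda>X s. 2 * normal_w X s $$ k)" for k
    by (intro root_regular_mult root_regular_const w)
  have "root_regular (\<lambda>X s. xx_form X $$ k + (-1) * (normal_w X s * normal_w X s) $$ k)" for k
    by (intro root_regular_add root_regular_mult root_regular_const root_regular_fps_mult root_regular_xx w)
  then have "root_regular (\<lambda>X s. (xx_form X - normal_w X s * normal_w X s) $$ k)" for k
    by simp
  then show ?thesis
    unfolding normal_point_def
    using letter_cases[of b] w w2 root_regular_root root_regular_const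
    by (elim insertE emptyE) (simp_all add: numeral_fps_const)
qed

text \<open>Writing w for \<open>normal_w X s\<close>, four times
  \<open>yy_form X * (xx_form X - w * w)\<close> is the Gram determinant
  \<open>4 * xx_form X * yy_form X - xy_form X * xy_form X\<close>; so \<open>det\<close> makes the
  entry \<open>xx_form X - w * w\<close> a unit.\<close>

lemma arc_invariant_normal_point:
  assumes f: "arc_invariant f"
    and s: "s * s = yy_form X" "s $$ 0 \<noteq> 0" and X: "X (Gamma Ie) $$ 0 \<noteq> 0"
    and det: "4 * (xx_form X $$ 0 * yy_form X $$ 0) \<noteq> xy_form X $$ 0 * xy_form X $$ 0"
  shows "poly_eval (arc_point X) f = poly_eval (arc_point (normal_point X s)) f"
proof -
  let ?h = "fps_const (1/2) * X (Beta Ih)" and ?w = "normal_w X s"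
  have two: "2 * fps_const (1/2) = (1 :: complex fps)" by (simp add: numeral_fps_const)
  have h2: "2 * ?h = X (Beta Ih)" using two by (simp add: mult.assoc[symmetric])
  have XM: "matrix_coords (X (Beta Ie)) (X (Beta If)) ?h (X (Gamma If)) (X (Gamma Ie)) (X (Gamma Ih)) = X"
  proof
    fix b show "matrix_coords (X (Beta Ie)) (X (Beta If)) ?h (X (Gamma If)) (X (Gamma Ie)) (X (Gamma Ih)) b = X b"
      using letter_cases[of b] h2 by auto
  qed
  have w: "2 * s * ?w = 2 * ?h * X (Gamma Ih) + X (Beta Ie) * X (Gamma Ie) + X (Beta If) * X (Gamma If)"
  proof -
    have "2 * s * ?w = (2 * fps_const (1/2)) * (s * inverse s) * xy_form X"
      by (simp add: normal_w_def mult_ac)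
    then show ?thesis unfolding two h2 inverse_mult_eq_1'[OF s(2)] by simp
  qed
  have xx: "?h * ?h + X (Beta Ie) * X (Beta If) = xx_form X"
    by (simp add: mult_ac)
  have det': "(?h * ?h + X (Beta Ie) * X (Beta If) - ?w * ?w) $$ 0 \<noteq> 0"
  proof
    assume "(?h * ?h + X (Beta Ie) * X (Beta If) - ?w * ?w) $$ 0 = 0"
    then have 1: "xx_form X $$ 0 = ?w $$ 0 * ?w $$ 0" unfolding xx by simp
    have 2: "yy_form X $$ 0 = s $$ 0 * s $$ 0" unfolding s(1)[symmetric] by simp
    have 3: "xy_form X $$ 0 = 2 * (s $$ 0 * ?w $$ 0)"
      using arg_cong[OF w, of "\<lambda>f. f $$ 0"] unfolding h2 by (simp add: mult.assoc)
    show False using det unfolding 1 2 3 by simp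
  qed
  have "poly_eval (arc_point (matrix_coords (X (Beta Ie)) (X (Beta If)) ?h (X (Gamma If)) (X (Gamma Ie)) (X (Gamma Ih)))) f
     = poly_eval (arc_point (matrix_coords 1 (?h * ?h + X (Beta Ie) * X (Beta If) - ?w * ?w) ?w 0 0 s)) f"
    using arc_invariant_elementary[OF f] s X w det'
    by (intro elementary_normal_form[where F = "\<lambda>xe xf xh ye yf yh. poly_eval (arc_point (matrix_coords xe xf xh ye yf yh)) f"]) auto
  then show ?thesis unfolding XM xx normal_point_def .
qed

text \<open>The value at the normal form depends on the chosen root, the value at the point does not;
  comparing both roots leaves the part that is even in the root.\<close>

lemma arc_invariant_in_symbol_ring:
  assumes "arc_invariant f"
  shows "f \<in> symbol_ring"
proof -
  obtain N where "root_poly (\<lambda>X s. (s $$ 0) ^ N * poly_eval (arc_point (normal_point X s)) f)"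
    using root_regular_poly_eval[of normal_point f] root_regular_normal_point unfolding root_regular_def by blast
  \<comment> \<open>Doubling the exponent makes the denominator a power of the square of
    \<open>s $$ 0\<close>, hence even in the root and a polynomial in the symbols.\<close>
  then have "root_poly (\<lambda>X s. (s $$ 0) ^ N * ((s $$ 0) ^ N * poly_eval (arc_point (normal_point X s)) f))"
    by (rule root_poly_mult[OF root_poly_power])
  then obtain f0 f1 where f0: "f0 \<in> symbol_ring" and
    eq: "\<And>X s. s * s = yy_form X \<Longrightarrow> s $$ 0 \<noteq> 0 \<Longrightarrow> (s $$ 0) ^ N * ((s $$ 0) ^ N * poly_eval (arc_point (normal_point X s)) f)
      = poly_eval (arc_point X) f0 + s $$ 0 * poly_eval (arc_point X) f1"
    unfolding root_poly_def by blast
  let ?q = "fock_scale (1/4) (symbol cur_e 0)"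
  \<comment> \<open>The Gram determinant at t = 0; the factor -4 compensates the constants 4 and
    -1/4 in \<open>poly_eval_symbol_currents\<close>. The product \<open>?g\<close> collects the
    conditions under which the normal form is available.\<close>
  let ?d = "fock_scale (- 4) (symbol cur_f 0 * symbol cur_e 0) - symbol cur_h 0 * symbol cur_h 0"
  let ?g = "fock_var (Gamma Ie, 0) * (?q * ?d)"
  have "?q ^ N * f - f0 = 0"
  proof (rule poly_eval_generic_eq_0)
    show "poly_eval (arc_point (matrix_coords 0 0 1 1 1 0)) ?g \<noteq> 0"
      by (simp add: poly_eval_symbol_currents) (simp add: arc_point_def)
    fix p assume g: "poly_eval p ?g \<noteq> 0"
    obtain X where X: "p = arc_point X" using arc_point_surj by blast
    define A B C where "A = xx_form X $$ 0" and "B = yy_form X $$ 0" and "C = xy_form X $$ 0"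
    have "poly_eval p ?g = X (Gamma Ie) $$ 0 * (B * (4 * (A * B) - C * C))"
      unfolding X poly_eval_mult poly_eval_diff poly_eval_scale poly_eval_symbol_currents poly_eval_var
        A_def[symmetric] B_def[symmetric] C_def[symmetric]
      by (simp add: arc_point_def)
    with g have ne: "X (Gamma Ie) $$ 0 \<noteq> 0" "yy_form X $$ 0 \<noteq> 0"
      "4 * (xx_form X $$ 0 * yy_form X $$ 0) \<noteq> xy_form X $$ 0 * xy_form X $$ 0"
      unfolding A_def[symmetric] B_def[symmetric] C_def[symmetric] by auto
    obtain s where s: "s * s = yy_form X" using fps_sqrt_exists[OF ne(2)] by blast
    then have s0: "s $$ 0 \<noteq> 0" using ne(2) by (metis fps_mult_nth_0 mult_zero_left)
    have ev: "(t $$ 0) ^ N * ((t $$ 0) ^ N * poly_eval p f) = poly_eval p f0 + t $$ 0 * poly_eval p f1"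
      if "t * t = yy_form X" "t $$ 0 \<noteq> 0" for t
      unfolding X arc_invariant_normal_point[OF assms that ne(1,3)] by (rule eq[OF that])
    have pow: "(t $$ 0) ^ N * ((t $$ 0) ^ N * c) = (t $$ 0 * t $$ 0) ^ N * c" for t :: "complex fps" and c
      by (simp add: power_mult_distrib)
    have "(s $$ 0 * s $$ 0) ^ N * poly_eval p f = poly_eval p f0"
      using ev[OF s s0] ev[of "- s"] s s0 unfolding pow by simp
    moreover have "poly_eval p (?q ^ N) = (s $$ 0 * s $$ 0) ^ N"
      unfolding root_square[OF s] X[symmetric] by (induction N) simp_all
    ultimately show "poly_eval p (?q ^ N * f - f0) = 0" by simp
  qed
  then have "?q ^ N * f \<in> symbol_ring" using f0 by simp
  then show ?thesis
  \<comment> \<open>Each step cancels one factor \<open>?q\<close>, a multiple of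
    \<open>symbol cur_e 0\<close>.\<close>
  proof (induction N)
    case (Suc N)
    have "symbol cur_e 0 * (?q ^ N * f) = fock_scale 4 (?q ^ Suc N * f)"
      by (simp add: mult.assoc)
    then show ?case using Suc symbol_ring_cancel symbol_ring.scale by metis
  qed simp
qed

section \<open>From leading terms to the commutant\<close>

lemma commutant_theta_subset:
  assumes "\<And>n. n \<ge> 0 \<Longrightarrow> fock_nprod theta_e n v = 0 \<and> fock_nprod theta_f n v = 0"
  shows "v \<in> sl2_words"
proof -
  have "v \<in> sl2_words" if "deg_lt d v" "\<And>n. n \<ge> 0 \<Longrightarrow> fock_nprod theta_e n v = 0 \<and> fock_nprod theta_f n v = 0" for d v
    using that
  proof (induction d arbitrary: v)
    case 0
    then show ?case using deg_lt_0 sl2_words_zero by blast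
  next
    case (Suc d)
    let ?g = "fhom d v"
    have "?g \<in> symbol_ring"
      using arc_invariant_leading[OF Suc.prems(2,1)] by (rule arc_invariant_in_symbol_ring)
    moreover have "fhom d ?g = ?g" by (rule poly_mapping_eqI) simp
    ultimately obtain a where a: "a \<in> sl2_words" "deg_lt d (a - ?g)"
      using sl2_words_leading[of ?g d] by auto
    have "deg_lt d ((v - ?g) - (a - ?g))"
      by (intro deg_lt_diff deg_lt_fhom Suc.prems(1) a(2))
    then have "deg_lt d (v - a)" by simp
    \<comment> \<open>The nonnegative modes of the adjoint currents annihilate words, so
      \<open>v - a\<close> satisfies the hypothesis again, in lower degree.\<close>
    then have "v - a \<in> sl2_words"
      using Suc.prems(2) theta_nprod_words[OF _ a(1)]
      by (intro Suc.IH) (auto simp: nprod_diff_right)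
    then show ?case using sl2_words.add[OF _ a(1)] by fastforce
  qed
  then show ?thesis using deg_lt_exists assms by blast
qed

theorem theorem5p4:
  fixes W :: "('a::ab_group_add) vertex_data"
    and \<iota> :: "sl2 \<Rightarrow> 'a"
    and \<psi> :: "'a \<Rightarrow> sl2_index fock"
  assumes "current_algebra sl2_bracket (\<lambda>x y. - (3/8) * sl2_killing x y) W \<iota>"
    and "vertex_hom W beta_gamma_system \<psi>"
    and "\<psi> (\<iota> sl2_e) = fock_scale 4
           (wick (gamma sl2_h) (gamma sl2_h) + wick (gamma sl2_e) (gamma sl2_f))"
    and "\<psi> (\<iota> sl2_f) = fock_scale (- (1/16))
           (wick (beta sl2_h) (beta sl2_h) + fock_scale 4 (wick (beta sl2_e) (beta sl2_f)))"
    and "\<psi> (\<iota> sl2_h) = wick (beta sl2_h) (gamma sl2_h) + wick (beta sl2_e) (gamma sl2_e)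
           + wick (beta sl2_f) (gamma sl2_f)"
  shows "howe_pair (range \<psi>) beta_gamma_system"
proof -
  have range: "range \<psi> = sl2_words"
    by (rule range_eq_sl2_words[OF assms(1,2)])
      (use assms(3-5) in \<open>simp_all only: beta_gamma_basis wick_var currents_def\<close>)
  have "vertex_subalgebra beta_gamma_system (range \<psi>)"
    unfolding vertex_subalgebra_def
    using assms(2) by (auto simp: vertex_hom_def) (metis rangeI)+
  then show ?thesis
    unfolding range using commutant_theta_subset by (rule howe_pair_sl2_words)
qed

end
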